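(* Let $d\ge 1$ be an integer and let $1+t^{i_1}+t^{i_2}+t^{i_3}$ be a polynomial, where $i_1,i_2,i_3$ are integers with $1 \leq i_1 \leq i_2 \leq i_3 \leq d$. Then there exists an integral polytope $\mathcal{P} \subset \mathbb{R}^d$ of dimension $d$ whose $\delta$-polynomial equals $1+t^{i_1}+t^{i_2}+t^{i_3}$ if and only if $(i_1,i_2,i_3)$ satisfies $$i_3 \leq i_1+i_2,\qquad i_1+i_3 \leq d+1,\qquad i_2 \leq \lfloor (d+1)/2\rfloor,$$ and the additional condition $$2i_2 \leq i_1+i_3 \quad\text{or}\quad i_2+i_3 \leq d+1.$$ Moreover, all these polytopes can be chosen to be simplices: whenever these conditions hold, there is an integral simplex in $\mathbb{R}^d$ of dimension $d$ whose $\delta$-polynomial equals $1+t^{i_1}+t^{i_2}+t^{i_3}$.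
   Context: An integral polytope is a convex polytope all of whose vertices have integer coordinates. For an integral polytope $\mathcal{P}\subset\mathbb{R}^N$ of dimension $d$ and an integer $n\ge 1$, let $i(\mathcal{P},n)=|n\mathcal{P}\cap\mathbb{Z}^N|$, where $n\mathcal{P}=\{n\alpha:\alpha\in\mathcal{P}\}$. The integers $\delta_0,\delta_1,\delta_2,\ldots$ are defined by $$(1-\lambda)^{d+1}\Big(1+\sum_{n=1}^{\infty} i(\mathcal{P},n)\lambda^n\Big)=\sum_{i\ge 0}\delta_i\lambda^i ;$$ one has $\delta_i=0$ for $i>d$. The vector $(\delta_0,\delta_1,\ldots,\delta_d)$ is the $\delta$-vector of $\mathcal{P}$ and $\delta_{\mathcal{P}}(t)=\delta_0+\delta_1t+\cdots+\delta_dt^d$ is the $\delta$-polynomial of $\mathcal{P}$. *)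

theory Defs
  imports "HOL-Analysis.Analysis" "HOL-Computational_Algebra.Computational_Algebra"
begin

definition integer_points :: "(real ^ 'n) set" where
  "integer_points = {x. \<forall>i. x $ i \<in> \<int>}"

definition integral_polytope :: "(real ^ 'n) set \<Rightarrow> bool" where
  "integral_polytope P \<longleftrightarrow>
     polytope P \<and> (\<forall>v. v extreme_point_of P \<longrightarrow> v \<in> integer_points)"

definition ehrhart_count :: "(real ^ 'n) set \<Rightarrow> nat \<Rightarrow> nat" where
  "ehrhart_count P n = card (((\<lambda>x. real n *\<^sub>R x) ` P) \<inter> integer_points)"

definition ehrhart_series :: "(real ^ 'n) set \<Rightarrow> int fps" where
  "ehrhart_series P = Abs_fps (\<lambda>n. if n = 0 then 1 else int (ehrhart_count P n))"

text \<open>The dimension of \<open>P\<close> enters through \<^const>\<open>aff_dim\<close>, which is integer-valued and equals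
  \<open>- 1\<close> only for the empty set; so for nonempty \<open>P\<close> the conversion \<^const>\<open>nat\<close> loses nothing.\<close>

definition delta :: "(real ^ 'n) set \<Rightarrow> nat \<Rightarrow> int" where
  "delta P i = fps_nth ((1 - fps_X) ^ (nat (aff_dim P) + 1) * ehrhart_series P) i"

definition delta_poly :: "(real ^ 'n) set \<Rightarrow> int poly" where
  "delta_poly P = (\<Sum>i\<le>nat (aff_dim P). monom (delta P i) i)"

end

theory Submission imports Defs
begin

text \<open>An integral polytope \<open>P\<close> of dimension \<open>d\<close> is studied through the cone over \<open>P \<times> {1}\<close> in
\<open>\<real>\<^sup>d \<times> \<real>\<close>, graded by the last coordinate (the height). A regular triangulation cuts this cone into
simplicial cones, and pushing every point in a fixed generic direction \<open>w\<close> of the cone decides to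
which simplicial cone a boundary point belongs, so that the lattice points of the cone become a
disjoint union of lattice points of half-open simplicial cones
(\<open>half_open_decomposition\<close>). In a half-open simplicial cone with generators \<open>b\<close> of height one, each
lattice point is uniquely a point of the half-open box spanned by the generators plus a sum of
generators, so multiplying the series by \<open>(1 - \<lambda>)^(d + 1)\<close> leaves the box points. Hence
\<open>\<delta>\<^sub>i\<close> is the number of box points of height \<open>i\<close> in all the simplices together
(\<open>delta_eq_box_count\<close>). The box points of one simplex represent the finite group of lattice points
modulo the lattice spanned by the generators, and if \<open>\<delta> = 1 + t^i1 + t^i2 + t^i3\<close>, these
groups have four elements in total.

Necessity, for a simplex: there is one group of order four. If it is \<open>\<int>/4\<close>, the barycentric
coordinates of a generator are quarters, and the three heights are determined by the numbers \<open>a\<close>,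
\<open>b\<close>, \<open>c\<close> of coordinates \<open>1/4\<close>, \<open>1/2\<close>, \<open>3/4\<close>; if it is the Klein four-group, all coordinates
are \<open>0\<close> or \<open>1/2\<close> and again three numbers with \<open>a + b + c \<le> d + 1\<close> give the heights
(\<open>order_four_box\<close>). All four conditions are then linear inequalities in \<open>a\<close>, \<open>b\<close>, \<open>c\<close>
(\<open>simplex_exponents\<close>).

Necessity, for more than \<open>d + 1\<close> vertices: now \<open>\<delta>\<^sub>1 \<ge> 1\<close>, so \<open>i1 = 1\<close>. Pushing in the direction
\<open>-w\<close> describes the lattice points in the interior of the cone, whose box points are those for \<open>w\<close>
reflected at the sum of the generators; this is Ehrhart reciprocity. If \<open>i3 \<ge> i2 + 2\<close>, the first
interior level has one point and the next has only \<open>d + 1\<close>, although adding the lattice points of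
\<open>P\<close> to the former gives more than \<open>d + 1\<close> (\<open>codegree_bound\<close>). So \<open>i3 \<le> i2 + 1\<close>, and only \<open>i2 \<ge> 2\<close>
remains, where \<open>\<delta>\<^sub>1 = 1\<close> forces exactly \<open>d + 2\<close> vertices. They satisfy one linear relation, and
omitting one vertex with positive coefficient at a time gives a triangulation. With three or more
such simplices, the zero elements of their groups have heights \<open>0, 1, 2, \<dots>\<close>, so \<open>i2 = 2\<close>. With two
simplices, the group orders are \<open>1, 3\<close> or \<open>2, 2\<close>, and the identity \<open>ht g + ht (- g) = |supp g| \<le> d + 1\<close>
in these groups gives the bounds on \<open>i2\<close> (\<open>circuit_exponents\<close>).

Sufficiency: a simplex with vertices \<open>0\<close>, unit vectors and one further vertex \<open>4 e\<^sub>s - \<Sum> f\<^sub>i e\<^sub>i\<close> has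
a cyclic group of order four with prescribed weights \<open>f\<close> (\<open>cyclic_simplex_delta\<close>). Solving the
equations for the heights for \<open>a\<close>, \<open>b\<close>, \<open>c\<close> shows that the heights \<open>(i1, i2, i3)\<close> of \<open>g\<close>, \<open>2g\<close>, \<open>3g\<close>
can be attained if, besides the common conditions, \<open>2 * i2 \<le> i1 + i3\<close>, and \<open>(i2, i1, i3)\<close> if \<open>i2 + i3 \<le> d + 1\<close>.\<close>

section \<open>Coordinates with respect to a basis\<close>

text \<open>Coordinates are taken with respect to bases consisting of arbitrary vectors, here the vertices of a simplex placed at height one.\<close>

definition is_basis :: "'a::euclidean_space set \<Rightarrow> bool" where
  "is_basis B \<longleftrightarrow> independent B \<and> span B = UNIV"

lemma basis_finite: "is_basis B \<Longrightarrow> finite B"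
  by (simp add: is_basis_def independent_imp_finite)

lemma basis_card: "is_basis (B :: 'a::euclidean_space set) \<Longrightarrow> card B = DIM('a)"
  unfolding is_basis_def by (metis dim_UNIV dim_span indep_card_eq_dim_span)

lemma basis_expand: "is_basis B \<Longrightarrow> (\<Sum>b\<in>B. representation B x b *\<^sub>R b) = x"
  by (rule real_vector.sum_representation_eq) (auto simp: is_basis_def independent_imp_finite)

lemma representation_add: "is_basis B \<Longrightarrow> representation B (x + y) b = representation B x b + representation B y b"
  by (simp add: is_basis_def real_vector.representation_add)
lemma representation_diff: "is_basis B \<Longrightarrow> representation B (x - y) b = representation B x b - representation B y b"
  by (simp add: is_basis_def real_vector.representation_diff)
lemma representation_scaleR: "is_basis B \<Longrightarrow> representation B (r *\<^sub>R x) b = r * representation B x b"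
  by (simp add: is_basis_def real_vector.representation_scale)
lemma representation_uminus: "is_basis B \<Longrightarrow> representation B (- x) b = - representation B x b"
  by (simp add: is_basis_def real_vector.representation_neg)
lemma representation_sum: "is_basis B \<Longrightarrow> representation B (sum f I) b = (\<Sum>i\<in>I. representation B (f i) b)"
  by (simp add: is_basis_def real_vector.representation_sum)
lemma representation_self: "is_basis B \<Longrightarrow> b' \<in> B \<Longrightarrow> representation B b' b = (if b = b' then 1 else 0)"
  by (simp add: is_basis_def real_vector.representation_basis)

lemma representation_unique:
  assumes B: "is_basis B" and x: "x = (\<Sum>b\<in>B. f b *\<^sub>R b)" and b: "b \<in> B"
  shows "representation B x b = f b"
proof -
  have "representation B x b = (\<Sum>b'\<in>B. f b' * representation B b' b)"
    unfolding x by (simp add: representation_sum[OF B] representation_scaleR[OF B])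
  also have "\<dots> = (\<Sum>b'\<in>B. if b' = b then f b' else 0)"
    by (rule sum.cong) (auto simp: representation_self[OF B])
  also have "\<dots> = f b" using b basis_finite[OF B] by simp
  finally show ?thesis .
qed

lemma basis_eqI: "is_basis B \<Longrightarrow> (\<And>b. b \<in> B \<Longrightarrow> representation B x b = representation B y b) \<Longrightarrow> x = y"
  by (metis (no_types, lifting) basis_expand sum.cong)

lemma linear_as_coordinates:
  assumes B: "is_basis B" and "linear f"
  shows "f x = (\<Sum>b\<in>B. representation B x b *\<^sub>R f b)"
  by (subst basis_expand[OF B, of x, symmetric]) (simp add: linear_sum[OF assms(2)] linear_scale[OF assms(2)] del: basis_expand)

lemma basis_exchange:
  assumes B: "is_basis B" and b: "b0 \<in> B" and nz: "representation B v b0 \<noteq> 0"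
  shows "is_basis (insert v (B - {b0}))"
proof -
  have fin: "finite B" using basis_finite[OF B] .
  let ?r = "representation B v"
  have v: "v = ?r b0 *\<^sub>R b0 + (\<Sum>b\<in>B-{b0}. ?r b *\<^sub>R b)"
    using basis_expand[OF B, of v] sum.remove[OF fin b, of "\<lambda>b. ?r b *\<^sub>R b"] by simp
  have "b0 = (1 / ?r b0) *\<^sub>R (?r b0 *\<^sub>R b0)" using nz by simp
  also have "?r b0 *\<^sub>R b0 = v - (\<Sum>b\<in>B-{b0}. ?r b *\<^sub>R b)"
    using v by (metis add_diff_cancel_right')
  also have "(1 / ?r b0) *\<^sub>R (v - (\<Sum>b\<in>B-{b0}. ?r b *\<^sub>R b)) \<in> span (insert v (B - {b0}))"
    by (intro span_scale span_diff span_sum span_base) auto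
  finally have "b0 \<in> span (insert v (B - {b0}))" .
  then have "B \<subseteq> span (insert v (B - {b0}))" using span_base[of _ "insert v (B - {b0})"] by fastforce
  then have sp: "span (insert v (B - {b0})) = UNIV"
    using B span_minimal[OF _ subspace_span] by (metis is_basis_def top.extremum_uniqueI)
  moreover have "card (insert v (B - {b0})) \<le> card B"
    using fin b by (metis One_nat_def Suc_pred card_Diff_singleton card_gt_0_iff card_insert_le_m1 empty_iff order_refl finite_Diff)
  ultimately have "independent (insert v (B - {b0}))"
    using basis_card[OF B] fin by (intro card_le_dim_spanning[of _ UNIV]) (auto simp: )
  with sp show ?thesis by (simp add: is_basis_def)
qed

section \<open>Conic hulls and bases\<close>

definition conic_hull :: "'a::euclidean_space set \<Rightarrow> 'a set" where
  "conic_hull V = {x. \<exists>a. (\<forall>v\<in>V. 0 \<le> a v) \<and> x = (\<Sum>v\<in>V. a v *\<^sub>R v)}"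

lemma conic_hullI: "(\<And>v. v \<in> V \<Longrightarrow> 0 \<le> a v) \<Longrightarrow> (\<Sum>v\<in>V. a v *\<^sub>R v) \<in> conic_hull V"
  unfolding conic_hull_def by blast

lemma conic_hull_add: assumes "x \<in> conic_hull V" "y \<in> conic_hull V" shows "x + y \<in> conic_hull V"
proof -
  obtain a b where "\<forall>v\<in>V. 0 \<le> a v" "x = (\<Sum>v\<in>V. a v *\<^sub>R v)" "\<forall>v\<in>V. 0 \<le> b v" "y = (\<Sum>v\<in>V. b v *\<^sub>R v)"
    using assms unfolding conic_hull_def by auto
  then show ?thesis using conic_hullI[of V "\<lambda>v. a v + b v"] by (simp add: sum.distrib scaleR_add_left)
qed

lemma conic_hull_scale: assumes "x \<in> conic_hull V" "0 \<le> r" shows "r *\<^sub>R x \<in> conic_hull V"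
proof -
  obtain a where "\<forall>v\<in>V. 0 \<le> a v" "x = (\<Sum>v\<in>V. a v *\<^sub>R v)"
    using assms unfolding conic_hull_def by auto
  then show ?thesis using conic_hullI[of V "\<lambda>v. r * a v"] assms(2) by (simp add: scaleR_sum_right)
qed

lemma conic_hull_mono:
  assumes "finite V" "B \<subseteq> V" shows "conic_hull B \<subseteq> conic_hull V"
proof
  fix x assume "x \<in> conic_hull B"
  then obtain a where a: "\<forall>v\<in>B. 0 \<le> a v" "x = (\<Sum>v\<in>B. a v *\<^sub>R v)" unfolding conic_hull_def by auto
  have "x = (\<Sum>v\<in>V. (if v \<in> B then a v else 0) *\<^sub>R v)"
    unfolding a(2) by (rule sum.mono_neutral_cong_left) (use assms in auto)
  then show "x \<in> conic_hull V" unfolding conic_hull_def using a by (intro CollectI exI[of _ "\<lambda>v. if v \<in> B then a v else 0"]) auto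
qed

lemma conic_hull_basis:
  assumes B: "is_basis B" and "\<And>b. b \<in> B \<Longrightarrow> 0 \<le> representation B x b"
  shows "x \<in> conic_hull B"
  using conic_hullI[of B "representation B x", OF assms(2)] basis_expand[OF B, of x] by simp

definition bases :: "'a::euclidean_space set \<Rightarrow> 'a set set" where
  "bases V = {B. B \<subseteq> V \<and> is_basis B}"

definition generic :: "'a::euclidean_space set \<Rightarrow> 'a \<Rightarrow> bool" where
  "generic V x \<longleftrightarrow> (\<forall>B\<in>bases V. \<forall>b\<in>B. representation B x b \<noteq> 0)"

text \<open>The reduced cost of linear programming: the amount by which the cost of \<open>v\<close> exceeds the value at
  \<open>v\<close> of the linear functional that agrees with the costs on \<open>B\<close>. The bases for which it is positive
  outside \<open>B\<close> are the maximal cells of the regular triangulation induced by the heights \<open>c\<close>.\<close>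

definition reduced_cost :: "('a::euclidean_space \<Rightarrow> real) \<Rightarrow> 'a set \<Rightarrow> 'a \<Rightarrow> real" where
  "reduced_cost c B v = c v - (\<Sum>b\<in>B. representation B v b * c b)"

definition generic_cost :: "'a::euclidean_space set \<Rightarrow> ('a \<Rightarrow> real) \<Rightarrow> bool" where
  "generic_cost V c \<longleftrightarrow> (\<forall>B\<in>bases V. \<forall>v\<in>V - B. reduced_cost c B v \<noteq> 0)"

definition optimal_bases :: "'a::euclidean_space set \<Rightarrow> ('a \<Rightarrow> real) \<Rightarrow> 'a set set" where
  "optimal_bases V c = {B \<in> bases V. \<forall>v\<in>V - B. 0 < reduced_cost c B v}"

lemma finite_bases: "finite V \<Longrightarrow> finite (bases V)"
  unfolding bases_def by (rule finite_subset[of _ "Pow V"]) auto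

lemma finite_optimal_bases: "finite V \<Longrightarrow> finite (optimal_bases V c)"
  unfolding optimal_bases_def by (rule finite_subset[OF _ finite_bases]) auto

text \<open>The ratio test of the simplex algorithm: moving from \<open>a\<close> against \<open>\<gamma>\<close> as far as nonnegativity permits makes a coefficient vanish.\<close>

lemma ratio_test:
  fixes a \<gamma> :: "'a \<Rightarrow> real"
  assumes "finite V" and a: "\<And>v. v \<in> V \<Longrightarrow> 0 \<le> a v" and "v1 \<in> V" "0 < \<gamma> v1"
  obtains t v0 where "0 \<le> t" "v0 \<in> V" "0 < \<gamma> v0" "t = a v0 / \<gamma> v0" "\<And>v. v \<in> V \<Longrightarrow> 0 \<le> a v - t * \<gamma> v"
proof -
  let ?T = "{v\<in>V. 0 < \<gamma> v}"
  define t where "t = Min ((\<lambda>v. a v / \<gamma> v) ` ?T)"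
  have fin: "finite ((\<lambda>v. a v / \<gamma> v) ` ?T)" and ne: "(\<lambda>v. a v / \<gamma> v) ` ?T \<noteq> {}" using assms by auto
  from Min_in[OF fin ne] obtain v0 where v0: "v0 \<in> V" "0 < \<gamma> v0" "t = a v0 / \<gamma> v0" unfolding t_def by auto
  have t0: "0 \<le> t" using v0 a by simp
  have "0 \<le> a v - t * \<gamma> v" if "v \<in> V" for v
  proof (cases "0 < \<gamma> v")
    case True
    then have "t \<le> a v / \<gamma> v" unfolding t_def using that fin by (intro Min_le) auto
    then show ?thesis using True by (simp add: field_simps)
  next
    case False
    then have "t * \<gamma> v \<le> 0" using t0 by (simp add: mult_nonneg_nonpos)
    then show ?thesis using a[OF that] by simp
  qed
  with t0 v0 that show ?thesis by blast
qed

text \<open>A conic Caratheodory theorem: a representation with the fewest nonzero coefficients has independent support, since a relation on the support would allow a ratio test step that shrinks it.\<close>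

lemma feasible_basis_exists:
  fixes ht :: "'a::euclidean_space \<Rightarrow> real"
  assumes fin: "finite V" and sp: "span V = UNIV" and ht: "linear ht" "\<And>v. v \<in> V \<Longrightarrow> ht v = 1"
    and x: "x \<in> conic_hull V"
  shows "\<exists>B\<in>bases V. \<forall>b\<in>B. 0 \<le> representation B x b"
proof -
  define R where "R a \<longleftrightarrow> (\<forall>v\<in>V. 0 \<le> a v) \<and> x = (\<Sum>v\<in>V. a v *\<^sub>R v)" for a
  obtain a0 where "R a0" using x unfolding R_def conic_hull_def by auto
  then obtain a where a: "R a" and amin: "\<And>a'. R a' \<Longrightarrow> card {v\<in>V. a v \<noteq> 0} \<le> card {v\<in>V. a' v \<noteq> 0}"
    using ex_has_least_nat[of R a0 "\<lambda>a. card {v\<in>V. a v \<noteq> 0}"] by blast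
  let ?S = "{v\<in>V. a v \<noteq> 0}"
  have finS: "finite ?S" using fin by simp
  have ind: "independent ?S"
  proof
    assume "dependent ?S"
    then obtain g v1 where g: "(\<Sum>v\<in>?S. g v *\<^sub>R v) = 0" "v1 \<in> ?S" "g v1 \<noteq> 0"
      using dependent_finite[OF finS] by auto
    \<comment> \<open>All elements have height one, so a linear relation has coefficient sum zero and hence
      a positive coefficient.\<close>
    have "(\<Sum>v\<in>?S. g v) = ht (\<Sum>v\<in>?S. g v *\<^sub>R v)"
      by (simp add: linear_sum[OF ht(1)] linear_scale[OF ht(1)] ht(2))
    then have s0: "(\<Sum>v\<in>?S. g v) = 0" using g linear_0[OF ht(1)] by simp
    have "\<exists>v2\<in>?S. 0 < g v2"
    proof (rule ccontr)
      assume "\<not> ?thesis"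
      then have "\<forall>v\<in>?S. g v \<le> 0" by force
      then have "\<forall>v\<in>?S. - g v = 0" using s0 finS sum_nonneg_eq_0_iff[of ?S "\<lambda>v. - g v"] by (simp add: sum_negf)
      then show False using g by force
    qed
    then obtain v2 where v2: "v2 \<in> ?S" "0 < g v2" by auto
    obtain t v0 where t: "0 \<le> t" "v0 \<in> ?S" "0 < g v0" "t = a v0 / g v0" "\<And>v. v \<in> ?S \<Longrightarrow> 0 \<le> a v - t * g v"
      using ratio_test[of ?S a v2 g] finS v2 a unfolding R_def by auto
    define a' where "a' v = (if v \<in> ?S then a v - t * g v else 0)" for v
    have "x = (\<Sum>v\<in>?S. a v *\<^sub>R v)" using a unfolding R_def
      by (metis (mono_tags, lifting) fin mem_Collect_eq scale_eq_0_iff sum.mono_neutral_right DiffE finS subsetI)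
    also have "\<dots> = (\<Sum>v\<in>?S. a v *\<^sub>R v) - t *\<^sub>R (\<Sum>v\<in>?S. g v *\<^sub>R v)" using g by simp
    also have "\<dots> = (\<Sum>v\<in>?S. a' v *\<^sub>R v)"
      by (simp add: a'_def scaleR_sum_right sum_subtractf scaleR_diff_left)
    also have "\<dots> = (\<Sum>v\<in>V. a' v *\<^sub>R v)"
      by (rule sum.mono_neutral_left) (use fin in \<open>auto simp: a'_def\<close>)
    finally have "R a'" unfolding R_def using t(5) by (auto simp: a'_def)
    moreover have "{v\<in>V. a' v \<noteq> 0} \<subseteq> ?S - {v0}" using t by (auto simp: a'_def)
    then have "card {v\<in>V. a' v \<noteq> 0} < card ?S"
      using finS t(2) by (metis (no_types, lifting) card_Diff1_less card_mono finite_Diff le_less_trans)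
    ultimately show False using amin[of a'] by simp
  qed
  obtain B where B: "?S \<subseteq> B" "B \<subseteq> V" "independent B" "V \<subseteq> span B"
    using maximal_independent_subset_extend[of ?S V] ind by auto
  have bB: "is_basis B" unfolding is_basis_def using B sp by (metis span_minimal subspace_span top.extremum_uniqueI)
  have "x = (\<Sum>v\<in>B. a v *\<^sub>R v)"
  proof -
    have "x = (\<Sum>v\<in>V. a v *\<^sub>R v)" using a by (simp add: R_def)
    also have "\<dots> = (\<Sum>v\<in>B. a v *\<^sub>R v)" by (rule sum.mono_neutral_right) (use fin B in auto)
    finally show ?thesis .
  qed
  then have "\<forall>b\<in>B. representation B x b = a b" using representation_unique[OF bB] by blast
  then show ?thesis using bB B a unfolding bases_def R_def by (intro bexI[of _ B]) auto
qed

section \<open>Regular triangulations of cones\<close>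

text \<open>Among the bases in which \<open>x\<close> has nonnegative coordinates, one of least cost is optimal: a vector
  of negative reduced cost could enter the basis by a pivot step, and since \<open>x\<close> is generic this step
  has positive length and strictly lowers the cost.\<close>

lemma optimal_basis_exists:
  fixes ht :: "'a::euclidean_space \<Rightarrow> real"
  assumes fin: "finite V" and sp: "span V = UNIV" and ht: "linear ht" "\<And>v. v \<in> V \<Longrightarrow> ht v = 1"
    and c: "generic_cost V c" and x: "x \<in> conic_hull V" "generic V x"
  shows "\<exists>B\<in>optimal_bases V c. \<forall>b\<in>B. 0 < representation B x b"
proof -
  define F where "F = {B\<in>bases V. \<forall>b\<in>B. 0 \<le> representation B x b}"
  define cost where "cost B = (\<Sum>b\<in>B. representation B x b * c b)" for B
  have "F \<noteq> {}" "finite F"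
    using feasible_basis_exists[OF fin sp ht x(1)] finite_bases[OF fin] by (auto simp: F_def)
  then obtain B where BF: "B \<in> F" and Bmin: "\<And>B'. B' \<in> F \<Longrightarrow> cost B \<le> cost B'"
    using arg_min_if_finite[of F cost] by (metis linorder_not_less)
  have BV: "B \<subseteq> V" and B: "is_basis B" and Bb: "B \<in> bases V" using BF by (auto simp: F_def bases_def)
  have finB: "finite B" using basis_finite[OF B] .
  have pos: "0 < representation B x b" if "b \<in> B" for b
    using that BF x(2) unfolding F_def generic_def by (metis (mono_tags, lifting) mem_Collect_eq order_less_le)
  have "0 < reduced_cost c B v" if v: "v \<in> V - B" for v
  proof (rule ccontr)
    assume "\<not> ?thesis"
    then have neg: "reduced_cost c B v < 0" using c v Bb unfolding generic_cost_def by force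
    let ?r = "representation B v"
    have "(\<Sum>b\<in>B. ?r b) = ht v" using linear_as_coordinates[OF B ht(1), of v] BV ht(2) by (simp add: subset_iff)
    then have s1: "(\<Sum>b\<in>B. ?r b) = 1" using v ht(2) by simp
    have "\<exists>b1\<in>B. 0 < ?r b1"
      using s1 sum_nonpos[of B ?r] by (metis linorder_not_less zero_less_one)
    then obtain b1 where b1: "b1 \<in> B" "0 < ?r b1" by blast
    obtain t b0 where t: "b0 \<in> B" "0 < ?r b0" "t = representation B x b0 / ?r b0"
      "\<And>b. b \<in> B \<Longrightarrow> 0 \<le> representation B x b - t * ?r b"
      using ratio_test[of B "representation B x" b1 ?r] finB b1 pos by (metis less_imp_le)
    have t0: "0 < t" using t pos by simp
    let ?B = "insert v (B - {b0})"
    have B': "is_basis ?B" using basis_exchange[OF B t(1)] t(2) by simp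
    define f where "f b = (if b = v then t else representation B x b - t * ?r b)" for b
    have vn: "v \<notin> B - {b0}" "finite (B - {b0})" using v finB by auto
    have fb0: "representation B x b0 - t * ?r b0 = 0" using t by simp
    have sumf: "(\<Sum>b\<in>?B. h (f b) b) = h t v + (\<Sum>b\<in>B. h (representation B x b - t * ?r b) b)"
      if "h 0 b0 = 0" for h :: "real \<Rightarrow> 'a \<Rightarrow> 'c::comm_monoid_add"
    proof -
      have "(\<Sum>b\<in>?B. h (f b) b) = h t v + (\<Sum>b\<in>B-{b0}. h (f b) b)"
        using vn by (simp add: f_def)
      also have "(\<Sum>b\<in>B-{b0}. h (f b) b) = (\<Sum>b\<in>B-{b0}. h (representation B x b - t * ?r b) b)"
        by (rule sum.cong) (use vn in \<open>auto simp: f_def\<close>)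
      also have "\<dots> = (\<Sum>b\<in>B. h (representation B x b - t * ?r b) b)"
        using sum.remove[OF finB t(1), of "\<lambda>b. h (representation B x b - t * ?r b) b"] that fb0 by simp
      finally show ?thesis .
    qed
    have "(\<Sum>b\<in>?B. f b *\<^sub>R b) = t *\<^sub>R v + ((\<Sum>b\<in>B. representation B x b *\<^sub>R b) - t *\<^sub>R (\<Sum>b\<in>B. ?r b *\<^sub>R b))"
      using sumf[of "\<lambda>r b. r *\<^sub>R b"] by (simp add: scaleR_diff_left sum_subtractf scaleR_sum_right)
    also have "\<dots> = x" using basis_expand[OF B] by simp
    finally have rep: "representation ?B x b = f b" if "b \<in> ?B" for b
      using representation_unique[OF B' _ that, of x f] by metis
    have "cost ?B = (\<Sum>b\<in>?B. f b * c b)" unfolding cost_def by (rule sum.cong) (auto simp: rep)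
    also have "\<dots> = t * c v + ((\<Sum>b\<in>B. representation B x b * c b) - t * (\<Sum>b\<in>B. ?r b * c b))"
      using sumf[of "\<lambda>r b. r * c b"] by (simp add: left_diff_distrib sum_subtractf sum_distrib_left mult.assoc)
    also have "\<dots> = cost B + t * reduced_cost c B v" by (simp add: cost_def reduced_cost_def algebra_simps)
    finally have "cost ?B < cost B" using t0 neg by (simp add: mult_pos_neg)
    moreover have "?B \<in> F"
      using B' BV v rep t t0 vn unfolding F_def bases_def by (auto simp: f_def)
    ultimately show False using Bmin by (meson linorder_not_less)
  qed
  then show ?thesis using pos Bb unfolding optimal_bases_def by blast
qed

text \<open>The functional that agrees with the costs on an optimal basis is below the costs elsewhere. Hence
  the cost of \<open>x\<close> with respect to either of two different optimal bases would be strictly smaller than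
  with respect to the other one.\<close>

lemma optimal_basis_unique:
  fixes V :: "'a::euclidean_space set"
  assumes B: "B \<in> optimal_bases V c" "\<forall>b\<in>B. 0 < representation B x b"
    and B': "B' \<in> optimal_bases V c" "\<forall>b\<in>B'. 0 < representation B' x b"
  shows "B = B'"
proof -
  have less: "(\<Sum>b\<in>B. representation B x b * c b) < (\<Sum>b\<in>B'. representation B' x b * c b)"
    if B: "B \<in> optimal_bases V c" and B': "B' \<in> optimal_bases V c" "\<forall>b\<in>B'. 0 < representation B' x b"
      and ne: "\<not> B' \<subseteq> B" for B B'
  proof -
    have bas: "is_basis B" "is_basis B'" "B' \<subseteq> V" using B B' by (auto simp: optimal_bases_def bases_def)
    define \<phi> where "\<phi> y = (\<Sum>b\<in>B. representation B y b * c b)" for y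
    have lin: "linear \<phi>" unfolding \<phi>_def
      by (rule linearI) (simp_all add: representation_add[OF bas(1)] representation_scaleR[OF bas(1)]
          distrib_right sum.distrib sum_distrib_left mult.assoc)
    have eq: "\<phi> b = c b" if "b \<in> B" for b
    proof -
      have "\<phi> b = (\<Sum>b'\<in>B. if b' = b then c b' else 0)" unfolding \<phi>_def
        by (rule sum.cong) (auto simp: representation_self[OF bas(1) that])
      then show ?thesis using that basis_finite[OF bas(1)] by simp
    qed
    have lt: "\<phi> b < c b" if "b \<in> B'" "b \<notin> B" for b
      using that B bas(3) by (auto simp: optimal_bases_def reduced_cost_def \<phi>_def)
    have "(\<Sum>b\<in>B'. representation B' x b * \<phi> b) < (\<Sum>b\<in>B'. representation B' x b * c b)"
    proof (rule sum_strict_mono_ex1)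
      show "finite B'" using basis_finite bas by auto
      show "\<forall>b\<in>B'. representation B' x b * \<phi> b \<le> representation B' x b * c b"
        using eq lt B'(2) by (metis less_imp_le mult_left_mono order_refl)
      show "\<exists>b\<in>B'. representation B' x b * \<phi> b < representation B' x b * c b"
        using ne lt B'(2) by (meson mult_strict_left_mono subsetI)
    qed
    also have "(\<Sum>b\<in>B'. representation B' x b * \<phi> b) = \<phi> x"
      using linear_as_coordinates[OF bas(2) lin, of x] by simp
    finally show ?thesis by (simp add: \<phi>_def)
  qed
  have bas: "is_basis B" "is_basis B'" using B B' by (auto simp: optimal_bases_def bases_def)
  show ?thesis
  proof (rule ccontr)
    assume "B \<noteq> B'"
    then have "\<not> B' \<subseteq> B" "\<not> B \<subseteq> B'"
      using bas basis_card basis_finite card_subset_eq by metis+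
    then show False using less[OF B(1) B'] less[OF B'(1) B] by simp
  qed
qed

section \<open>Half-open decompositions\<close>

lemma eventually_sign_perturbed:
  fixes \<alpha> \<beta> :: real
  assumes "\<beta> \<noteq> 0"
  shows "eventually (\<lambda>\<epsilon>. \<alpha> + \<epsilon> * \<beta> \<noteq> 0 \<and> (0 < \<alpha> + \<epsilon> * \<beta> \<longleftrightarrow> 0 < \<alpha> \<or> \<alpha> = 0 \<and> 0 < \<beta>)) (at_right 0)"
proof (cases "\<alpha> = 0")
  case True
  show ?thesis unfolding True
    by (rule eventually_at_rightI[of 0 1]) (use assms in \<open>auto simp: zero_less_mult_iff\<close>)
next
  case False
  have "((\<lambda>\<epsilon>. \<alpha> + \<epsilon> * \<beta>) \<longlongrightarrow> \<alpha> + 0 * \<beta>) (at_right 0)" by (intro tendsto_intros)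
  then have lim: "((\<lambda>\<epsilon>. \<alpha> + \<epsilon> * \<beta>) \<longlongrightarrow> \<alpha>) (at_right 0)" by simp
  show ?thesis
  proof (cases "0 < \<alpha>")
    case True
    then have "eventually (\<lambda>\<epsilon>. 0 < \<alpha> + \<epsilon> * \<beta>) (at_right 0)" using lim by (rule order_tendstoD(1)[rotated])
    then show ?thesis by (rule eventually_mono) (use True in auto)
  next
    case neg: False
    with False have "\<alpha> < 0" by simp
    then have "eventually (\<lambda>\<epsilon>. \<alpha> + \<epsilon> * \<beta> < 0) (at_right 0)" using lim by (rule order_tendstoD(2)[rotated])
    then show ?thesis by (rule eventually_mono) (use \<open>\<alpha> < 0\<close> in auto)
  qed
qed

text \<open>The points that are moved into the interior of the simplicial cone over \<open>B\<close> by every sufficiently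
  small step in the direction \<open>u\<close>, expressed in coordinates.\<close>

definition half_open_cone :: "'a::euclidean_space set \<Rightarrow> 'a \<Rightarrow> 'a set" where
  "half_open_cone B u = {x. \<forall>b\<in>B. 0 < representation B x b \<or> representation B x b = 0 \<and> 0 < representation B u b}"

text \<open>For a cone \<open>S\<close> and a direction \<open>u\<close> in general position, this is \<open>S\<close> itself if \<open>u\<close> lies in \<open>S\<close>
  (\<open>pushes_into_conic_hull\<close>), and it is the interior of \<open>S\<close> if \<open>- u\<close> does. One notion thus
  covers both sides of Ehrhart reciprocity.\<close>

definition pushes_into :: "'a::euclidean_space set \<Rightarrow> 'a \<Rightarrow> 'a set" where
  "pushes_into S u = {x. eventually (\<lambda>\<epsilon>::real. x + \<epsilon> *\<^sub>R u \<in> S) (at_right 0)}"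

lemma eventually_perturbed_coordinates:
  fixes V :: "'a::euclidean_space set"
  assumes "finite V" "generic V u"
  shows "eventually (\<lambda>\<epsilon>::real. generic V (x + \<epsilon> *\<^sub>R u) \<and>
    (\<forall>B\<in>bases V. (\<forall>b\<in>B. 0 < representation B (x + \<epsilon> *\<^sub>R u) b) \<longleftrightarrow> x \<in> half_open_cone B u)) (at_right 0)"
proof -
  have "eventually (\<lambda>\<epsilon>::real. \<forall>B\<in>bases V. \<forall>b\<in>B. representation B x b + \<epsilon> * representation B u b \<noteq> 0 \<and>
     (0 < representation B x b + \<epsilon> * representation B u b \<longleftrightarrow>
       0 < representation B x b \<or> representation B x b = 0 \<and> 0 < representation B u b)) (at_right 0)"
    by (intro eventually_ball_finite ballI eventually_sign_perturbed)
      (use assms finite_bases basis_finite in \<open>auto simp: generic_def bases_def\<close>)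
  then show ?thesis
    by (rule eventually_mono)
      (auto simp: generic_def bases_def half_open_cone_def representation_add representation_scaleR)
qed

text \<open>For small \<open>\<epsilon>\<close> the point \<open>x + \<epsilon> u\<close> is generic, hence lies in the interior of exactly one cone of the
  triangulation, and by \<open>eventually_perturbed_coordinates\<close> this cone does not depend on \<open>\<epsilon>\<close>.\<close>

lemma half_open_decomposition:
  fixes ht :: "'a::euclidean_space \<Rightarrow> real"
  assumes fin: "finite V" and sp: "span V = UNIV" and ht: "linear ht" "\<And>v. v \<in> V \<Longrightarrow> ht v = 1"
    and c: "generic_cost V c" and u: "generic V u"
  shows "pushes_into (conic_hull V) u = (\<Union>B\<in>optimal_bases V c. half_open_cone B u)"
    and "B \<in> optimal_bases V c \<Longrightarrow> B' \<in> optimal_bases V c \<Longrightarrow> B \<noteq> B' \<Longrightarrow>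
      half_open_cone B u \<inter> half_open_cone B' u = {}"
proof -
  note ev = eventually_perturbed_coordinates[OF fin u]
  have opt: "B \<in> bases V" if "B \<in> optimal_bases V c" for B using that by (simp add: optimal_bases_def)
  show "pushes_into (conic_hull V) u = (\<Union>B\<in>optimal_bases V c. half_open_cone B u)"
  proof (intro equalityI subsetI)
    fix x assume "x \<in> pushes_into (conic_hull V) u"
    then have "eventually (\<lambda>\<epsilon>::real. x + \<epsilon> *\<^sub>R u \<in> conic_hull V) (at_right 0)"
      by (simp add: pushes_into_def)
    from eventually_happens'[OF _ eventually_conj[OF this ev[of x]]]
    obtain \<epsilon> :: real where e: "x + \<epsilon> *\<^sub>R u \<in> conic_hull V" "generic V (x + \<epsilon> *\<^sub>R u)"
      "\<forall>B\<in>bases V. (\<forall>b\<in>B. 0 < representation B (x + \<epsilon> *\<^sub>R u) b) \<longleftrightarrow> x \<in> half_open_cone B u"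
      by (auto simp: trivial_limit_at_right_real)
    then show "x \<in> (\<Union>B\<in>optimal_bases V c. half_open_cone B u)"
      using optimal_basis_exists[OF fin sp ht c e(1,2)] opt by fast
  next
    fix x assume "x \<in> (\<Union>B\<in>optimal_bases V c. half_open_cone B u)"
    then obtain B where B: "B \<in> optimal_bases V c" "x \<in> half_open_cone B u" by auto
    then have bas: "is_basis B" "B \<subseteq> V" using opt by (auto simp: bases_def)
    have "eventually (\<lambda>\<epsilon>::real. \<forall>b\<in>B. 0 < representation B (x + \<epsilon> *\<^sub>R u) b) (at_right 0)"
      using ev[of x] by (rule eventually_mono) (use B(2) opt[OF B(1)] in simp)
    moreover have "y \<in> conic_hull V" if "\<forall>b\<in>B. 0 < representation B y b" for y
      using conic_hull_basis[OF bas(1), of y] conic_hull_mono[OF fin bas(2)] that by (meson less_imp_le subsetD)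
    ultimately show "x \<in> pushes_into (conic_hull V) u" unfolding pushes_into_def mem_Collect_eq
      by (rule eventually_mono)
  qed
  show "half_open_cone B u \<inter> half_open_cone B' u = {}"
    if "B \<in> optimal_bases V c" "B' \<in> optimal_bases V c" "B \<noteq> B'"
  proof (rule ccontr)
    assume "\<not> ?thesis"
    then obtain x where x: "x \<in> half_open_cone B u" "x \<in> half_open_cone B' u" by auto
    from eventually_happens'[OF _ ev[of x]]
    obtain \<epsilon> :: real where
      "\<forall>B\<in>bases V. (\<forall>b\<in>B. 0 < representation B (x + \<epsilon> *\<^sub>R u) b) \<longleftrightarrow> x \<in> half_open_cone B u"
      by (auto simp: trivial_limit_at_right_real)
    then show False using optimal_basis_unique[OF that(1) _ that(2)] that x opt by blast
  qed
qed

lemma pushes_into_conic_hull: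
  fixes ht :: "'a::euclidean_space \<Rightarrow> real"
  assumes fin: "finite V" and sp: "span V = UNIV" and ht: "linear ht" "\<And>v. v \<in> V \<Longrightarrow> ht v = 1"
    and c: "generic_cost V c" and w: "generic V w" "w \<in> conic_hull V"
  shows "pushes_into (conic_hull V) w = conic_hull V"
proof (intro equalityI subsetI)
  fix x assume "x \<in> conic_hull V"
  then have "x + \<epsilon> *\<^sub>R w \<in> conic_hull V" if "0 < \<epsilon>" for \<epsilon>
    using that w by (intro conic_hull_add conic_hull_scale) auto
  then show "x \<in> pushes_into (conic_hull V) w"
    unfolding pushes_into_def by (auto intro: eventually_at_rightI[of 0 1])
next
  fix x assume "x \<in> pushes_into (conic_hull V) w"
  then obtain B where B: "B \<in> optimal_bases V c" "x \<in> half_open_cone B w"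
    using half_open_decomposition(1)[OF fin sp ht c w(1)] by auto
  then have "is_basis B" "B \<subseteq> V" by (auto simp: optimal_bases_def bases_def)
  moreover have "0 \<le> representation B x b" if "b \<in> B" for b
    using B(2) that unfolding half_open_cone_def by fastforce
  ultimately show "x \<in> conic_hull V"
    using conic_hull_basis[of B x] conic_hull_mono[OF fin] by blast
qed

text \<open>Finitely many hyperplanes through the origin do not cover the positive orthant: the hyperplanes can be avoided one at a time by arbitrarily small changes of a single coordinate.\<close>

lemma avoid_hyperplanes:
  fixes f :: "'k \<Rightarrow> 'i \<Rightarrow> real"
  assumes "finite I" "finite K" and "\<And>k. k \<in> K \<Longrightarrow> \<exists>i\<in>I. f k i \<noteq> 0"
  shows "\<exists>a. (\<forall>i\<in>I. 0 < a i) \<and> (\<forall>k\<in>K. (\<Sum>i\<in>I. f k i * a i) \<noteq> 0)"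
  using assms(2,3)
proof (induction K)
  case empty
  show ?case by (rule exI[of _ "\<lambda>_. 1"]) simp
next
  case (insert k K)
  then obtain a where a: "\<forall>i\<in>I. 0 < a i" "\<forall>k\<in>K. (\<Sum>i\<in>I. f k i * a i) \<noteq> 0" by auto
  obtain j where j: "j \<in> I" "f k j \<noteq> 0" using insert.prems[of k] by auto
  have eq: "(\<Sum>i\<in>I. f l i * (a i + (if i = j then \<epsilon> else 0))) = (\<Sum>i\<in>I. f l i * a i) + \<epsilon> * f l j" for l \<epsilon>
  proof -
    have "(\<Sum>i\<in>I. f l i * (a i + (if i = j then \<epsilon> else 0))) = (\<Sum>i\<in>I. f l i * a i + (if i = j then \<epsilon> * f l i else 0))"
      by (rule sum.cong) (auto simp: algebra_simps)
    then show ?thesis using j assms(1) by (simp add: sum.distrib)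
  qed
  have "eventually (\<lambda>\<epsilon>. (\<Sum>i\<in>I. f k i * a i) + \<epsilon> * f k j \<noteq> 0) (at_right 0)"
    using eventually_sign_perturbed[OF j(2)] by (rule eventually_mono) auto
  moreover have "eventually (\<lambda>\<epsilon>. \<forall>l\<in>K. (\<Sum>i\<in>I. f l i * a i) + \<epsilon> * f l j \<noteq> 0) (at_right 0)"
  proof (intro eventually_ball_finite ballI)
    fix l assume "l \<in> K"
    then have l: "(\<Sum>i\<in>I. f l i * a i) \<noteq> 0" using a by auto
    show "eventually (\<lambda>\<epsilon>. (\<Sum>i\<in>I. f l i * a i) + \<epsilon> * f l j \<noteq> 0) (at_right 0)"
    proof (cases "f l j = 0")
      case False
      show ?thesis using eventually_sign_perturbed[OF False] by (rule eventually_mono) auto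
    qed (use l in simp)
  qed (use insert in simp)
  moreover have "eventually (\<lambda>\<epsilon>::real. 0 < \<epsilon>) (at_right 0)" by (rule eventually_at_right_less)
  ultimately have "eventually (\<lambda>\<epsilon>. (\<Sum>i\<in>I. f k i * a i) + \<epsilon> * f k j \<noteq> 0 \<and>
      (\<forall>l\<in>K. (\<Sum>i\<in>I. f l i * a i) + \<epsilon> * f l j \<noteq> 0) \<and> 0 < \<epsilon>) (at_right 0)"
    by (intro eventually_conj)
  from eventually_happens'[OF _ this]
  obtain \<epsilon> where e: "(\<Sum>i\<in>I. f k i * a i) + \<epsilon> * f k j \<noteq> 0"
      "\<forall>l\<in>K. (\<Sum>i\<in>I. f l i * a i) + \<epsilon> * f l j \<noteq> 0" "0 < \<epsilon>" by (auto simp: trivial_limit_at_right_real)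
  show ?case
    by (rule exI[of _ "\<lambda>i. a i + (if i = j then \<epsilon> else 0)"]) (use e a in \<open>auto simp: eq add_pos_pos\<close>)
qed

lemma generic_direction_exists:
  fixes V :: "'a::euclidean_space set"
  assumes "finite V"
  obtains w where "w \<in> conic_hull V" "generic V w"
proof -
  let ?K = "SIGMA B:bases V. B"
  have "\<exists>a. (\<forall>v\<in>V. 0 < a v) \<and> (\<forall>k\<in>?K. (\<Sum>v\<in>V. (case k of (B, b) \<Rightarrow> representation B v b) * a v) \<noteq> 0)"
  proof (rule avoid_hyperplanes)
    show "finite ?K" using finite_bases[OF assms] basis_finite by (auto simp: bases_def)
    fix k assume "k \<in> ?K"
    then obtain B b where "k = (B, b)" "is_basis B" "B \<subseteq> V" "b \<in> B" by (auto simp: bases_def)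
    then show "\<exists>v\<in>V. (case k of (B, b) \<Rightarrow> representation B v b) \<noteq> 0"
      by (intro bexI[of _ b]) (auto simp: representation_self)
  qed (fact assms)
  then obtain a where a: "\<forall>v\<in>V. 0 < a v" "\<forall>k\<in>?K. (\<Sum>v\<in>V. (case k of (B, b) \<Rightarrow> representation B v b) * a v) \<noteq> 0"
    by blast
  show ?thesis
  proof (rule that[of "\<Sum>v\<in>V. a v *\<^sub>R v"])
    show "(\<Sum>v\<in>V. a v *\<^sub>R v) \<in> conic_hull V" using a by (intro conic_hullI) (auto simp: less_imp_le)
    show "generic V (\<Sum>v\<in>V. a v *\<^sub>R v)" unfolding generic_def
      using a(2) by (auto simp: bases_def representation_sum representation_scaleR mult.commute)
  qed
qed

lemma generic_cost_exists:
  fixes V :: "'a::euclidean_space set"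
  assumes "finite V"
  obtains c where "generic_cost V c"
proof -
  let ?K = "SIGMA B:bases V. V - B"
  let ?f = "\<lambda>k u. case k of (B, v) \<Rightarrow> if u = v then 1 else if u \<in> B then - representation B v u else (0 :: real)"
  have "\<exists>c. (\<forall>v\<in>V. 0 < c v) \<and> (\<forall>k\<in>?K. (\<Sum>u\<in>V. ?f k u * c u) \<noteq> 0)"
  proof (rule avoid_hyperplanes)
    show "finite ?K" using finite_bases[OF assms] assms by auto
    fix k assume "k \<in> ?K"
    then show "\<exists>u\<in>V. ?f k u \<noteq> 0" by (auto intro!: bexI[of _ "snd k"])
  qed (fact assms)
  then obtain c where c: "\<And>k. k \<in> ?K \<Longrightarrow> (\<Sum>u\<in>V. ?f k u * c u) \<noteq> 0" by blast
  have "reduced_cost c B v \<noteq> 0" if B: "B \<in> bases V" and v: "v \<in> V - B" for B v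
  proof -
    have BV: "B \<subseteq> V" "finite B" using B basis_finite by (auto simp: bases_def)
    have "(\<Sum>u\<in>V. ?f (B, v) u * c u) = (\<Sum>u\<in>insert v B. ?f (B, v) u * c u)"
      by (rule sum.mono_neutral_right) (use assms BV v in auto)
    also have "\<dots> = c v + (\<Sum>u\<in>B. ?f (B, v) u * c u)" using v BV by simp
    also have "(\<Sum>u\<in>B. ?f (B, v) u * c u) = (\<Sum>u\<in>B. - (representation B v u * c u))"
      by (rule sum.cong) (use v in auto)
    finally show ?thesis using c[of "(B, v)"] that by (simp add: reduced_cost_def sum_negf)
  qed
  then show ?thesis using that unfolding generic_cost_def by blast
qed

section \<open>Lattice points in half-open simplicial cones\<close>

lemma nth_one_minus_X_power:
  "fps_nth ((1 - fps_X :: int fps) ^ n) 0 = 1" "fps_nth ((1 - fps_X :: int fps) ^ n) 1 = - int n"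
proof (induction n)
  case (Suc n)
  { case 1 show ?case using Suc by (simp add: left_diff_distrib) }
  { case 2 show ?case using Suc by (simp add: left_diff_distrib) }
qed simp_all

text \<open>A lattice with an integral grading. The theory of boxes and triangulations uses only these
  properties of the integer points of \<open>\<real>\<^sup>d \<times> \<real>\<close>, graded by the last coordinate.\<close>

locale graded_lattice =
  fixes L :: "'a::euclidean_space set" and ht :: "'a \<Rightarrow> real"
  assumes lattice_zero: "0 \<in> L"
    and lattice_diff: "x \<in> L \<Longrightarrow> y \<in> L \<Longrightarrow> x - y \<in> L"
    and lattice_discrete: "bounded S \<Longrightarrow> finite (S \<inter> L)"
    and linear_ht: "linear ht"
    and ht_Ints: "x \<in> L \<Longrightarrow> ht x \<in> \<int>"
begin

lemma lattice_uminus: "x \<in> L \<Longrightarrow> - x \<in> L"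
  using lattice_diff[OF lattice_zero, of x] by simp

lemma lattice_add: "x \<in> L \<Longrightarrow> y \<in> L \<Longrightarrow> x + y \<in> L"
  using lattice_diff[OF _ lattice_uminus, of x y] by simp

lemma lattice_sum: "(\<And>i. i \<in> I \<Longrightarrow> f i \<in> L) \<Longrightarrow> sum f I \<in> L"
  by (induction I rule: infinite_finite_induct) (auto simp: lattice_zero lattice_add)

lemma lattice_scale_nat: "x \<in> L \<Longrightarrow> real n *\<^sub>R x \<in> L"
  by (induction n) (auto simp: lattice_zero scaleR_add_left lattice_add)

lemma lattice_scale_int: "x \<in> L \<Longrightarrow> of_int k *\<^sub>R x \<in> L"
  by (cases k rule: int_cases2) (auto intro: lattice_scale_nat lattice_uminus)

lemmas ht_simps = linear_add[OF linear_ht] linear_diff[OF linear_ht] linear_sum[OF linear_ht]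
  linear_scale[OF linear_ht] linear_0[OF linear_ht] linear_neg[OF linear_ht]

definition lattice_basis :: "'a set \<Rightarrow> bool" where
  "lattice_basis B \<longleftrightarrow> is_basis B \<and> B \<subseteq> L \<and> (\<forall>b\<in>B. ht b = 1)"

lemma lattice_basisD:
  assumes "lattice_basis B"
  shows "is_basis B" "b \<in> B \<Longrightarrow> b \<in> L" "b \<in> B \<Longrightarrow> ht b = 1" "finite B" "card B = DIM('a)"
  using assms basis_finite basis_card by (auto simp: lattice_basis_def)

lemma ht_coordinates: "lattice_basis B \<Longrightarrow> ht x = (\<Sum>b\<in>B. representation B x b)"
  using linear_as_coordinates[OF _ linear_ht, of B x] by (simp add: lattice_basis_def)

definition hcount :: "'a set \<Rightarrow> nat \<Rightarrow> nat" where
  "hcount M n = card {x\<in>M. ht x = real n}"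

definition hseries :: "'a set \<Rightarrow> int fps" where
  "hseries M = Abs_fps (\<lambda>n. int (hcount M n))"

lemma finite_cone_level:
  assumes B: "lattice_basis B"
  shows "finite {x\<in>L. (\<forall>b\<in>B. 0 \<le> representation B x b) \<and> ht x = r}"
proof -
  note [simp] = lattice_basisD[OF B]
  have "bounded {x. (\<forall>b\<in>B. 0 \<le> representation B x b) \<and> ht x = r}"
  proof (rule boundedI)
    fix x assume x: "x \<in> {x. (\<forall>b\<in>B. 0 \<le> representation B x b) \<and> ht x = r}"
    have le: "representation B x b \<le> r" if "b \<in> B" for b
      using x that member_le_sum[of b B "representation B x"] ht_coordinates[OF B, of x] by auto
    have "norm x = norm (\<Sum>b\<in>B. representation B x b *\<^sub>R b)" by (simp add: basis_expand)
    also have "\<dots> \<le> (\<Sum>b\<in>B. \<bar>representation B x b\<bar> * norm b)" by (rule sum_norm_le) simp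
    also have "\<dots> \<le> (\<Sum>b\<in>B. r * norm b)"
      by (rule sum_mono) (use x le in \<open>auto intro!: mult_right_mono\<close>)
    finally show "norm x \<le> (\<Sum>b\<in>B. r * norm b)" .
  qed
  from lattice_discrete[OF this] show ?thesis by (rule finite_subset[rotated]) auto
qed

text \<open>The lattice points of a half-open cone whose coordinates in \<open>T\<close> lie in a half-open unit interval,
  \<open>[0, 1)\<close> or \<open>(0, 1]\<close>. These sets interpolate between the cone, for \<open>T = {}\<close>, and the box, for
  \<open>T = B\<close>, so that the coordinates can be bounded one at a time.\<close>

definition half_open_slab :: "'a set \<Rightarrow> 'a \<Rightarrow> 'a set \<Rightarrow> 'a set" where
  "half_open_slab B u T = {x \<in> L \<inter> half_open_cone B u.
     \<forall>b\<in>T. representation B x b < 1 \<or> representation B x b = 1 \<and> representation B u b < 0}"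

abbreviation half_open_box :: "'a set \<Rightarrow> 'a \<Rightarrow> 'a set" where
  "half_open_box B u \<equiv> half_open_slab B u B"

lemma half_open_slab_nonneg:
  "x \<in> half_open_slab B u T \<Longrightarrow> b \<in> B \<Longrightarrow> 0 \<le> representation B x b"
  unfolding half_open_slab_def half_open_cone_def by fastforce

lemma finite_slab_level: "lattice_basis B \<Longrightarrow> finite {x\<in>half_open_slab B u T. ht x = r}"
  by (rule finite_subset[OF _ finite_cone_level[of B r]])
    (auto simp: half_open_slab_nonneg, auto simp: half_open_slab_def)

text \<open>A point of a slab survives after bounding its \<open>b\<close>-coordinate exactly if subtracting \<open>b\<close> leads out of the slab.\<close>

lemma half_open_slab_peel:
  assumes B: "lattice_basis B" and b: "b \<in> B" "b \<notin> T" and u: "representation B u b \<noteq> 0"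
  shows "half_open_slab B u (insert b T) = half_open_slab B u T - (\<lambda>x. b + x) ` half_open_slab B u T"
    and "(\<lambda>x. b + x) ` half_open_slab B u T \<subseteq> half_open_slab B u T"
proof -
  note [simp] = lattice_basisD[OF B]
  have rep: "representation B (b + x) b' = (if b' = b then 1 else 0) + representation B x b'" for x b'
    using b by (simp add: representation_add representation_self)
  show sub: "(\<lambda>x. b + x) ` half_open_slab B u T \<subseteq> half_open_slab B u T"
  proof
    fix y assume "y \<in> (\<lambda>x. b + x) ` half_open_slab B u T"
    then obtain x where x: "x \<in> half_open_slab B u T" "y = b + x" by auto
    have "0 \<le> representation B x b" using half_open_slab_nonneg[OF x(1) b(1)] .
    then show "y \<in> half_open_slab B u T"
      using x b lattice_add by (auto simp: half_open_slab_def half_open_cone_def rep)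
  qed
  show "half_open_slab B u (insert b T) = half_open_slab B u T - (\<lambda>x. b + x) ` half_open_slab B u T"
  proof (intro equalityI subsetI DiffI)
    fix x assume x: "x \<in> half_open_slab B u (insert b T)"
    then show "x \<in> half_open_slab B u T" by (simp add: half_open_slab_def)
    show "x \<notin> (\<lambda>x. b + x) ` half_open_slab B u T"
    proof
      assume "x \<in> (\<lambda>x. b + x) ` half_open_slab B u T"
      then obtain y where y: "y \<in> half_open_slab B u T" "x = b + y" by auto
      have "0 < representation B y b \<or> representation B y b = 0 \<and> 0 < representation B u b"
        using y(1) b by (auto simp: half_open_slab_def half_open_cone_def)
      then show False using x y(2) by (auto simp: half_open_slab_def rep)
    qed
  next
    fix x assume "x \<in> half_open_slab B u T - (\<lambda>x. b + x) ` half_open_slab B u T"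
    then have x: "x \<in> half_open_slab B u T" "x - b \<notin> half_open_slab B u T"
      by (auto simp: image_iff)
    have rep': "representation B (x - b) b' = representation B x b' - (if b' = b then 1 else 0)" for b'
      using b by (simp add: representation_diff representation_self)
    have "x - b \<in> L" using x b by (auto simp: half_open_slab_def intro: lattice_diff)
    moreover have "\<forall>b'\<in>T. representation B (x - b) b' = representation B x b'" using b by (auto simp: rep')
    ultimately have "x - b \<notin> half_open_cone B u" using x by (auto simp: half_open_slab_def)
    then obtain b' where b': "b' \<in> B" "\<not> (0 < representation B (x - b) b' \<or> representation B (x - b) b' = 0 \<and> 0 < representation B u b')"
      by (auto simp: half_open_cone_def)
    have "b' = b" using b' x(1) by (auto simp: rep' half_open_slab_def half_open_cone_def split: if_splits)
    then show "x \<in> half_open_slab B u (insert b T)" using b' x(1) u by (auto simp: rep' half_open_slab_def)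
  qed
qed

text \<open>Translation by \<open>b\<close> raises the height by one, so removing the translated slab multiplies the series by \<open>1 - \<lambda>\<close>.\<close>

lemma hseries_slab_peel:
  assumes B: "lattice_basis B" and b: "b \<in> B" "b \<notin> T" and u: "representation B u b \<noteq> 0"
  shows "hseries (half_open_slab B u (insert b T)) = (1 - fps_X) * hseries (half_open_slab B u T)"
proof (rule fps_ext)
  fix n
  let ?M = "half_open_slab B u T" and ?l = "\<lambda>M n. {x\<in>M. ht x = real n}"
  note peel = half_open_slab_peel[OF B b u]
  note [simp] = lattice_basisD[OF B]
  have fin: "finite (?l ?M n)" for n using finite_slab_level[OF B] .
  have nn: "0 \<le> ht x" if "x \<in> ?M" for x
    using half_open_slab_nonneg[OF that] ht_coordinates[OF B, of x] by (auto intro: sum_nonneg)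
  have eq: "?l (half_open_slab B u (insert b T)) n = ?l ?M n - ?l ((\<lambda>x. b + x) ` ?M) n"
    unfolding peel(1) by auto
  have sub: "?l ((\<lambda>x. b + x) ` ?M) n \<subseteq> ?l ?M n" using peel(2) by auto
  have *: "hcount (half_open_slab B u (insert b T)) n + card (?l ((\<lambda>x. b + x) ` ?M) n) = hcount ?M n"
    unfolding hcount_def eq using card_Diff_subset[OF finite_subset[OF sub fin] sub] card_mono[OF fin sub] by simp
  show "fps_nth (hseries (half_open_slab B u (insert b T))) n = fps_nth ((1 - fps_X) * hseries ?M) n"
  proof (cases n)
    case 0
    have "?l ((\<lambda>x. b + x) ` ?M) n = {}" using nn b 0 by (auto simp: ht_simps) (metis add_nonneg_eq_0_iff zero_le_one zero_neq_one)
    then have "hcount (half_open_slab B u (insert b T)) n = hcount ?M n" using * by (simp only: card.empty add_0_right)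
    then show ?thesis using 0 by (simp add: hseries_def left_diff_distrib)
  next
    case (Suc m)
    have "?l ((\<lambda>x. b + x) ` ?M) n = (\<lambda>x. b + x) ` ?l ?M m" using b Suc by (auto simp: ht_simps)
    then have "card (?l ((\<lambda>x. b + x) ` ?M) n) = hcount ?M m" unfolding hcount_def by (simp add: card_image)
    then show ?thesis using * Suc by (simp add: hseries_def left_diff_distrib)
  qed
qed

lemma hseries_cone:
  assumes B: "lattice_basis B" and u: "\<And>b. b \<in> B \<Longrightarrow> representation B u b \<noteq> 0"
  shows "hseries (half_open_box B u) = (1 - fps_X) ^ DIM('a) * hseries (L \<inter> half_open_cone B u)"
proof -
  have "hseries (half_open_slab B u T) = (1 - fps_X) ^ card T * hseries (L \<inter> half_open_cone B u)"
    if "finite T" "T \<subseteq> B" for T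
    using that
  proof induction
    case empty then show ?case by (simp add: half_open_slab_def Int_def)
  next
    case (insert b T)
    then show ?case using hseries_slab_peel[OF B, of b T u] u by (simp add: mult.assoc)
  qed
  from this[of B] show ?thesis using lattice_basisD[OF B] by simp
qed

text \<open>The reflection \<open>x \<mapsto> \<Sum>B - x\<close> exchanges \<open>[0, 1)\<close> and \<open>(0, 1]\<close> in each coordinate.\<close>

lemma hcount_box_reflect:
  assumes B: "lattice_basis B" and n: "n \<le> DIM('a)"
  shows "hcount (half_open_box B (- u)) n = hcount (half_open_box B u) (DIM('a) - n)"
proof -
  note [simp] = lattice_basisD[OF B]
  have rep: "representation B (\<Sum>B - x) b = 1 - representation B x b" if "b \<in> B" for x b
  proof -
    have "representation B (\<Sum>B) b = (\<Sum>b'\<in>B. if b' = b then 1 else 0)"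
      unfolding representation_sum[OF lattice_basisD(1)[OF B]] by (rule sum.cong) (auto simp: representation_self)
    then show ?thesis using that by (simp add: representation_diff)
  qed
  have SB: "\<Sum>B \<in> L" by (rule lattice_sum) simp
  have htS: "ht (\<Sum>B) = DIM('a)" by (simp add: ht_simps)
  have mem: "\<Sum>B - x \<in> half_open_box B (- v)" if "x \<in> half_open_box B v" for x v
    using that lattice_diff[OF SB, of x]
    by (auto simp: half_open_slab_def half_open_cone_def rep representation_uminus)
  have "bij_betw (\<lambda>x. \<Sum>B - x) {x\<in>half_open_box B (- u). ht x = real n} {x\<in>half_open_box B u. ht x = real (DIM('a) - n)}"
  proof (rule bij_betw_byWitness[where f' = "\<lambda>x. \<Sum>B - x"])
    show "(\<lambda>x. \<Sum>B - x) ` {x\<in>half_open_box B (- u). ht x = real n} \<subseteq> {x\<in>half_open_box B u. ht x = real (DIM('a) - n)}"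
      using mem[of _ "- u"] n by (auto simp: ht_simps htS of_nat_diff)
    show "(\<lambda>x. \<Sum>B - x) ` {x\<in>half_open_box B u. ht x = real (DIM('a) - n)} \<subseteq> {x\<in>half_open_box B (- u). ht x = real n}"
      using mem[of _ u] n by (auto simp: ht_simps htS of_nat_diff)
  qed auto
  then show ?thesis unfolding hcount_def by (rule bij_betw_same_card)
qed

lemma box_height:
  assumes B: "lattice_basis B" and x: "x \<in> half_open_box B u"
  shows "0 \<le> ht x" "ht x \<le> DIM('a)"
    and "\<exists>b\<in>B. 0 < representation B u b \<Longrightarrow> ht x < DIM('a)"
proof -
  note [simp] = lattice_basisD[OF B]
  have le: "representation B x b \<le> 1" if "b \<in> B" for b using x that by (force simp: half_open_slab_def)
  show "0 \<le> ht x" using half_open_slab_nonneg[OF x] ht_coordinates[OF B, of x] by (auto intro: sum_nonneg)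
  show "ht x \<le> DIM('a)" using sum_mono[of B "representation B x" "\<lambda>_. 1"] le ht_coordinates[OF B, of x] by simp
  assume "\<exists>b\<in>B. 0 < representation B u b"
  then have "\<exists>b\<in>B. representation B x b < 1" using x by (force simp: half_open_slab_def)
  then show "ht x < DIM('a)"
    using sum_strict_mono_ex1[of B "representation B x" "\<lambda>_. 1"] le ht_coordinates[OF B, of x] by simp
qed

end

section \<open>Box points of a triangulated cone\<close>

text \<open>The cone over a full-dimensional lattice polytope, given by finitely many lattice points of height one.\<close>

locale lattice_cone = graded_lattice +
  fixes V :: "'a set"
  assumes finite_V: "finite V" and V_lattice: "V \<subseteq> L" and V_ht: "v \<in> V \<Longrightarrow> ht v = 1" and V_span: "span V = UNIV"
begin

lemma optimal_lattice_basis: "B \<in> optimal_bases V c \<Longrightarrow> lattice_basis B"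
  using V_lattice V_ht by (auto simp: optimal_bases_def bases_def lattice_basis_def)

definition box_count :: "('a \<Rightarrow> real) \<Rightarrow> 'a \<Rightarrow> nat \<Rightarrow> nat" where
  "box_count c u n = (\<Sum>B\<in>optimal_bases V c. hcount (half_open_box B u) n)"

lemma generic_optimal: "generic V u \<Longrightarrow> B \<in> optimal_bases V c \<Longrightarrow> b \<in> B \<Longrightarrow> representation B u b \<noteq> 0"
  by (auto simp: generic_def optimal_bases_def)

theorem hseries_pushed_cone:
  assumes c: "generic_cost V c" and u: "generic V u"
  shows "(1 - fps_X) ^ DIM('a) * hseries (L \<inter> pushes_into (conic_hull V) u) = Abs_fps (\<lambda>n. int (box_count c u n))"
proof -
  let ?O = "optimal_bases V c"
  note dec = half_open_decomposition[OF finite_V V_span linear_ht V_ht c u]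
  have "hcount (L \<inter> pushes_into (conic_hull V) u) n = (\<Sum>B\<in>?O. hcount (L \<inter> half_open_cone B u) n)" for n
  proof -
    have "{x \<in> L \<inter> pushes_into (conic_hull V) u. ht x = real n} = (\<Union>B\<in>?O. {x \<in> L \<inter> half_open_cone B u. ht x = real n})"
      using dec(1) by blast
    also have "card \<dots> = (\<Sum>B\<in>?O. card {x \<in> L \<inter> half_open_cone B u. ht x = real n})"
    proof (rule card_UN_disjoint)
      show "\<forall>B\<in>?O. finite {x \<in> L \<inter> half_open_cone B u. ht x = real n}"
        using finite_slab_level[OF optimal_lattice_basis, of _ c u "{}"] by (simp add: half_open_slab_def)
    qed (use dec(2) finite_optimal_bases[OF finite_V] in fast)+
    finally show ?thesis by (simp add: hcount_def)
  qed
  then have "hseries (L \<inter> pushes_into (conic_hull V) u) = (\<Sum>B\<in>?O. hseries (L \<inter> half_open_cone B u))"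
    by (intro fps_ext) (simp add: hseries_def fps_sum_nth)
  then have "(1 - fps_X) ^ DIM('a) * hseries (L \<inter> pushes_into (conic_hull V) u) = (\<Sum>B\<in>?O. hseries (half_open_box B u))"
    by (simp add: sum_distrib_left hseries_cone[OF optimal_lattice_basis] generic_optimal[OF u])
  also have "\<dots> = Abs_fps (\<lambda>n. int (box_count c u n))"
    by (intro fps_ext) (simp add: hseries_def fps_sum_nth box_count_def)
  finally show ?thesis .
qed

lemma box_count_reflect: "n \<le> DIM('a) \<Longrightarrow> box_count c (- u) n = box_count c u (DIM('a) - n)"
  unfolding box_count_def using hcount_box_reflect[OF optimal_lattice_basis] by (intro sum.cong) auto

lemma hcount_eq_0: "(\<And>x. x \<in> M \<Longrightarrow> ht x \<noteq> real n) \<Longrightarrow> hcount M n = 0"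
  unfolding hcount_def by (metis (mono_tags, lifting) card.empty empty_Collect_eq)

text \<open>The direction \<open>w\<close> has nonnegative height, hence a positive coordinate in every simplicial cone, and there the box points have coordinate less than one.\<close>

lemma box_count_beyond:
  assumes w: "w \<in> conic_hull V" "generic V w" and n: "DIM('a) \<le> n"
  shows "box_count c w n = 0"
  unfolding box_count_def
proof (intro sum.neutral ballI hcount_eq_0)
  fix B x assume B: "B \<in> optimal_bases V c" and x: "x \<in> half_open_box B w"
  note lB = optimal_lattice_basis[OF B]
  obtain a where a: "\<forall>v\<in>V. 0 \<le> a v" "w = (\<Sum>v\<in>V. a v *\<^sub>R v)" using w(1) by (auto simp: conic_hull_def)
  have "ht w = (\<Sum>v\<in>V. a v)" unfolding a(2) by (simp add: ht_simps V_ht)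
  then have "0 \<le> ht w" using a(1) by (simp add: sum_nonneg)
  then have "0 \<le> (\<Sum>b\<in>B. representation B w b)" using ht_coordinates[OF lB] by simp
  moreover have "B \<noteq> {}" using lattice_basisD[OF lB] by auto
  ultimately have "\<exists>b\<in>B. 0 \<le> representation B w b"
    using sum_strict_mono[of B "representation B w" "\<lambda>_. 0"] lattice_basisD(4)[OF lB] by force
  then have "\<exists>b\<in>B. 0 < representation B w b"
    using generic_optimal[OF w(2) B] by force
  then show "ht x \<noteq> real n" using box_height(3)[OF lB x] n by linarith
qed

lemma box_count_above_dim: "DIM('a) < n \<Longrightarrow> box_count c u n = 0"
  unfolding box_count_def using box_height(2)[OF optimal_lattice_basis] by (intro sum.neutral ballI hcount_eq_0) fastforce

text \<open>Let \<open>k\<close> be the largest height of a box point. By reciprocity the interior of the cone has its first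
  lattice points at height \<open>DIM('a) - k\<close>. A single box point of height \<open>k\<close> and none of height \<open>k - 1\<close>
  mean that there is one such point \<open>y\<close>, and that the next level of the interior has \<open>DIM('a)\<close> points.
  That level contains \<open>x + y\<close> for each lattice point \<open>x\<close> of the cone at height one.\<close>

theorem codegree_bound:
  assumes c: "generic_cost V c" and w: "w \<in> conic_hull V" "generic V w"
    and k: "1 \<le> k" "k < DIM('a)"
    and top: "box_count c w k = 1" "\<And>n. k < n \<Longrightarrow> box_count c w n = 0" "box_count c w (k - 1) = 0"
  shows "hcount (L \<inter> conic_hull V) 1 \<le> DIM('a)"
proof -
  \<comment> \<open>The lattice points in the interior of the cone.\<close>
  define I where "I = L \<inter> pushes_into (conic_hull V) (- w)"
  have gw: "generic V (- w)" using w(2) by (auto simp: generic_def bases_def representation_uminus)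
  define m where "m = DIM('a) - k"
  define G where "G n = fps_nth ((1 - fps_X) ^ DIM('a) * hseries I) n" for n
  define Q :: "int fps" where "Q = (1 - fps_X) ^ DIM('a)"
  have G: "G n = int (if n \<le> DIM('a) then box_count c w (DIM('a) - n) else 0)" for n
    unfolding G_def I_def hseries_pushed_cone[OF c gw] by (simp add: box_count_reflect box_count_above_dim)
  have Q: "fps_nth Q 0 = 1" "fps_nth Q 1 = - int DIM('a)"
    unfolding Q_def by (rule nth_one_minus_X_power)+
  have conv: "G n = (\<Sum>i\<le>n. int (hcount I i) * fps_nth Q (n - i))" for n
    unfolding G_def Q_def[symmetric] by (subst mult.commute) (simp add: fps_mult_nth hseries_def atLeast0AtMost)
  have low: "hcount I n = 0" if "n < m" for n
    using that
  proof (induction n rule: less_induct)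
    case (less n)
    have "G n = 0" unfolding G using less.prems top(2) by (simp add: m_def)
    moreover have "G n = int (hcount I n)"
      unfolding conv using less Q(1) by (simp add: lessThan_Suc_atMost[symmetric] del: lessThan_Suc_atMost)
    ultimately show ?case by simp
  qed
  have "G m = int (hcount I m)"
    unfolding conv using low Q(1) by (simp add: lessThan_Suc_atMost[symmetric] del: lessThan_Suc_atMost)
  then have m1: "hcount I m = 1" using top(1) k by (simp add: G m_def)
  have "G (Suc m) = int (hcount I (Suc m)) - int DIM('a)"
    unfolding conv using low Q m1 by (simp add: lessThan_Suc_atMost[symmetric] del: lessThan_Suc_atMost)
  moreover have "G (Suc m) = 0" using top(3) k by (simp add: G m_def)
  ultimately have m2: "hcount I (Suc m) = DIM('a)" by simp
  obtain y where y: "y \<in> I" "ht y = real m"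
    using m1 unfolding hcount_def by (metis (mono_tags, lifting) card_1_singletonE mem_Collect_eq singletonI)
  have mem: "x + y \<in> I" if "x \<in> L \<inter> conic_hull V" for x
  proof -
    have "eventually (\<lambda>\<epsilon>::real. x + (y + \<epsilon> *\<^sub>R (- w)) \<in> conic_hull V) (at_right 0)"
      using y(1) unfolding I_def pushes_into_def by (auto elim!: eventually_mono intro: conic_hull_add that[THEN IntD2])
    then show ?thesis using that y(1) lattice_add unfolding I_def pushes_into_def by (simp add: add_diff_eq)
  qed
  have "finite {x \<in> I. ht x = real (Suc m)}" using m2 unfolding hcount_def by (intro card_ge_0_finite) simp
  then have "hcount (L \<inter> conic_hull V) 1 \<le> hcount I (Suc m)" unfolding hcount_def
    by (rule card_inj_on_le[of "\<lambda>x. x + y", rotated 2]) (use mem y in \<open>auto simp: ht_simps\<close>)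
  then show ?thesis using m2 by simp
qed

end

section \<open>The finite group of a lattice simplex\<close>

lemma sum_by_values:
  fixes F :: "nat \<Rightarrow> real"
  assumes "finite B" "\<And>b. b \<in> B \<Longrightarrow> v b < (k::nat)"
  shows "(\<Sum>b\<in>B. F (v b)) = (\<Sum>j<k. real (card {b\<in>B. v b = j}) * F j)"
proof -
  have "(\<Sum>b\<in>B. F (v b)) = (\<Sum>j<k. \<Sum>b\<in>{b\<in>B. v b = j}. F (v b))"
    by (rule sum.group[symmetric]) (use assms in auto)
  also have "\<dots> = (\<Sum>j<k. real (card {b\<in>B. v b = j}) * F j)"
    by (intro sum.cong) auto
  finally show ?thesis .
qed

lemma frac_eq_iff: "frac x = frac y \<longleftrightarrow> x - y \<in> (\<int> :: real set)"
proof
  assume "frac x = frac y"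
  then have "x - y = of_int (\<lfloor>x\<rfloor> - \<lfloor>y\<rfloor>)" by (simp add: frac_def algebra_simps)
  then show "x - y \<in> \<int>" by (metis Ints_of_int)
next
  assume "x - y \<in> \<int>"
  then obtain k where "x - y = of_int k" by (auto elim: Ints_cases)
  then have "x = y + of_int k" by simp
  then show "frac x = frac y" by simp
qed

context graded_lattice
begin

text \<open>The representative of \<open>x\<close> in the box modulo the lattice spanned by \<open>B\<close>.\<close>

definition reduce :: "'a set \<Rightarrow> 'a \<Rightarrow> 'a" where
  "reduce B x = x - (\<Sum>b\<in>B. of_int \<lfloor>representation B x b\<rfloor> *\<^sub>R b)"

definition closed_box :: "'a set \<Rightarrow> 'a set" where
  "closed_box B = {x\<in>L. \<forall>b\<in>B. 0 \<le> representation B x b \<and> representation B x b < 1}"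

lemma finite_closed_box:
  assumes B: "lattice_basis B" shows "finite (closed_box B)"
proof -
  note [simp] = lattice_basisD[OF B]
  have "bounded {x. \<forall>b\<in>B. 0 \<le> representation B x b \<and> representation B x b < 1}"
  proof (rule boundedI)
    fix x assume x: "x \<in> {x. \<forall>b\<in>B. 0 \<le> representation B x b \<and> representation B x b < 1}"
    have "norm x = norm (\<Sum>b\<in>B. representation B x b *\<^sub>R b)" by (simp add: basis_expand)
    also have "\<dots> \<le> (\<Sum>b\<in>B. \<bar>representation B x b\<bar> * norm b)" by (rule sum_norm_le) simp
    also have "\<dots> \<le> (\<Sum>b\<in>B. 1 * norm b)"
      by (rule sum_mono, rule mult_right_mono) (use x in auto)
    finally show "norm x \<le> (\<Sum>b\<in>B. 1 * norm b)" .
  qed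
  from lattice_discrete[OF this] show ?thesis by (rule finite_subset[rotated]) (auto simp: closed_box_def)
qed

lemma representation_sum_basis:
  assumes B: "lattice_basis B" and b: "b \<in> B"
  shows "representation B (\<Sum>b\<in>B. f b *\<^sub>R b) b = f b"
  using representation_unique[OF lattice_basisD(1)[OF B] refl b] .

lemma representation_reduce:
  assumes "lattice_basis B" "b \<in> B"
  shows "representation B (reduce B x) b = frac (representation B x b)"
  unfolding reduce_def using assms
  by (simp add: representation_diff lattice_basisD(1) representation_sum_basis frac_def)

lemma reduce_lattice: "lattice_basis B \<Longrightarrow> x \<in> L \<Longrightarrow> reduce B x \<in> L"
  unfolding reduce_def by (intro lattice_diff lattice_sum lattice_scale_int) (auto dest: lattice_basisD(2))

lemma reduce_closed_box: "lattice_basis B \<Longrightarrow> x \<in> L \<Longrightarrow> reduce B x \<in> closed_box B"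
  unfolding closed_box_def by (simp add: reduce_lattice representation_reduce frac_lt_1)

lemma zero_closed_box: "lattice_basis B \<Longrightarrow> 0 \<in> closed_box B"
  by (simp add: closed_box_def lattice_zero real_vector.representation_zero)

text \<open>Congruence modulo the lattice spanned by \<open>B\<close>. By \<open>reduce_closed_box\<close> and
  \<open>lattice_congruent_closed_box_eq\<close> the box is a system of representatives of \<open>L\<close> modulo this lattice,
  so it carries a group structure, in which the relations below are computed with multiples in \<open>L\<close>.\<close>

definition lattice_congruent :: "'a set \<Rightarrow> 'a \<Rightarrow> 'a \<Rightarrow> bool" where
  "lattice_congruent B x y \<longleftrightarrow> (\<forall>b\<in>B. representation B x b - representation B y b \<in> \<int>)"

lemma lattice_congruent_iff_reduce:
  assumes B: "lattice_basis B"
  shows "lattice_congruent B x y \<longleftrightarrow> reduce B x = reduce B y"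
proof
  assume "lattice_congruent B x y"
  then show "reduce B x = reduce B y"
    by (intro basis_eqI[OF lattice_basisD(1)[OF B]])
      (auto simp: lattice_congruent_def representation_reduce[OF B] frac_eq_iff)
next
  assume "reduce B x = reduce B y"
  then show "lattice_congruent B x y"
    unfolding lattice_congruent_def by (metis representation_reduce[OF B] frac_eq_iff)
qed

lemma reduce_id: "lattice_basis B \<Longrightarrow> x \<in> closed_box B \<Longrightarrow> reduce B x = x"
  by (rule basis_eqI[OF lattice_basisD(1)]) (auto simp: representation_reduce closed_box_def frac_eq)

lemma lattice_congruent_closed_box_eq:
  "lattice_basis B \<Longrightarrow> x \<in> closed_box B \<Longrightarrow> y \<in> closed_box B \<Longrightarrow> lattice_congruent B x y \<Longrightarrow> x = y"
  by (simp add: lattice_congruent_iff_reduce reduce_id)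

lemma lattice_congruent_reduce: "lattice_basis B \<Longrightarrow> lattice_congruent B (reduce B x) x"
  unfolding lattice_congruent_def by (auto simp: representation_reduce frac_def)

lemma lattice_congruent_sym: "lattice_congruent B x y \<Longrightarrow> lattice_congruent B y x"
  unfolding lattice_congruent_def by (metis Ints_minus minus_diff_eq)
lemma lattice_congruent_trans: "lattice_congruent B x y \<Longrightarrow> lattice_congruent B y z \<Longrightarrow> lattice_congruent B x z"
  unfolding lattice_congruent_def by (metis Ints_add diff_add_cancel add_diff_eq)
lemma lattice_congruent_refl: "lattice_congruent B x x" by (simp add: lattice_congruent_def)
lemma lattice_congruent_diff:
  assumes "lattice_basis B" "lattice_congruent B x y" "lattice_congruent B x' y'" shows "lattice_congruent B (x - x') (y - y')"
  unfolding lattice_congruent_def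
proof
  fix b assume "b \<in> B"
  then have "representation B x b - representation B y b \<in> \<int>" "representation B x' b - representation B y' b \<in> \<int>"
    using assms(2,3) unfolding lattice_congruent_def by auto
  from Ints_diff[OF this]
  show "representation B (x - x') b - representation B (y - y') b \<in> \<int>"
    by (simp add: representation_diff[OF lattice_basisD(1)[OF assms(1)]] algebra_simps)
qed

text \<open>A coordinate \<open>c\<close> strictly between \<open>0\<close> and \<open>1\<close> turns into \<open>1 - c\<close> under negation, and \<open>0\<close> remains \<open>0\<close>.\<close>

lemma ht_reduce_uminus:
  assumes B: "lattice_basis B" and g: "g \<in> closed_box B"
  shows "ht g + ht (reduce B (- g)) = real (card {b\<in>B. representation B g b \<noteq> 0})"
proof -
  note [simp] = lattice_basisD[OF B]
  have "ht g + ht (reduce B (- g)) = (\<Sum>b\<in>B. representation B g b + frac (- representation B g b))"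
    by (simp add: ht_coordinates[OF B] sum.distrib representation_reduce[OF B] representation_uminus)
  also have "\<dots> = (\<Sum>b\<in>B. if representation B g b \<noteq> 0 then 1 else 0)"
  proof (intro sum.cong refl)
    fix b assume "b \<in> B"
    then have "0 \<le> representation B g b" "representation B g b < 1" using g by (simp_all add: closed_box_def)
    then have fr: "frac (representation B g b) = representation B g b" by (simp add: frac_eq)
    then have "representation B g b \<in> \<int> \<longleftrightarrow> representation B g b = 0" using frac_eq_0_iff by metis
    then show "representation B g b + frac (- representation B g b) = (if representation B g b \<noteq> 0 then 1 else 0)"
      using fr by (simp add: frac_neg)
  qed
  finally show ?thesis by (simp add: sum.If_cases Int_def)
qed

lemma reduce_uminus_ne:
  assumes B: "lattice_basis B" and g: "g \<in> closed_box B" "g \<noteq> 0"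
  shows "reduce B (- g) \<noteq> 0"
proof
  assume "reduce B (- g) = 0"
  then have "lattice_congruent B (- g) 0" using B lattice_congruent_iff_reduce[OF B] reduce_id[OF B zero_closed_box[OF B]] by metis
  then have "lattice_congruent B g 0"
    by (simp add: lattice_congruent_def representation_uminus[OF lattice_basisD(1)[OF B]] real_vector.representation_zero)
  then show False using lattice_congruent_closed_box_eq[OF B g(1) zero_closed_box[OF B]] g by simp
qed

lemma nonzero_box_list:
  assumes B: "lattice_basis B" and card: "card (closed_box B) = Suc n"
  obtains xs where "closed_box B = insert 0 (set xs)" "distinct (0 # xs)" "length xs = n"
proof -
  have fin: "finite (closed_box B)" and z: "0 \<in> closed_box B"
    using finite_closed_box[OF B] zero_closed_box[OF B] by auto
  obtain xs where xs: "set xs = closed_box B - {0}" "distinct xs"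
    using finite_distinct_list[of "closed_box B - {0}"] fin by auto
  then have "length xs = n" using distinct_card[of xs] card z fin by simp
  with xs z that[of xs] show ?thesis by auto
qed

text \<open>In a group of order two the nonzero element is its own negative.\<close>

lemma order_two_box:
  assumes B: "lattice_basis B" and card: "card (closed_box B) = 2"
  obtains g where "closed_box B = {0, g}" "g \<noteq> 0" "2 * ht g = real (card {b\<in>B. representation B g b \<noteq> 0})"
proof -
  have z: "0 \<in> closed_box B" using zero_closed_box[OF B] .
  obtain g where g: "closed_box B = {0, g}" "g \<noteq> 0"
  proof -
    obtain xs where "closed_box B = insert 0 (set xs)" "distinct (0 # xs)" "length xs = 1"
      by (rule nonzero_box_list[OF B, of 1]) (use card in auto)
    then show ?thesis using that by (auto simp: length_Suc_conv)
  qed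
  have "g \<in> closed_box B" using g by simp
  then have "g \<in> L" unfolding closed_box_def by simp
  then have "reduce B (- g) \<in> closed_box B" by (intro reduce_closed_box[OF B] lattice_uminus)
  then have "reduce B (- g) = g" using reduce_uminus_ne[OF B, of g] g by auto
  then show ?thesis using that ht_reduce_uminus[OF B, of g] g by simp
qed

text \<open>In a group of order three the two nonzero elements are negatives of each other.\<close>

lemma order_three_box:
  assumes B: "lattice_basis B" and card: "card (closed_box B) = 3"
  obtains g h where "closed_box B = {0, g, h}" "g \<noteq> 0" "h \<noteq> 0" "g \<noteq> h" "ht g + ht h \<le> DIM('a)"
proof -
  note [simp] = lattice_basisD[OF B]
  have z: "0 \<in> closed_box B" using zero_closed_box[OF B] .
  obtain g h where g: "closed_box B = {0, g, h}" "g \<noteq> 0" "h \<noteq> 0" "g \<noteq> h"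
  proof -
    obtain xs where "closed_box B = insert 0 (set xs)" "distinct (0 # xs)" "length xs = 2"
      by (rule nonzero_box_list[OF B, of 2]) (use card in auto)
    then show ?thesis using that by (auto simp: length_Suc_conv numeral_2_eq_2)
  qed
  have gh: "g \<in> closed_box B" "h \<in> closed_box B" using g by auto
  have in_L: "g \<in> L" "h \<in> L" using gh unfolding closed_box_def by simp_all
  have neg: "reduce B (- g) \<in> closed_box B" using in_L by (intro reduce_closed_box[OF B] lattice_uminus)
  have "reduce B (- g) = h"
  proof (rule ccontr)
    assume "reduce B (- g) \<noteq> h"
    then have gg: "reduce B (- g) = g" using reduce_uminus_ne[OF B gh(1)] neg g by auto
    then have c1: "lattice_congruent B (- g) g" using lattice_congruent_reduce[OF B, of "- g"] lattice_congruent_sym by metis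
    have sum: "reduce B (g + h) \<in> {0, g, h}" using g(1) in_L reduce_closed_box[OF B lattice_add] by metis
    have c: "lattice_congruent B (g + h) (reduce B (g + h))" using lattice_congruent_reduce[OF B] lattice_congruent_sym by metis
    have "lattice_congruent B h (- g)" if "reduce B (g + h) = 0"
      using lattice_congruent_diff[OF B c lattice_congruent_refl[of B g]] that by simp
    then have "reduce B (g + h) \<noteq> 0" using c1 lattice_congruent_trans lattice_congruent_closed_box_eq[OF B] gh g by metis
    moreover have "lattice_congruent B h 0" if "reduce B (g + h) = g"
      using lattice_congruent_diff[OF B c lattice_congruent_refl[of B g]] that by simp
    then have "reduce B (g + h) \<noteq> g" using lattice_congruent_closed_box_eq[OF B gh(2) z] g by metis
    moreover have "lattice_congruent B g 0" if "reduce B (g + h) = h"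
      using lattice_congruent_diff[OF B c lattice_congruent_refl[of B h]] that by simp
    then have "reduce B (g + h) \<noteq> h" using lattice_congruent_closed_box_eq[OF B gh(1) z] g by metis
    ultimately show False using sum by auto
  qed
  then have "ht g + ht h = real (card {b\<in>B. representation B g b \<noteq> 0})" using ht_reduce_uminus[OF B gh(1)] by simp
  also have "\<dots> \<le> DIM('a)" using card_mono[of B "{b\<in>B. representation B g b \<noteq> 0}"] by simp
  finally show ?thesis using that g by blast
qed

text \<open>The first alternative is the Klein four-group: every coordinate is \<open>0\<close> or \<open>1/2\<close>, and \<open>a\<close>, \<open>b\<close>,
  \<open>c\<close> are the numbers of places where exactly \<open>x, y\<close>, exactly \<open>x, z\<close>, exactly \<open>y, z\<close> are nonzero.
  The second is the cyclic group with \<open>y = 2x\<close> and \<open>z = 3x\<close>, where \<open>a\<close>, \<open>b\<close>, \<open>c\<close> are the numbers of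
  coordinates \<open>1/4\<close>, \<open>1/2\<close>, \<open>3/4\<close> of \<open>x\<close>.\<close>

lemma order_four_box:
  assumes B: "lattice_basis B" and card: "card (closed_box B) = 4"
  obtains x y z a b c where "closed_box B = {0, x, y, z}" "distinct [0, x, y, z]" "a + b + c \<le> DIM('a)"
    "(2 * ht x = real (a + b) \<and> 2 * ht y = real (a + c) \<and> 2 * ht z = real (b + c)) \<or>
     (4 * ht x = real (a + 2 * b + 3 * c) \<and> 2 * ht y = real (a + c) \<and> 4 * ht z = real (3 * a + 2 * b + c))"
proof -
  note bas = lattice_basisD(1)[OF B]
  note [simp] = lattice_basisD(4,5)[OF B]
  let ?r = "representation B"
  have z: "0 \<in> closed_box B" using zero_closed_box[OF B] .
  have fin: "finite (closed_box B)" using finite_closed_box[OF B] .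
  have cl: "x \<in> L" if "x \<in> closed_box B" for x using that by (simp add: closed_box_def)
  have ne: "lattice_congruent B x y \<longleftrightarrow> x = y" if "x \<in> closed_box B" "y \<in> closed_box B" for x y
    using that lattice_congruent_closed_box_eq[OF B] lattice_congruent_refl by blast
  have cr: "lattice_congruent B (reduce B x) x" for x by (rule lattice_congruent_reduce[OF B])
  have multiple: "lattice_congruent B (real i *\<^sub>R g) (real j *\<^sub>R g) \<longleftrightarrow> lattice_congruent B (real (j - i) *\<^sub>R g) 0" if "i \<le> j" for i j g
  proof -
    have "real j * ?r g b = real i * ?r g b + real (j - i) * ?r g b" for b
      using that by (simp add: of_nat_diff algebra_simps)
    then show ?thesis
      by (simp add: lattice_congruent_def representation_scaleR[OF bas] real_vector.representation_zero)
  qed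
  show ?thesis
  proof (cases "\<exists>g\<in>closed_box B. \<not> lattice_congruent B (2 *\<^sub>R g) 0")
    case True
    then obtain g where g: "g \<in> closed_box B" "\<not> lattice_congruent B (2 *\<^sub>R g) 0" by auto
    then have c2: "\<not> lattice_congruent B (real 2 *\<^sub>R g) 0" by simp
    have c1: "\<not> lattice_congruent B (real 1 *\<^sub>R g) 0" using c2 ne[OF g(1) z] by (auto simp: lattice_congruent_refl)
    have gL: "real i *\<^sub>R g \<in> L" for i using lattice_scale_nat[OF cl[OF g(1)]] .
    have red: "reduce B (real i *\<^sub>R g) \<in> closed_box B" for i using reduce_closed_box[OF B gL] .
    define gs where "gs i = reduce B (real i *\<^sub>R g)" for i
    have gs_box: "gs i \<in> closed_box B" for i unfolding gs_def by (rule red)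
    have gs_eq: "gs i = gs j \<longleftrightarrow> lattice_congruent B (real (j - i) *\<^sub>R g) 0" if "i \<le> j" for i j
      unfolding gs_def using lattice_congruent_iff_reduce[OF B] multiple[OF that] by simp
    have c3: "\<not> lattice_congruent B (real 3 *\<^sub>R g) 0"
    proof
      assume c3: "lattice_congruent B (real 3 *\<^sub>R g) 0"
      have dist: "distinct [gs 0, gs 1, gs 2]" using c1 c2 by (simp add: gs_eq)
      have "\<exists>h\<in>closed_box B. h \<notin> {gs 0, gs 1, gs 2}"
      proof (rule ccontr)
        assume "\<not> ?thesis"
        then have "closed_box B \<subseteq> set [gs 0, gs 1, gs 2]" by auto
        then have "card (closed_box B) \<le> card (set [gs 0, gs 1, gs 2])" by (rule card_mono[rotated]) simp
        also have "\<dots> \<le> 3" using card_length[of "[gs 0, gs 1, gs 2]"] by simp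
        finally show False using card by simp
      qed
      then obtain h where h: "h \<in> closed_box B" "h \<noteq> gs 0" "h \<noteq> gs 1" "h \<noteq> gs 2" by auto
      define k where "k = reduce B (h + g)"
      have k: "lattice_congruent B k (h + g)" "k \<in> closed_box B" 
        unfolding k_def using cr reduce_closed_box[OF B lattice_add[OF cl[OF h(1)] cl[OF g(1)]]] by simp_all
      have hgs: "\<not> lattice_congruent B h (real i *\<^sub>R g)" if "i < 3" for i
      proof
        assume "lattice_congruent B h (real i *\<^sub>R g)"
        then have "h = gs i" using lattice_congruent_iff_reduce[OF B] reduce_id[OF B h(1)] unfolding gs_def by metis
        then show False using h that by (auto simp: numeral_3_eq_3 less_Suc_eq numeral_2_eq_2)
      qed
      have kgs: "k \<noteq> gs i" if "i < 3" for i
      proof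
        assume "k = gs i"
        then have "lattice_congruent B (h + g) (real i *\<^sub>R g)" using k(1) cr lattice_congruent_sym lattice_congruent_trans gs_def by metis
        from lattice_congruent_diff[OF B this lattice_congruent_refl[of B g]]
        have c: "lattice_congruent B h (real i *\<^sub>R g - g)" by simp
        show False
        proof (cases i)
          case 0
          have "lattice_congruent B (real i *\<^sub>R g - g) (real 2 *\<^sub>R g)"
            using lattice_congruent_sym[OF lattice_congruent_diff[OF B c3 lattice_congruent_refl[of B g]]] scaleR_add_left[of 2 1 g] 0 by simp
          then show False using hgs[of 2] c lattice_congruent_trans by force
        next
          case (Suc j)
          then have "real i *\<^sub>R g - g = real j *\<^sub>R g" by (simp add: scaleR_add_left)
          then show False using hgs[of j] c that Suc by simp
        qed
      qed
      have kh: "k \<noteq> h"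
      proof
        assume "k = h"
        then have "lattice_congruent B (h + g) h" using k lattice_congruent_sym by metis
        from lattice_congruent_diff[OF B this lattice_congruent_refl[of B h]] show False using c1 by simp
      qed
      \<comment> \<open>Two cosets of a subgroup of order three do not fit into four elements; five of their
        elements suffice to see this.\<close>
      have "distinct [gs 0, gs 1, gs 2, h, k]" using dist h kh kgs[of 0] kgs[of 1] kgs[of 2] by auto
      then have "card (set [gs 0, gs 1, gs 2, h, k]) = 5" by (subst distinct_card) auto
      moreover have "set [gs 0, gs 1, gs 2, h, k] \<subseteq> closed_box B" using gs_box h(1) k(2) by simp
      then have "card (set [gs 0, gs 1, gs 2, h, k]) \<le> 4" using card card_mono[OF fin] by metis
      ultimately show False by simp
    qed
    have dist: "distinct [gs 0, gs 1, gs 2, gs 3]" using c1 c2 c3 by (simp add: gs_eq)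
    have sub: "set [gs 0, gs 1, gs 2, gs 3] \<subseteq> closed_box B" using gs_box by simp
    have "card (set [gs 0, gs 1, gs 2, gs 3]) = 4" using distinct_card[OF dist] by simp
    then have box: "closed_box B = set [gs 0, gs 1, gs 2, gs 3]" using card_subset_eq[OF fin sub] card by simp
    have gs01: "gs 0 = 0" "gs 1 = g" unfolding gs_def using reduce_id[OF B z] reduce_id[OF B g(1)] by auto
    have "gs 4 \<in> set [gs 0, gs 1, gs 2, gs 3]" using gs_box[of 4] box by simp
    moreover have "gs 4 \<noteq> gs 1" "gs 4 \<noteq> gs 2" "gs 4 \<noteq> gs 3"
      using gs_eq[of 1 4] gs_eq[of 2 4] gs_eq[of 3 4] c1 c2 c3 by auto
    ultimately have "gs 0 = gs 4" by auto
    then have c4: "lattice_congruent B (real 4 *\<^sub>R g) 0" using gs_eq[of 0 4] by simp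
    define v where "v b = nat \<lfloor>4 * ?r g b\<rfloor>" for b
    have v: "v b < 4" "?r g b = real (v b) / 4" if "b \<in> B" for b
    proof -
      have "4 * ?r g b \<in> \<int>" using c4 that by (simp add: lattice_congruent_def representation_scaleR[OF bas] real_vector.representation_zero)
      moreover have "0 \<le> ?r g b" "?r g b < 1" using g that by (auto simp: closed_box_def)
      ultimately show "v b < 4" "?r g b = real (v b) / 4" unfolding v_def by (auto elim!: Ints_cases)
    qed
    have hgs: "ht (gs i) = (\<Sum>j<4. real (card {b\<in>B. v b = j}) * frac (real i * real j / 4))" for i
    proof -
      have "ht (gs i) = (\<Sum>b\<in>B. frac (real i * real (v b) / 4))"
        unfolding ht_coordinates[OF B] gs_def by (rule sum.cong) (auto simp: representation_reduce[OF B] representation_scaleR[OF bas] v(2))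
      then show ?thesis using sum_by_values[of B v 4 "\<lambda>j. frac (real i * real j / 4)"] v by simp
    qed
    have fr: "frac (1/4) = (1/4::real)" "frac (2/4) = (2/4::real)" "frac (3/4) = (3/4::real)" "frac (4/4) = (0::real)"
       "frac (6/4) = (2/4::real)" "frac (9/4) = (1/4::real)" "frac 1 = (0::real)" "frac (3/2) = (1/2::real)" "frac (1/2) = (1/2::real)"
      by (simp_all add: frac_def floor_eq_iff)
    have lt4: "{..<4::nat} = {0,1,2,3}" by auto
    define a b c where "a = card {b\<in>B. v b = 1}" "b = card {b\<in>B. v b = 2}" "c = card {b\<in>B. v b = 3}"
    note abc = a_b_c_def
    have "a + b + c = card ({b\<in>B. v b = 1} \<union> {b\<in>B. v b = 2} \<union> {b\<in>B. v b = 3})"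
      unfolding abc by (subst card_Un_disjoint; (subst card_Un_disjoint)?) auto
    also have "\<dots> \<le> card B" by (rule card_mono) auto
    finally have "a + b + c \<le> DIM('a)" by simp
    moreover have "4 * ht g = real (a + 2 * b + 3 * c)" "2 * ht (gs 2) = real (a + c)" "4 * ht (gs 3) = real (3 * a + 2 * b + c)"
      using hgs[of 1] hgs[of 2] hgs[of 3] fr unfolding gs01 lt4 abc by simp_all
    ultimately show ?thesis using that[of g "gs 2" "gs 3" a b c] box dist gs01 by simp
  next
    case False
    then have two: "lattice_congruent B (2 *\<^sub>R g) 0" if "g \<in> closed_box B" for g using that by blast
    obtain g h k where box: "closed_box B = {0, g, h, k}" and dist: "distinct [0, g, h, k]"
    proof -
      obtain xs where "closed_box B = insert 0 (set xs)" "distinct (0 # xs)" "length xs = 3"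
        by (rule nonzero_box_list[OF B, of 3]) (use card in auto)
      then show ?thesis using that by (auto simp: length_Suc_conv numeral_3_eq_3)
    qed
    have gh: "g \<in> closed_box B" "h \<in> closed_box B" "k \<in> closed_box B" using box by auto
    define s where "s = reduce B (g + h)"
    have s: "lattice_congruent B (g + h) s" "s \<in> closed_box B" unfolding s_def using cr lattice_congruent_sym reduce_closed_box[OF B lattice_add] cl gh by metis+
    have "s \<noteq> 0"
    proof
      assume "s = 0"
      then have "lattice_congruent B (2 *\<^sub>R g - (g + h)) (0 - 0)" using s lattice_congruent_diff[OF B two[OF gh(1)]] by metis
      then have "lattice_congruent B (g - h) 0" by (simp add: scaleR_2)
      then have "lattice_congruent B g h" by (simp add: lattice_congruent_def representation_diff[OF bas] real_vector.representation_zero)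
      then show False using ne gh dist by auto
    qed
    moreover have "s \<noteq> g"
      using lattice_congruent_diff[OF B s(1) lattice_congruent_refl[of B g]] ne[OF gh(2) z] dist by auto
    moreover have "s \<noteq> h"
      using lattice_congruent_diff[OF B s(1) lattice_congruent_refl[of B h]] ne[OF gh(1) z] dist by auto
    ultimately have sk: "s = k" using s(2) box by auto
    have half: "?r g b = 0 \<or> ?r g b = 1/2" if "g \<in> closed_box B" "b \<in> B" for g b
    proof -
      have "2 * ?r g b \<in> \<int>" using two[OF that(1)] that by (simp add: lattice_congruent_def representation_scaleR[OF bas] real_vector.representation_zero)
      moreover have "0 \<le> ?r g b" "?r g b < 1" using that by (auto simp: closed_box_def)
      moreover from calculation(1) obtain m where "2 * ?r g b = of_int m" by (auto elim: Ints_cases)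
      ultimately have "2 * ?r g b = of_int m" "m = 0 \<or> m = 1" by linarith+
      then show ?thesis by auto
    qed
    \<comment> \<open>The value encodes which two of the three nonzero elements have coordinate \<open>1/2\<close> at \<open>b\<close>.\<close>
    define v where "v b = (if ?r g b = 0 then (if ?r h b = 0 then 0 else 3) else (if ?r h b = 0 then 2 else 1::nat))" for b
    have rk: "?r k b = frac (?r g b + ?r h b)" if "b \<in> B" for b
      using that unfolding sk[symmetric] s_def by (simp add: representation_reduce[OF B] representation_add[OF bas])
    have fr: "frac (1/2) = (1/2::real)" "frac 1 = (0::real)" by (simp_all add: frac_def floor_eq_iff)
    have vals: "?r g b = (if v b \<in> {1,2} then 1/2 else 0)" "?r h b = (if v b \<in> {1,3} then 1/2 else 0)"
      "?r k b = (if v b \<in> {2,3} then 1/2 else 0)" "v b < 4" if "b \<in> B" for b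
    proof -
      show g: "?r g b = (if v b \<in> {1,2} then 1/2 else 0)" and h: "?r h b = (if v b \<in> {1,3} then 1/2 else 0)"
        using half[OF gh(1) that] half[OF gh(2) that] by (auto simp: v_def)
      show v4: "v b < 4" by (simp add: v_def)
      then have "v b \<in> {0, 1, 2, 3}" by auto
      then show "?r k b = (if v b \<in> {2,3} then 1/2 else 0)"
        unfolding rk[OF that] g h by (auto simp: fr)
    qed
    have hs: "ht x = (\<Sum>j<4. real (card {b\<in>B. v b = j}) * F j)" if "\<And>b. b \<in> B \<Longrightarrow> ?r x b = F (v b)" for x F
      using sum_by_values[of B v 4 F] vals(4) that unfolding ht_coordinates[OF B] by simp
    have lt4: "{..<4::nat} = {0,1,2,3}" by auto
    define a b c where "a = card {b\<in>B. v b = 1}" "b = card {b\<in>B. v b = 2}" "c = card {b\<in>B. v b = 3}"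
    note abc = a_b_c_def
    have "a + b + c = card ({b\<in>B. v b = 1} \<union> {b\<in>B. v b = 2} \<union> {b\<in>B. v b = 3})"
      unfolding abc by (subst card_Un_disjoint; (subst card_Un_disjoint)?) auto
    also have "\<dots> \<le> card B" by (rule card_mono) auto
    finally have "a + b + c \<le> DIM('a)" by simp
    moreover have "2 * ht g = real (a + b)" "2 * ht h = real (a + c)" "2 * ht k = real (b + c)"
      using hs[OF vals(1)] hs[OF vals(2)] hs[OF vals(3)] unfolding lt4 abc by simp_all
    ultimately show ?thesis using that[of g h k a b c] box dist by simp
  qed
qed

text \<open>The element of the half-open box congruent to an element \<open>g\<close> of the closed one: a coordinate whose
  unit interval is \<open>(0, 1]\<close> has the value \<open>1\<close> in place of \<open>0\<close>.\<close>

definition lift_box :: "'a set \<Rightarrow> 'a \<Rightarrow> 'a \<Rightarrow> 'a" where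
  "lift_box B u g = g + \<Sum>{b\<in>B. representation B g b = 0 \<and> representation B u b < 0}"

lemma representation_lift_box:
  assumes B: "lattice_basis B" and b: "b \<in> B"
  shows "representation B (lift_box B u g) b =
    (if representation B g b = 0 \<and> representation B u b < 0 then 1 else representation B g b)"
proof -
  note [simp] = lattice_basisD[OF B]
  let ?S = "{b\<in>B. representation B g b = 0 \<and> representation B u b < 0}"
  have "representation B (\<Sum>?S) b = (\<Sum>b'\<in>?S. if b' = b then 1 else 0)"
    unfolding representation_sum[OF lattice_basisD(1)[OF B]] by (rule sum.cong) (auto simp: representation_self)
  then show ?thesis using b by (simp add: lift_box_def representation_add)
qed

lemma half_open_box_eq:
  assumes B: "lattice_basis B" and u: "\<And>b. b \<in> B \<Longrightarrow> representation B u b \<noteq> 0"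
  shows "half_open_box B u = lift_box B u ` closed_box B" and "inj_on (lift_box B u) (closed_box B)"
proof -
  note [simp] = lattice_basisD[OF B]
  have red: "reduce B (lift_box B u g) = g" if "g \<in> closed_box B" for g
    by (rule basis_eqI[OF lattice_basisD(1)[OF B]])
      (use that in \<open>auto simp: representation_reduce[OF B] representation_lift_box[OF B] closed_box_def frac_eq\<close>)
  then show "inj_on (lift_box B u) (closed_box B)" by (metis inj_onI)
  show "half_open_box B u = lift_box B u ` closed_box B"
  proof (intro equalityI subsetI)
    fix x assume x: "x \<in> half_open_box B u"
    have "lift_box B u (reduce B x) = x"
    proof (rule basis_eqI[OF lattice_basisD(1)[OF B]])
      fix b assume b: "b \<in> B"
      then have c: "0 < representation B x b \<or> representation B x b = 0 \<and> 0 < representation B u b"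
         "representation B x b < 1 \<or> representation B x b = 1 \<and> representation B u b < 0"
        using x by (auto simp: half_open_slab_def half_open_cone_def)
      show "representation B (lift_box B u (reduce B x)) b = representation B x b"
        unfolding representation_lift_box[OF B b] representation_reduce[OF B b]
        using c by (auto simp: frac_eq_0_iff frac_eq elim!: Ints_cases)
    qed
    moreover have "reduce B x \<in> closed_box B" using x by (intro reduce_closed_box[OF B]) (auto simp: half_open_slab_def)
    ultimately show "x \<in> lift_box B u ` closed_box B" by force
  next
    fix x assume "x \<in> lift_box B u ` closed_box B"
    then obtain g where g: "g \<in> closed_box B" "x = lift_box B u g" by auto
    have "x \<in> L" using g unfolding lift_box_def by (auto intro!: lattice_add lattice_sum simp: closed_box_def)
    moreover have "(0 < representation B x b \<or> representation B x b = 0 \<and> 0 < representation B u b) \<and>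
        (representation B x b < 1 \<or> representation B x b = 1 \<and> representation B u b < 0)" if b: "b \<in> B" for b
    proof -
      have "0 \<le> representation B g b" "representation B g b < 1" using g(1) b by (simp_all add: closed_box_def)
      then show ?thesis using u[OF b] unfolding g(2) representation_lift_box[OF B b] by auto
    qed
    ultimately show "x \<in> half_open_box B u"
      by (simp add: half_open_slab_def half_open_cone_def)
  qed
qed

lemma ht_lift_box:
  assumes B: "lattice_basis B"
  shows "ht (lift_box B u g) = ht g + real (card {b\<in>B. representation B g b = 0 \<and> representation B u b < 0})"
  using lattice_basisD[OF B] by (simp add: lift_box_def ht_simps)

lemma hcount_half_open_box:
  assumes B: "lattice_basis B" and u: "\<And>b. b \<in> B \<Longrightarrow> representation B u b \<noteq> 0"
  shows "hcount (half_open_box B u) n = (\<Sum>g\<in>closed_box B. if ht (lift_box B u g) = real n then 1 else 0)"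
proof -
  have "{x \<in> half_open_box B u. ht x = real n} = lift_box B u ` {g\<in>closed_box B. ht (lift_box B u g) = real n}"
    using half_open_box_eq[OF B u] by auto
  then have "hcount (half_open_box B u) n = card {g\<in>closed_box B. ht (lift_box B u g) = real n}"
    unfolding hcount_def using half_open_box_eq(2)[OF B u] by (simp add: card_image inj_on_subset)
  then show ?thesis by (simp add: sum.If_cases finite_closed_box[OF B] Int_def)
qed

lemma lift_box_closed:
  assumes B: "lattice_basis B" and u: "\<And>b. b \<in> B \<Longrightarrow> 0 < representation B u b"
  shows "lift_box B u g = g"
proof -
  have "{b\<in>B. representation B g b = 0 \<and> representation B u b < 0} = {}" using u by fastforce
  then show ?thesis unfolding lift_box_def by (metis add_0_right sum.empty)
qed

end

context graded_lattice
begin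

lemma box_height_nat:
  assumes B: "lattice_basis B" and x: "x \<in> half_open_box B u"
  obtains m :: nat where "ht x = real m" "m \<le> DIM('a)"
proof -
  have "ht x \<in> \<int>" using x by (intro ht_Ints) (auto simp: half_open_slab_def)
  then obtain m where "ht x = of_int m" by (auto elim: Ints_cases)
  then show ?thesis using box_height(1,2)[OF B x] that[of "nat m"] by simp
qed

lemma closed_box_height_nat:
  assumes B: "lattice_basis B" and x: "x \<in> closed_box B"
  obtains m :: nat where "ht x = real m"
proof -
  have "x \<in> L" using x by (simp add: closed_box_def)
  then have "ht x \<in> \<int>" by (rule ht_Ints)
  moreover have "0 \<le> ht x" unfolding ht_coordinates[OF B] using x by (intro sum_nonneg) (simp add: closed_box_def)
  ultimately show ?thesis using that by (metis Ints_cases of_int_0_le_iff of_int_of_nat_eq zero_le_imp_eq_int)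
qed

lemma sum_hcount_half_open_box:
  assumes B: "lattice_basis B" and u: "\<And>b. b \<in> B \<Longrightarrow> representation B u b \<noteq> 0"
  shows "(\<Sum>n\<le>DIM('a). hcount (half_open_box B u) n) = card (closed_box B)"
proof -
  have "(\<Sum>n\<le>DIM('a). hcount (half_open_box B u) n)
      = (\<Sum>g\<in>closed_box B. \<Sum>n\<le>DIM('a). if ht (lift_box B u g) = real n then 1 else 0)"
    by (subst sum.swap) (simp add: hcount_half_open_box[OF B u])
  also have "\<dots> = (\<Sum>g\<in>closed_box B. 1)"
  proof (rule sum.cong[OF refl])
    fix g assume "g \<in> closed_box B"
    then have "lift_box B u g \<in> half_open_box B u" using half_open_box_eq(1)[OF B u] by blast
    then obtain m where m: "ht (lift_box B u g) = real m" "m \<le> DIM('a)" by (rule box_height_nat[OF B])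
    show "(\<Sum>n\<le>DIM('a). if ht (lift_box B u g) = real n then 1 else 0) = (1::nat)"
      unfolding m(1) of_nat_eq_iff using m(2) by simp
  qed
  finally show ?thesis by simp
qed

end

context lattice_cone
begin

lemma sum_box_count:
  assumes "generic V u"
  shows "(\<Sum>n\<le>DIM('a). box_count c u n) = (\<Sum>B\<in>optimal_bases V c. card (closed_box B))"
  unfolding box_count_def
  by (subst sum.swap) (intro sum.cong refl sum_hcount_half_open_box optimal_lattice_basis generic_optimal[OF assms])

section \<open>Vertex sets with a single linear relation\<close>

text \<open>Adding a multiple of a linear relation among \<open>V\<close> makes the coefficient of \<open>v\<close> vanish.\<close>

lemma representation_complement:
  assumes rel: "(\<Sum>v\<in>V. \<gamma> v *\<^sub>R v) = 0" and v: "v \<in> V" "\<gamma> v \<noteq> 0" and B: "is_basis (V - {v})" and b: "b \<in> V - {v}"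
  shows "representation (V - {v}) (\<Sum>u\<in>V. a u *\<^sub>R u) b = a b - a v / \<gamma> v * \<gamma> b"
proof (rule representation_unique[OF B _ b])
  have "(\<Sum>u\<in>V. a u *\<^sub>R u) = (\<Sum>u\<in>V. a u *\<^sub>R u) - (a v / \<gamma> v) *\<^sub>R (\<Sum>u\<in>V. \<gamma> u *\<^sub>R u)"
    by (simp add: rel)
  also have "\<dots> = (\<Sum>u\<in>V. (a u - a v / \<gamma> v * \<gamma> u) *\<^sub>R u)"
    by (simp add: scaleR_sum_right sum_subtractf scaleR_diff_left)
  also have "\<dots> = (\<Sum>u\<in>V-{v}. (a u - a v / \<gamma> v * \<gamma> u) *\<^sub>R u)"
    using v finite_V by (subst sum.remove[of V v]) auto
  finally show "(\<Sum>u\<in>V. a u *\<^sub>R u) = (\<Sum>u\<in>V-{v}. (a u - a v / \<gamma> v * \<gamma> u) *\<^sub>R u)" .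
qed

lemma basis_complement:
  assumes card: "card V = Suc DIM('a)" and rel: "(\<Sum>v\<in>V. \<gamma> v *\<^sub>R v) = 0" and v: "v \<in> V" "\<gamma> v \<noteq> 0"
  shows "is_basis (V - {v})"
proof -
  have "\<gamma> v *\<^sub>R v = - (\<Sum>u\<in>V-{v}. \<gamma> u *\<^sub>R u)"
    using rel v(1) finite_V by (subst (asm) sum.remove[of V v]) (auto simp: eq_neg_iff_add_eq_0)
  then have "v = (1 / \<gamma> v) *\<^sub>R (- (\<Sum>u\<in>V-{v}. \<gamma> u *\<^sub>R u))" using v(2) by (metis divide_self_if scaleR_one scaleR_scaleR times_divide_eq_left mult_1)
  also have "\<dots> \<in> span (V - {v})" by (intro span_scale span_neg span_sum span_base) auto
  finally have "span (V - {v}) = span V" by (metis insert_Diff span_redundant v(1))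
  then have sp: "span (V - {v}) = UNIV" by (simp add: V_span)
  moreover have "independent (V - {v})"
    by (rule card_le_dim_spanning[of _ UNIV]) (use sp v finite_V card in auto)
  ultimately show ?thesis by (simp add: is_basis_def)
qed

lemma bases_complement:
  assumes card: "card V = Suc DIM('a)" and rel: "(\<Sum>v\<in>V. \<gamma> v *\<^sub>R v) = 0" and nz: "\<exists>v\<in>V. \<gamma> v \<noteq> 0"
  shows "bases V = (\<lambda>v. V - {v}) ` {v\<in>V. \<gamma> v \<noteq> 0}"
proof (intro equalityI subsetI)
  fix B assume "B \<in> bases V"
  then have B: "B \<subseteq> V" "is_basis B" by (auto simp: bases_def)
  then have "card (V - B) = 1" using card basis_card[of B] basis_finite[of B] by (simp add: card_Diff_subset)
  then obtain v where "V - B = {v}" by (auto simp: card_1_singleton_iff)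
  then have v: "v \<in> V" "B = V - {v}" using B by auto
  have "\<gamma> v \<noteq> 0"
  proof
    assume 0: "\<gamma> v = 0"
    then have "(\<Sum>u\<in>B. \<gamma> u *\<^sub>R u) = 0" using rel v finite_V by (simp add: sum_diff1)
    then have "\<forall>u\<in>B. \<gamma> u = 0"
      using B(2) basis_finite[OF B(2)] unfolding is_basis_def using independentD by (metis order_refl)
    then show False using 0 nz v by auto
  qed
  then show "B \<in> (\<lambda>v. V - {v}) ` {v\<in>V. \<gamma> v \<noteq> 0}" using v by auto
qed (use basis_complement[OF card rel] in \<open>auto simp: bases_def\<close>)

text \<open>Taking the coefficients of the relation as costs gives reduced costs whose sign is the sign of the coefficient.\<close>

lemma reduced_cost_complement:
  assumes card: "card V = Suc DIM('a)" and rel: "(\<Sum>v\<in>V. \<gamma> v *\<^sub>R v) = 0" and v: "v \<in> V" "\<gamma> v \<noteq> 0"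
  shows "reduced_cost \<gamma> (V - {v}) v = (\<Sum>u\<in>V. (\<gamma> u)\<^sup>2) / \<gamma> v"
proof -
  note B = basis_complement[OF card rel v]
  have vs: "v = (\<Sum>u\<in>V. (if u = v then 1 else 0) *\<^sub>R u)"
  proof -
    have "(\<Sum>u\<in>V. (if u = v then 1 else 0) *\<^sub>R u) = (\<Sum>u\<in>V. if u = v then u else 0)" by (rule sum.cong) auto
    then show ?thesis using v finite_V by simp
  qed
  have "representation (V - {v}) v b = - \<gamma> b / \<gamma> v" if "b \<in> V - {v}" for b
    using representation_complement[OF rel v B that, of "\<lambda>u. if u = v then 1 else 0"] vs that by simp
  then have "(\<Sum>b\<in>V-{v}. representation (V - {v}) v b * \<gamma> b) = (\<Sum>b\<in>V-{v}. - (\<gamma> b)\<^sup>2 / \<gamma> v)"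
    by (intro sum.cong) (auto simp: power2_eq_square)
  also have "\<dots> = - (\<Sum>b\<in>V-{v}. (\<gamma> b)\<^sup>2) / \<gamma> v" by (simp add: sum_divide_distrib sum_negf)
  finally have "reduced_cost \<gamma> (V - {v}) v = \<gamma> v + (\<Sum>b\<in>V-{v}. (\<gamma> b)\<^sup>2) / \<gamma> v"
    unfolding reduced_cost_def by simp
  also have "\<dots> = ((\<gamma> v)\<^sup>2 + (\<Sum>b\<in>V-{v}. (\<gamma> b)\<^sup>2)) / \<gamma> v" using v by (simp add: field_simps power2_eq_square)
  also have "(\<gamma> v)\<^sup>2 + (\<Sum>b\<in>V-{v}. (\<gamma> b)\<^sup>2) = (\<Sum>u\<in>V. (\<gamma> u)\<^sup>2)"
    using sum.remove[OF finite_V v(1), of "\<lambda>u. (\<gamma> u)\<^sup>2"] by simp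
  finally show ?thesis .
qed

text \<open>If \<open>V\<close> has one element more than a basis, it satisfies one linear relation \<open>\<gamma>\<close> up to scaling. The
  costs \<open>\<gamma>\<close> then select one of the two triangulations of \<open>V\<close>, whose simplices omit a point with
  positive coefficient.\<close>

lemma circuit_cost:
  assumes card: "card V = Suc DIM('a)" and rel: "(\<Sum>v\<in>V. \<gamma> v *\<^sub>R v) = 0" and nz: "\<exists>v\<in>V. \<gamma> v \<noteq> 0"
  shows "generic_cost V \<gamma>" and "optimal_bases V \<gamma> = (\<lambda>v. V - {v}) ` {v\<in>V. 0 < \<gamma> v}"
proof -
  have pos: "0 < (\<Sum>u\<in>V. (\<gamma> u)\<^sup>2)" using nz finite_V by (meson sum_pos2 zero_le_power2 zero_less_power2)
  have compl: "V - (V - {v}) = {v}" if "v \<in> V" for v using that by auto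
  have rc: "reduced_cost \<gamma> (V - {v}) v = (\<Sum>u\<in>V. (\<gamma> u)\<^sup>2) / \<gamma> v" if "v \<in> V" "\<gamma> v \<noteq> 0" for v
    using reduced_cost_complement[OF card rel that] .
  note bs = bases_complement[OF card rel nz]
  show "generic_cost V \<gamma>" unfolding generic_cost_def bs using pos by (auto simp: compl rc)
  show "optimal_bases V \<gamma> = (\<lambda>v. V - {v}) ` {v\<in>V. 0 < \<gamma> v}"
  proof (intro equalityI subsetI)
    fix B assume "B \<in> optimal_bases V \<gamma>"
    then obtain v where v: "v \<in> V" "\<gamma> v \<noteq> 0" "B = V - {v}" "\<forall>u\<in>V-B. 0 < reduced_cost \<gamma> B u"
      unfolding optimal_bases_def bs by auto
    then have "0 < (\<Sum>u\<in>V. (\<gamma> u)\<^sup>2) / \<gamma> v" using rc[of v] v(4)[rule_format, of v] by simp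
    then show "B \<in> (\<lambda>v. V - {v}) ` {v\<in>V. 0 < \<gamma> v}" using pos v by (auto simp: zero_less_divide_iff)
  next
    fix B assume "B \<in> (\<lambda>v. V - {v}) ` {v\<in>V. 0 < \<gamma> v}"
    then obtain v where v: "v \<in> V" "0 < \<gamma> v" "B = V - {v}" by auto
    then show "B \<in> optimal_bases V \<gamma>" unfolding optimal_bases_def bs using pos by (auto simp: compl rc)
  qed
qed

text \<open>The weights are chosen so that the sign of a coordinate in the simplex omitting \<open>v\<close> is decided by
  comparing \<open>r\<close>: the half-open simplex omitting \<open>v\<close> lacks the facets opposite to those points with
  positive coefficient that rank below \<open>v\<close>.\<close>

definition circuit_direction :: "('a \<Rightarrow> real) \<Rightarrow> ('a \<Rightarrow> real) \<Rightarrow> 'a" where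
  "circuit_direction \<gamma> r = (\<Sum>v\<in>V. (if \<gamma> v = 0 then 1 else \<bar>\<gamma> v\<bar> * r v) *\<^sub>R v)"

lemma circuit_direction:
  assumes card: "card V = Suc DIM('a)" and rel: "(\<Sum>v\<in>V. \<gamma> v *\<^sub>R v) = 0" and nz: "\<exists>v\<in>V. \<gamma> v \<noteq> 0"
    and r: "\<And>v. v \<in> V \<Longrightarrow> 0 < r v" "inj_on r V"
  shows "circuit_direction \<gamma> r \<in> conic_hull V" and "generic V (circuit_direction \<gamma> r)"
    and "v \<in> V \<Longrightarrow> 0 < \<gamma> v \<Longrightarrow> b \<in> V - {v} \<Longrightarrow>
      representation (V - {v}) (circuit_direction \<gamma> r) b < 0 \<longleftrightarrow> 0 < \<gamma> b \<and> r b < r v"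
proof -
  let ?w = "circuit_direction \<gamma> r"
  show "?w \<in> conic_hull V" unfolding circuit_direction_def by (intro conic_hullI) (auto simp: less_imp_le[OF r(1)])
  define s where "s v = (if \<gamma> v = 0 then 1 else \<bar>\<gamma> v\<bar> * r v)" for v
  have co: "representation (V - {v}) ?w b = s b - s v / \<gamma> v * \<gamma> b" if "v \<in> V" "\<gamma> v \<noteq> 0" "b \<in> V - {v}" for v b
    unfolding circuit_direction_def s_def[symmetric]
    using representation_complement[OF rel that(1,2) basis_complement[OF card rel that(1,2)] that(3)] .
  have pos: "representation (V - {v}) ?w b = (if 0 < \<gamma> b then \<gamma> b * (r b - r v) else if \<gamma> b = 0 then 1 else - \<gamma> b * (r b + r v))"
    if "v \<in> V" "0 < \<gamma> v" "b \<in> V - {v}" for v b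
    using that by (auto simp: co s_def algebra_simps)
  have neg: "representation (V - {v}) ?w b = (if 0 < \<gamma> b then \<gamma> b * (r b + r v) else if \<gamma> b = 0 then 1 else - \<gamma> b * (r b - r v))"
    if "v \<in> V" "\<gamma> v < 0" "b \<in> V - {v}" for v b
    using that by (auto simp: co s_def algebra_simps)
  have rne: "r b \<noteq> r v" "0 < r b + r v" if "v \<in> V" "b \<in> V - {v}" for v b
    using that r(2) r(1)[of v] r(1)[of b] by (auto simp: inj_on_def add_pos_pos)
  have "representation (V - {v}) ?w b \<noteq> 0" if v: "v \<in> V" "\<gamma> v \<noteq> 0" "b \<in> V - {v}" for v b
  proof (cases "0 < \<gamma> v")
    case True
    then show ?thesis unfolding pos[OF v(1) True v(3)] using rne[OF v(1,3)] by simp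
  next
    case False
    with v have *: "\<gamma> v < 0" by simp
    show ?thesis unfolding neg[OF v(1) * v(3)] using rne[OF v(1,3)] by simp
  qed
  then show "generic V ?w" unfolding generic_def bases_complement[OF card rel nz] by auto
  assume v: "v \<in> V" "0 < \<gamma> v" "b \<in> V - {v}"
  show "representation (V - {v}) ?w b < 0 \<longleftrightarrow> 0 < \<gamma> b \<and> r b < r v"
    unfolding pos[OF v] using rne[OF v(1,3)] by (auto simp: mult_less_0_iff zero_less_mult_iff)
qed

lemma circuit_exists:
  assumes card: "card V = Suc DIM('a)"
  obtains \<gamma> where "(\<Sum>v\<in>V. \<gamma> v *\<^sub>R v) = 0" "\<exists>v\<in>V. \<gamma> v \<noteq> 0"
proof -
  have "dependent V"
    using card independent_bound[of V] by auto
  then show ?thesis using that dependent_finite[OF finite_V] by auto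
qed

text \<open>If a single coefficient were positive, its point would be a nonnegative combination of the others.\<close>

lemma circuit_positive_part:
  assumes rel: "(\<Sum>v\<in>V. \<gamma> v *\<^sub>R v) = 0" and nz: "\<exists>v\<in>V. \<gamma> v \<noteq> 0"
    and vertex: "\<And>v. v \<in> V \<Longrightarrow> v \<notin> conic_hull (V - {v})"
  shows "2 \<le> card {v\<in>V. 0 < \<gamma> v}"
proof (rule ccontr)
  assume "\<not> ?thesis"
  then have le: "card {v\<in>V. 0 < \<gamma> v} \<le> 1" by simp
  have "(\<Sum>v\<in>V. \<gamma> v) = ht (\<Sum>v\<in>V. \<gamma> v *\<^sub>R v)" by (simp add: ht_simps V_ht)
  then have s0: "(\<Sum>v\<in>V. \<gamma> v) = 0" by (simp add: rel ht_simps)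
  have "\<exists>v\<in>V. 0 < \<gamma> v"
  proof (rule ccontr)
    assume "\<not> ?thesis"
    then have "\<forall>v\<in>V. - \<gamma> v = 0" using s0 finite_V sum_nonneg_eq_0_iff[of V "\<lambda>v. - \<gamma> v"] by (simp add: sum_negf not_less)
    then show False using nz by force
  qed
  then obtain v where v: "v \<in> V" "0 < \<gamma> v" by auto
  have others: "\<gamma> u \<le> 0" if "u \<in> V - {v}" for u
  proof (rule ccontr)
    assume "\<not> \<gamma> u \<le> 0"
    then have "{u, v} \<subseteq> {v\<in>V. 0 < \<gamma> v}" using v that by auto
    then have "card {u, v} \<le> 1" using le card_mono[of "{v\<in>V. 0 < \<gamma> v}" "{u, v}"] finite_V by simp
    then show False using that by simp
  qed
  have "\<gamma> v *\<^sub>R v = - (\<Sum>u\<in>V-{v}. \<gamma> u *\<^sub>R u)"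
    using rel v(1) finite_V by (subst (asm) sum.remove[of V v]) (auto simp: eq_neg_iff_add_eq_0)
  then have "v = (1 / \<gamma> v) *\<^sub>R (\<Sum>u\<in>V-{v}. (- \<gamma> u) *\<^sub>R u)" using v(2)
    by (simp add: sum_negf) (metis divide_self_if less_irrefl scaleR_one scaleR_scaleR times_divide_eq_left mult_1 scaleR_minus_right)
  moreover have "(1 / \<gamma> v) *\<^sub>R (\<Sum>u\<in>V-{v}. (- \<gamma> u) *\<^sub>R u) \<in> conic_hull (V - {v})"
    by (intro conic_hull_scale conic_hullI) (use others v in auto)
  ultimately show False using vertex[OF v(1)] by simp
qed

text \<open>A direction can be prescribed by saying which three points come first.\<close>

lemma exists_ranking:
  assumes "v1 \<noteq> v2" "v1 \<noteq> v3" "v2 \<noteq> v3"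
  obtains r :: "'a \<Rightarrow> real" where "\<And>v. 0 < r v" "inj_on r V" "r v1 = 1" "r v2 = 2" "r v3 = 3"
    "\<And>v. v \<in> V \<Longrightarrow> v \<notin> {v1, v2, v3} \<Longrightarrow> 3 < r v"
proof -
  obtain f :: "'a \<Rightarrow> nat" and n where f: "inj_on f V" using finite_imp_inj_to_nat_seg[OF finite_V] by blast
  define r where "r v = (if v = v1 then 1 else if v = v2 then 2 else if v = v3 then 3 else 4 + real (f v))" for v
  have "inj_on r V"
  proof (rule inj_onI)
    fix u v assume "u \<in> V" "v \<in> V" "r u = r v"
    then show "u = v" using inj_onD[OF f, of u v] by (simp add: r_def split: if_splits)
  qed
  with assms show ?thesis by (intro that[of r]) (simp_all add: r_def)
qed

end

section \<open>The exponents for a simplex\<close>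

lemma two_exponents:
  fixes x y j k :: nat
  assumes "\<And>n. of_bool (n = x) + of_bool (n = y) = (of_bool (n = j) + of_bool (n = k) :: nat)"
  shows "(x = j \<and> y = k) \<or> (x = k \<and> y = j)"
proof -
  have "x = j \<or> x = k"
  proof (rule ccontr)
    assume "\<not> ?thesis"
    then show False using assms[of x] by simp
  qed
  then show ?thesis
  proof
    assume "x = j"
    then have "y = k" using assms[of y] by (cases "y = k") simp_all
    then show ?thesis using \<open>x = j\<close> by simp
  next
    assume "x = k"
    then have "y = j" using assms[of y] by (cases "y = j") simp_all
    then show ?thesis using \<open>x = k\<close> by simp
  qed
qed

lemma three_exponents:
  fixes x y z i j k :: nat
  assumes *: "\<And>n. of_bool (n = x) + of_bool (n = y) + of_bool (n = z) = (of_bool (n = i) + of_bool (n = j) + of_bool (n = k) :: nat)"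
  shows "(x, y, z) \<in> {(i, j, k), (i, k, j), (j, i, k), (j, k, i), (k, i, j), (k, j, i)}"
proof -
  have "x = i \<or> x = j \<or> x = k"
  proof (rule ccontr)
    assume "\<not> ?thesis"
    then show False using *[of x] by simp
  qed
  then consider "x = i" | "x = j" | "x = k" by blast
  then show ?thesis
  proof cases
    case 1
    have "(y = j \<and> z = k) \<or> (y = k \<and> z = j)"
      by (rule two_exponents) (use * 1 in \<open>simp add: add.assoc\<close>)
    then show ?thesis using 1 by auto
  next
    case 2
    have "(y = i \<and> z = k) \<or> (y = k \<and> z = i)"
      by (rule two_exponents) (use * 2 in \<open>simp add: ac_simps\<close>)
    then show ?thesis using 2 by auto
  next
    case 3
    have "(y = i \<and> z = j) \<or> (y = j \<and> z = i)"
      by (rule two_exponents) (use * 3 in \<open>simp add: ac_simps\<close>)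
    then show ?thesis using 3 by auto
  qed
qed

context lattice_cone
begin

lemma hcount_half_open_box_bool:
  assumes "generic V u" "B \<in> optimal_bases V c"
  shows "hcount (half_open_box B u) n = (\<Sum>g\<in>closed_box B. of_bool (ht (lift_box B u g) = real n))"
  using hcount_half_open_box[OF optimal_lattice_basis[OF assms(2)] generic_optimal[OF assms]]
  by (simp add: of_bool_def)

text \<open>For a simplex the triangulation is trivial. The sum of all vertices is a direction in its interior, for which the box is closed.\<close>

lemma simplex_box_count:
  assumes V: "is_basis V"
  obtains c w where "generic_cost V c" "w \<in> conic_hull V" "generic V w"
    "\<And>n. box_count c w n = (\<Sum>g\<in>closed_box V. of_bool (ht g = real n))"
    "(\<Sum>n\<le>DIM('a). box_count c w n) = card (closed_box V)"
proof -
  have bV: "bases V = {V}"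
  proof (intro equalityI subsetI)
    fix B assume "B \<in> bases V"
    then have "B \<subseteq> V" "card B = card V" using basis_card[OF V] basis_card[of B] by (auto simp: bases_def)
    then show "B \<in> {V}" using card_subset_eq[OF finite_V] by auto
  qed (use V in \<open>auto simp: bases_def\<close>)
  obtain c where c: "generic_cost V c" by (rule generic_cost_exists[OF finite_V])
  have opt: "optimal_bases V c = {V}" unfolding optimal_bases_def bV by auto
  have lV: "lattice_basis V" using optimal_lattice_basis opt by blast
  define w where "w = (\<Sum>v\<in>V. (1::real) *\<^sub>R v)"
  have rw: "representation V w b = 1" if "b \<in> V" for b
    unfolding w_def using representation_sum_basis[OF lV that, of "\<lambda>_. 1"] .
  have w: "w \<in> conic_hull V" "generic V w"
    unfolding generic_def bV using rw conic_hullI[of V "\<lambda>_. 1"] by (auto simp: w_def)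
  have lift: "lift_box V w g = g" for g by (rule lift_box_closed[OF lV]) (simp add: rw)
  show ?thesis
  proof (rule that[OF c w])
    show "box_count c w n = (\<Sum>g\<in>closed_box V. of_bool (ht g = real n))" for n
      using hcount_half_open_box_bool[OF w(2), of V c n] by (simp add: box_count_def opt lift)
    show "(\<Sum>n\<le>DIM('a). box_count c w n) = card (closed_box V)" using sum_box_count[OF w(2), of c] opt by simp
  qed
qed

theorem simplex_exponents:
  assumes V: "is_basis V" and i: "1 \<le> i1" "i1 \<le> i2" "i2 \<le> i3" "i3 < DIM('a)"
    and bc: "\<And>c w n. generic_cost V c \<Longrightarrow> w \<in> conic_hull V \<Longrightarrow> generic V w \<Longrightarrow>
      box_count c w n = of_bool (n = 0) + of_bool (n = i1) + of_bool (n = i2) + of_bool (n = i3)"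
  shows "i3 \<le> i1 + i2" "i1 + i3 \<le> DIM('a)" "2 * i2 \<le> DIM('a)" "2 * i2 \<le> i1 + i3 \<or> i2 + i3 \<le> DIM('a)"
proof -
  obtain c w where c: "generic_cost V c" and w: "w \<in> conic_hull V" "generic V w"
    and count: "\<And>n. box_count c w n = (\<Sum>g\<in>closed_box V. of_bool (ht g = real n))"
    and total: "(\<Sum>n\<le>DIM('a). box_count c w n) = card (closed_box V)"
    by (rule simplex_box_count[OF V]) blast
  have lV: "lattice_basis V" using V V_lattice V_ht by (simp add: lattice_basis_def)
  have "card (closed_box V) = (\<Sum>n\<le>DIM('a). box_count c w n)" using total by simp
  also have "\<dots> = 4" unfolding bc[OF c w] using i by (simp add: sum.distrib of_bool_def)
  finally obtain x y z a b e where box: "closed_box V = {0, x, y, z}" and dist: "distinct [0, x, y, z]" and le: "a + b + e \<le> DIM('a)"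
    and hts: "(2 * ht x = real (a + b) \<and> 2 * ht y = real (a + e) \<and> 2 * ht z = real (b + e)) \<or>
     (4 * ht x = real (a + 2 * b + 3 * e) \<and> 2 * ht y = real (a + e) \<and> 4 * ht z = real (3 * a + 2 * b + e))"
    by (rule order_four_box[OF lV])
  obtain hx where hx: "ht x = real hx" by (rule closed_box_height_nat[OF lV, of x]) (use box in auto)
  obtain hy where hy: "ht y = real hy" by (rule closed_box_height_nat[OF lV, of y]) (use box in auto)
  obtain hz where hz: "ht z = real hz" by (rule closed_box_height_nat[OF lV, of z]) (use box in auto)
  have "of_bool (n = hx) + of_bool (n = hy) + of_bool (n = hz) = (of_bool (n = i1) + of_bool (n = i2) + of_bool (n = i3) :: nat)" for n
  proof -
    have "of_bool (n = 0) + of_bool (n = hx) + of_bool (n = hy) + of_bool (n = hz) = box_count c w n"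
      unfolding count box using dist by (simp add: hx hy hz ht_simps eq_commute[of _ n] add.assoc)
    then show ?thesis unfolding bc[OF c w] by simp
  qed
  from three_exponents[OF this]
  have perm: "(hx, hy, hz) \<in> {(i1, i2, i3), (i1, i3, i2), (i2, i1, i3), (i2, i3, i1), (i3, i1, i2), (i3, i2, i1)}" .
  have hts': "(2 * hx = a + b \<and> 2 * hy = a + e \<and> 2 * hz = b + e) \<or>
     (4 * hx = a + 2 * b + 3 * e \<and> 2 * hy = a + e \<and> 4 * hz = 3 * a + 2 * b + e)"
    using hts unfolding hx hy hz by linarith
  have "i3 \<le> i1 + i2 \<and> i1 + i3 \<le> DIM('a) \<and> 2 * i2 \<le> DIM('a) \<and> (2 * i2 \<le> i1 + i3 \<or> i2 + i3 \<le> DIM('a))"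
    using hts' perm i(1-3) le unfolding insert_iff empty_iff prod.inject by (elim disjE conjE; simp; linarith)
  then show "i3 \<le> i1 + i2" "i1 + i3 \<le> DIM('a)" "2 * i2 \<le> DIM('a)" "2 * i2 \<le> i1 + i3 \<or> i2 + i3 \<le> DIM('a)"
    by auto
qed

section \<open>The exponents for one more vertex than a simplex\<close>

text \<open>The case of one vertex more than a simplex has. Let \<open>p\<close> be the number of positive coefficients of
  the relation between the vertices. If \<open>p \<ge> 3\<close>, a direction can be chosen for which the zero element
  in the third simplex lifts to height \<open>2\<close>, so \<open>j = 2\<close>; the upper bound on \<open>2 * j\<close> holds because there
  are at least three positive and two negative coefficients. If \<open>p = 2\<close>, the two groups have four
  elements in total, and the zero elements account for the exponents \<open>0\<close> and \<open>1\<close>. Groups of orders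
  \<open>3\<close> and \<open>1\<close> give \<open>j + k \<le> DIM('a)\<close>, since the simplex with the larger group may be taken as the closed
  one. For two groups of order two the nonzero element \<open>g\<close> of the closed simplex has height \<open>j\<close> or \<open>k\<close>,
  which is half the size of its support. Equality \<open>2 * j = DIM('a)\<close> with \<open>k = j + 1\<close> would give both
  nonzero elements height \<open>j\<close> and full support, so that lifting changes neither of them and the exponent
  \<open>k\<close> is not attained.\<close>

theorem circuit_exponents:
  assumes card: "card V = Suc DIM('a)" and vertex: "\<And>v. v \<in> V \<Longrightarrow> v \<notin> conic_hull (V - {v})"
    and jk: "2 \<le> j" "j \<le> k" "k < DIM('a)"
    and bc: "\<And>c w n. generic_cost V c \<Longrightarrow> w \<in> conic_hull V \<Longrightarrow> generic V w \<Longrightarrow>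
      box_count c w n = of_bool (n = 0) + of_bool (n = 1) + of_bool (n = j) + of_bool (n = k)"
  shows "2 * j \<le> DIM('a)" and "k = j + 1 \<Longrightarrow> 3 \<le> j \<Longrightarrow> 2 * j < DIM('a)"
proof -
  obtain \<gamma> where rel: "(\<Sum>v\<in>V. \<gamma> v *\<^sub>R v) = 0" and nz: "\<exists>v\<in>V. \<gamma> v \<noteq> 0"
    by (rule circuit_exists[OF card])
  define Pos where "Pos = {v\<in>V. 0 < \<gamma> v}"
  have Pos: "Pos \<subseteq> V" "finite Pos" using finite_V by (auto simp: Pos_def)
  have p: "2 \<le> card Pos" unfolding Pos_def by (rule circuit_positive_part[OF rel nz vertex])
  have q: "2 \<le> card {v\<in>V. 0 < - \<gamma> v}"
    by (rule circuit_positive_part) (use rel nz vertex in \<open>auto simp: sum_negf\<close>)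
  note cost = circuit_cost[OF card rel nz]
  have opt: "optimal_bases V \<gamma> = (\<lambda>v. V - {v}) ` Pos" unfolding cost(2) Pos_def ..
  have lB: "lattice_basis (V - {v})" if "v \<in> Pos" for v using optimal_lattice_basis opt that by blast
  have injc: "inj_on (\<lambda>v. V - {v}) Pos" using Pos by (auto simp: inj_on_def)
  let ?w = "circuit_direction \<gamma>"
  have "2 * j \<le> DIM('a) \<and> (k = j + 1 \<longrightarrow> 3 \<le> j \<longrightarrow> 2 * j < DIM('a))"
  proof (cases "card Pos = 2")
    case False
    then have "3 \<le> card Pos" using p by simp
    then obtain T where "T \<subseteq> Pos" "card T = 3" using obtain_subset_with_card_n by metis
    then obtain v1 v2 v3 where v: "{v1, v2, v3} \<subseteq> Pos" "v1 \<noteq> v2" "v1 \<noteq> v3" "v2 \<noteq> v3" by (auto simp: card_3_iff)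
    obtain r :: "'a \<Rightarrow> real" where r: "\<And>v. 0 < r v" "inj_on r V" "r v1 = 1" "r v2 = 2" "r v3 = 3"
      "\<And>v. v \<in> V \<Longrightarrow> v \<notin> {v1, v2, v3} \<Longrightarrow> 3 < r v"
      by (rule exists_ranking[OF v(2-4)]) blast
    note w = circuit_direction[OF card rel nz r(1,2)]
    let ?B = "V - {v3}"
    have B: "?B \<in> optimal_bases V \<gamma>" unfolding opt using v by auto
    have "{b\<in>?B. representation ?B 0 b = 0 \<and> representation ?B (?w r) b < 0} = {b\<in>?B. 0 < \<gamma> b \<and> r b < r v3}"
      using w(3)[of v3] v(1) by (auto simp: Pos_def real_vector.representation_zero)
    also have "\<dots> = {v1, v2}"
    proof -
      have "r b < 3 \<longleftrightarrow> b \<in> {v1, v2}" if "b \<in> V" for b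
        using r(6)[OF that] r(3-5) by (cases "b \<in> {v1, v2, v3}") auto
      then show ?thesis using v r(5) by (auto simp: Pos_def)
    qed
    finally have "ht (lift_box ?B (?w r) 0) = 2" using ht_lift_box[OF optimal_lattice_basis[OF B], of "?w r" 0] v by (simp add: ht_simps)
    then have "of_bool (ht (lift_box ?B (?w r) 0) = real 2) = (1::nat)" by simp
    moreover have "of_bool (ht (lift_box ?B (?w r) 0) = real 2) \<le> hcount (half_open_box ?B (?w r)) 2"
      unfolding hcount_half_open_box_bool[OF w(2) B]
      by (rule member_le_sum[of 0]) (use zero_closed_box finite_closed_box optimal_lattice_basis[OF B] in auto)
    ultimately have "1 \<le> hcount (half_open_box ?B (?w r)) 2" by simp
    also have "\<dots> \<le> box_count \<gamma> (?w r) 2" unfolding box_count_def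
      by (rule member_le_sum[OF B]) (use finite_optimal_bases[OF finite_V] in auto)
    finally have "j = 2" unfolding bc[OF cost(1) w(1,2)] using jk by (auto simp: of_bool_def split: if_splits)
    moreover have "card Pos + card {v\<in>V. 0 < - \<gamma> v} \<le> card V"
      using card_mono[OF finite_V, of "Pos \<union> {v\<in>V. 0 < - \<gamma> v}"] card_Un_disjoint[of Pos "{v\<in>V. 0 < - \<gamma> v}"] Pos finite_V
      by (force simp: Pos_def)
    ultimately show ?thesis using card \<open>3 \<le> card Pos\<close> q by auto
  next
    case True
    then obtain v1 v2 where v: "Pos = {v1, v2}" "v1 \<noteq> v2" by (auto simp: card_2_iff)
    \<comment> \<open>With \<open>x\<close> ranked below \<open>y\<close>, the simplex without \<open>x\<close> is closed and the one without \<open>y\<close> lacks the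
      facet opposite to \<open>x\<close>. The roles of \<open>x\<close> and \<open>y\<close> may be exchanged, which gives two descriptions of
      the same exponents.\<close>
    have flip: "(\<Sum>g\<in>closed_box (V - {x}). of_bool (ht g = real n)) +
        (\<Sum>g\<in>closed_box (V - {y}). of_bool (ht g + of_bool (representation (V - {y}) g x = 0) = real n))
        = (of_bool (n = 0) + of_bool (n = 1) + of_bool (n = j) + of_bool (n = k) :: nat)"
      if xy: "Pos = {x, y}" "x \<noteq> y" for x y n
    proof -
      have "\<exists>z. z \<noteq> x \<and> z \<noteq> y"
      proof (rule ccontr)
        assume "\<not> ?thesis"
        then have "V \<subseteq> {x, y}" by auto
        then have "card V \<le> 2" using card_mono[of "{x,y}" V] xy(2) by simp
        moreover have "{v\<in>V. 0 < - \<gamma> v} \<inter> Pos = {}" by (auto simp: Pos_def)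
        then have "{v\<in>V. 0 < - \<gamma> v} = {}" using \<open>V \<subseteq> {x, y}\<close> xy(1) by blast
        then have "card {v\<in>V. 0 < - \<gamma> v} = 0" by (simp only: card.empty)
        then show False using q by simp
      qed
      then obtain z where z: "z \<noteq> x" "z \<noteq> y" by blast
      obtain r :: "'a \<Rightarrow> real" where r: "\<And>v. 0 < r v" "inj_on r V" "r x = 1" "r y = 2" "r z = 3"
        "\<And>v. v \<in> V \<Longrightarrow> v \<notin> {x, y, z} \<Longrightarrow> 3 < r v"
        by (rule exists_ranking[of x y z]) (use xy z in blast)+
      note w = circuit_direction[OF card rel nz r(1,2)]
      have pos_iff: "0 < \<gamma> b \<longleftrightarrow> b = x \<or> b = y" if "b \<in> V" for b using xy(1) that by (auto simp: Pos_def)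
      have xV: "x \<in> V" "y \<in> V" "0 < \<gamma> x" "0 < \<gamma> y" using xy(1) by (auto simp: Pos_def)
      have opt': "V - {x} \<in> optimal_bases V \<gamma>" "V - {y} \<in> optimal_bases V \<gamma>" unfolding opt xy(1) by auto
      have "lift_box (V - {x}) (?w r) g = g" for g
      proof (rule lift_box_closed[OF lB])
        fix b assume b: "b \<in> V - {x}"
        have "\<not> representation (V - {x}) (?w r) b < 0" using w(3)[OF xV(1,3) b] pos_iff[of b] b r by auto
        moreover have "representation (V - {x}) (?w r) b \<noteq> 0" using generic_optimal[OF w(2) opt'(1) b] .
        ultimately show "0 < representation (V - {x}) (?w r) b" by simp
      qed (use xy in auto)
      moreover have "ht (lift_box (V - {y}) (?w r) g) = ht g + of_bool (representation (V - {y}) g x = 0)" for g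
      proof -
        have "representation (V - {y}) (?w r) b < 0 \<longleftrightarrow> b = x" if b: "b \<in> V - {y}" for b
          using w(3)[OF xV(2,4) b] pos_iff[of b] b r by auto
        then have "{b\<in>V - {y}. representation (V - {y}) g b = 0 \<and> representation (V - {y}) (?w r) b < 0}
            = (if representation (V - {y}) g x = 0 then {x} else {})" using xV xy(2) by auto
        then show ?thesis unfolding ht_lift_box[OF optimal_lattice_basis[OF opt'(2)]] by simp
      qed
      moreover have "box_count \<gamma> (?w r) n = hcount (half_open_box (V - {x}) (?w r)) n + hcount (half_open_box (V - {y}) (?w r)) n"
        unfolding box_count_def opt using sum.reindex[OF injc, of "\<lambda>B. hcount (half_open_box B (?w r)) n"] xy by simp
      ultimately show ?thesis
        unfolding bc[OF cost(1) w(1,2)] hcount_half_open_box_bool[OF w(2) opt'(1)] hcount_half_open_box_bool[OF w(2) opt'(2)]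
        by simp
    qed
    obtain w where w: "w \<in> conic_hull V" "generic V w" by (rule generic_direction_exists[OF finite_V])
    have "card (closed_box (V - {v1})) + card (closed_box (V - {v2})) = (\<Sum>n\<le>DIM('a). box_count \<gamma> w n)"
      unfolding sum_box_count[OF w(2)] opt using sum.reindex[OF injc, of "\<lambda>B. card (closed_box B)"] v by simp
    also have "\<dots> = 4" unfolding bc[OF cost(1) w] using jk by (simp add: sum.distrib of_bool_def)
    finally have four: "card (closed_box (V - {v1})) + card (closed_box (V - {v2})) = 4" .
    have ge1: "1 \<le> card (closed_box (V - {x}))" if "x \<in> Pos" for x
      using zero_closed_box[OF lB[OF that]] finite_closed_box[OF lB[OF that]] by (metis One_nat_def Suc_leI card_gt_0_iff empty_iff)
    have three: "j + k \<le> DIM('a)" if xy: "Pos = {x, y}" "x \<noteq> y" and c: "card (closed_box (V - {x})) = 3" "card (closed_box (V - {y})) = 1" for x y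
    proof -
      have lx: "lattice_basis (V - {x})" "lattice_basis (V - {y})" using lB xy by auto
      obtain g h where gh: "closed_box (V - {x}) = {0, g, h}" "g \<noteq> 0" "h \<noteq> 0" "g \<noteq> h" "ht g + ht h \<le> DIM('a)"
        by (rule order_three_box[OF lx(1) c(1)])
      have y0: "closed_box (V - {y}) = {0}" using c(2) zero_closed_box[OF lx(2)] by (auto simp: card_1_singleton_iff)
      obtain hg where hg: "ht g = real hg" by (rule closed_box_height_nat[OF lx(1), of g]) (use gh in auto)
      obtain hh where hh: "ht h = real hh" by (rule closed_box_height_nat[OF lx(1), of h]) (use gh in auto)
      have s3: "(\<Sum>v\<in>{0, g, h}. f v) = f 0 + (f g + f h)" for f :: "'a \<Rightarrow> nat" using gh(2-4) by simp
      have "of_bool (n = hg) + of_bool (n = hh) = (of_bool (n = j) + of_bool (n = k) :: nat)" for n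
        using flip[OF xy, of n] unfolding gh(1) y0 s3
        by (simp add: hg hh ht_simps real_vector.representation_zero eq_commute[of _ n] eq_commute[of 1 "real n"])
      from two_exponents[OF this] show ?thesis using gh(5) hg hh by auto
    qed
    consider "card (closed_box (V - {v1})) = 3" "card (closed_box (V - {v2})) = 1"
      | "card (closed_box (V - {v2})) = 3" "card (closed_box (V - {v1})) = 1"
      | "card (closed_box (V - {v1})) = 2" "card (closed_box (V - {v2})) = 2"
      using four ge1[of v1] ge1[of v2] v by fastforce
    then show ?thesis
    proof cases
      case 1
      then have "j + k \<le> DIM('a)" using three v by blast
      then show ?thesis using jk by auto
    next
      case 2
      moreover have "Pos = {v2, v1}" using v by auto
      ultimately have "j + k \<le> DIM('a)" using three v(2) by blast
      then show ?thesis using jk by auto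
    next
      case 3
      have lx: "lattice_basis (V - {v1})" "lattice_basis (V - {v2})" using lB v by auto
      obtain g where g: "closed_box (V - {v1}) = {0, g}" "g \<noteq> 0" "2 * ht g = real (card {b\<in>V - {v1}. representation (V - {v1}) g b \<noteq> 0})"
        by (rule order_two_box[OF lx(1) 3(1)])
      obtain h where h: "closed_box (V - {v2}) = {0, h}" "h \<noteq> 0" "2 * ht h = real (card {b\<in>V - {v2}. representation (V - {v2}) h b \<noteq> 0})"
        by (rule order_two_box[OF lx(2) 3(2)])
      obtain m where m: "ht g = real m" by (rule closed_box_height_nat[OF lx(1), of g]) (use g in auto)
      obtain l where l: "ht h = real l" by (rule closed_box_height_nat[OF lx(2), of h]) (use h in auto)
      define \<epsilon> \<epsilon>' :: nat where "\<epsilon> = of_bool (representation (V - {v2}) h v1 = 0)" "\<epsilon>' = of_bool (representation (V - {v1}) g v2 = 0)"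
      have e1: "real l + of_bool (representation (V - {v2}) h v1 = 0) = real (l + \<epsilon>)" by (simp add: \<epsilon>_\<epsilon>'_def)
      have e2: "real m + of_bool (representation (V - {v1}) g v2 = 0) = real (m + \<epsilon>')" by (simp add: \<epsilon>_\<epsilon>'_def)
      have s2: "(\<Sum>v\<in>{0, g}. f v) = f 0 + f g" "(\<Sum>v\<in>{0, h}. f v) = f 0 + f h" for f :: "'a \<Rightarrow> nat"
        using g(2) h(2) by simp_all
      have "of_bool (n = m) + of_bool (n = l + \<epsilon>) = (of_bool (n = j) + of_bool (n = k) :: nat)" for n
      proof -
        show ?thesis using flip[OF v, of n] unfolding g(1) h(1) s2 e1 m l
          by (simp add: ht_simps real_vector.representation_zero eq_commute[of _ n] eq_commute[of 1 "real n"] del: of_nat_add)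
      qed
      from two_exponents[OF this] have 1: "(m = j \<and> l + \<epsilon> = k) \<or> (m = k \<and> l + \<epsilon> = j)" .
      have "of_bool (n = l) + of_bool (n = m + \<epsilon>') = (of_bool (n = j) + of_bool (n = k) :: nat)" for n
      proof -
        have v': "Pos = {v2, v1}" "v2 \<noteq> v1" using v by auto
        show ?thesis using flip[OF v', of n] unfolding g(1) h(1) s2 e2 m l
          by (simp add: ht_simps real_vector.representation_zero eq_commute[of _ n] eq_commute[of 1 "real n"] del: of_nat_add)
      qed
      from two_exponents[OF this] have 2: "(l = j \<and> m + \<epsilon>' = k) \<or> (l = k \<and> m + \<epsilon>' = j)" .
      have half0: "2 * M \<le> DIM('a)" if B: "lattice_basis B" and M: "2 * real M = real (card {b\<in>B. Q b})" for B M Q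
      proof -
        have "card {b\<in>B. Q b} \<le> DIM('a)"
          using card_mono[of B "{b\<in>B. Q b}"] lattice_basisD(4,5)[OF B] by auto
        then show ?thesis using M by linarith
      qed
      have half: "2 * m \<le> DIM('a)" "2 * l \<le> DIM('a)"
        using half0[OF lx(1) g(3)[unfolded m]] half0[OF lx(2) h(3)[unfolded l]] .
      have "2 * j < DIM('a)" if kj: "k = j + 1"
      proof (rule ccontr)
        assume "\<not> ?thesis"
        then have "DIM('a) \<le> 2 * j" by simp
        then have j: "2 * j = DIM('a)" "l = j" "m = j" using 1 2 half kj by (elim disjE conjE; linarith)+
        then have "card {b\<in>V - {v2}. representation (V - {v2}) h b \<noteq> 0} = card (V - {v2})"
          using h(3) unfolding l lattice_basisD(5)[OF lx(2)] by linarith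
        then have "{b\<in>V - {v2}. representation (V - {v2}) h b \<noteq> 0} = V - {v2}"
          by (intro card_subset_eq) (use finite_V in auto)
        moreover have "v1 \<in> V - {v2}" using v Pos by auto
        ultimately have "representation (V - {v2}) h v1 \<noteq> 0" by blast
        then show False using 1 j kj by (simp add: \<epsilon>_\<epsilon>'_def)
      qed
      moreover have "2 * j \<le> DIM('a)" using 1 half jk(2) by (elim disjE conjE; linarith)
      ultimately show ?thesis by blast
    qed
  qed
  then show "2 * j \<le> DIM('a)" and "k = j + 1 \<Longrightarrow> 3 \<le> j \<Longrightarrow> 2 * j < DIM('a)" by auto
qed

end

context lattice_cone
begin

section \<open>Necessity for polytopes\<close>

lemma cone_level_zero:
  assumes "x \<in> conic_hull V" "ht x = 0" shows "x = 0"
proof -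
  obtain a where a: "\<forall>v\<in>V. 0 \<le> a v" "x = (\<Sum>v\<in>V. a v *\<^sub>R v)" using assms(1) by (auto simp: conic_hull_def)
  have "(\<Sum>v\<in>V. a v) = 0" using assms(2) unfolding a(2) by (simp add: ht_simps V_ht)
  then have "\<forall>v\<in>V. a v = 0" using a(1) finite_V by (simp add: sum_nonneg_eq_0_iff)
  then show ?thesis unfolding a(2) by simp
qed

lemma zero_in_conic_hull: "0 \<in> conic_hull V"
  using conic_hullI[of V "\<lambda>_. 0"] by simp

lemma hseries_cone_box_count:
  assumes c: "generic_cost V c" and w: "w \<in> conic_hull V" "generic V w"
  shows "(1 - fps_X) ^ DIM('a) * hseries (L \<inter> conic_hull V) = Abs_fps (\<lambda>n. int (box_count c w n))"
  using hseries_pushed_cone[OF c w(2)] pushes_into_conic_hull[OF finite_V V_span linear_ht V_ht c w(2,1)] by simp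

lemma hcount_level_one:
  assumes c: "generic_cost V c" and w: "w \<in> conic_hull V" "generic V w"
  shows "hcount (L \<inter> conic_hull V) 1 = DIM('a) + box_count c w 1"
proof -
  have "{x \<in> L \<inter> conic_hull V. ht x = real 0} = {0}"
    using cone_level_zero zero_in_conic_hull lattice_zero by (auto simp: ht_simps)
  then have h0: "hcount (L \<inter> conic_hull V) 0 = 1" unfolding hcount_def by simp
  have "int (box_count c w 1) = fps_nth ((1 - fps_X) ^ DIM('a) * hseries (L \<inter> conic_hull V)) 1"
    unfolding hseries_cone_box_count[OF assms] by simp
  also have "\<dots> = int (hcount (L \<inter> conic_hull V) 1) - int (DIM('a))"
    using nth_one_minus_X_power[of "DIM('a)"] h0 by (simp add: fps_mult_nth hseries_def)
  finally show ?thesis by simp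
qed

text \<open>Here \<open>DIM('a)\<close> is \<open>d + 1\<close>. A polytope that is not a simplex has more than \<open>d + 1\<close> lattice points, so
  \<open>i1 = 1\<close>, and \<open>codegree_bound\<close> yields \<open>i3 \<le> i2 + 1\<close>. For \<open>i2 = 1\<close> all conditions follow; for
  \<open>i2 \<ge> 2\<close> there are exactly \<open>d + 2\<close> vertices.\<close>

theorem exponents_necessary:
  assumes vertex: "\<And>v. v \<in> V \<Longrightarrow> v \<notin> conic_hull (V - {v})"
    and i: "1 \<le> i1" "i1 \<le> i2" "i2 \<le> i3" "i3 < DIM('a)"
    and bc: "\<And>c w n. generic_cost V c \<Longrightarrow> w \<in> conic_hull V \<Longrightarrow> generic V w \<Longrightarrow>
      box_count c w n = of_bool (n = 0) + of_bool (n = i1) + of_bool (n = i2) + of_bool (n = i3)"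
  shows "i3 \<le> i1 + i2 \<and> i1 + i3 \<le> DIM('a) \<and> 2 * i2 \<le> DIM('a) \<and> (2 * i2 \<le> i1 + i3 \<or> i2 + i3 \<le> DIM('a))"
proof (cases "card V \<le> DIM('a)")
  case True
  then have "independent V" by (intro card_le_dim_spanning[of _ UNIV]) (auto simp: V_span finite_V)
  then have "is_basis V" by (simp add: is_basis_def V_span)
  then show ?thesis using simplex_exponents[OF _ i bc] by blast
next
  case False
  obtain c where c: "generic_cost V c" by (rule generic_cost_exists[OF finite_V])
  obtain w where w: "w \<in> conic_hull V" "generic V w" by (rule generic_direction_exists[OF finite_V])
  note bc' = bc[OF c w]
  note one = hcount_level_one[OF c w]
  have V_level: "V \<subseteq> {x \<in> L \<inter> conic_hull V. ht x = real 1}"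
  proof
    fix v assume v: "v \<in> V"
    have "(\<Sum>u\<in>V. (if u = v then 1 else 0) *\<^sub>R u) = (\<Sum>u\<in>V. if u = v then u else 0)" by (rule sum.cong) auto
    also have "\<dots> = v" using v finite_V by simp
    finally have "v \<in> conic_hull V" using conic_hullI[of V "\<lambda>u. if u = v then 1 else 0"] by auto
    then show "v \<in> {x \<in> L \<inter> conic_hull V. ht x = real 1}" using v V_lattice V_ht by auto
  qed
  have "finite {x \<in> L \<inter> conic_hull V. ht x = real 1}" using one unfolding hcount_def by (intro card_ge_0_finite) simp
  then have le: "card V \<le> DIM('a) + box_count c w 1" using card_mono[OF _ V_level] one unfolding hcount_def by simp
  then have "box_count c w 1 \<noteq> 0" using False by simp
  then have i1: "i1 = 1" using i unfolding bc' by (auto simp: of_bool_def split: if_splits)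
  have i3: "i3 \<le> i2 + 1"
  proof (rule ccontr)
    assume "\<not> ?thesis"
    then have "hcount (L \<inter> conic_hull V) 1 \<le> DIM('a)"
      using i i1 by (intro codegree_bound[OF c w, of i3]) (auto simp: bc')
    then show False using one \<open>box_count c w 1 \<noteq> 0\<close> by simp
  qed
  show ?thesis
  proof (cases "i2 = 1")
    case True
    then show ?thesis using i i1 i3 by auto
  next
    case i2: False
    then have "box_count c w 1 = 1" using i i1 unfolding bc' by simp
    then have card: "card V = Suc DIM('a)" using le False by simp
    have "2 \<le> i2" using i i2 by simp
    note circuit = circuit_exponents[OF card vertex this i(3,4), unfolded i1[symmetric], OF _ bc]
    show ?thesis using circuit i i1 i3 i2 by fastforce
  qed
qed

end

section \<open>Ehrhart series of integral polytopes\<close>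

lemma finite_integer_points_bounded:
  fixes S :: "((real ^ 'n) \<times> real) set"
  assumes "bounded S"
  shows "finite (S \<inter> integer_points \<times> \<int>)"
proof -
  obtain M where M: "\<And>x. x \<in> S \<Longrightarrow> norm x \<le> M" using assms unfolding bounded_iff by blast
  define F :: "real set" where "F = {z\<in>\<int>. \<bar>z\<bar> \<le> M}"
  have F: "finite F" unfolding F_def by (rule finite_abs_int_segment)
  have "S \<inter> integer_points \<times> \<int> \<subseteq> (vec_lambda ` (UNIV \<rightarrow>\<^sub>E F)) \<times> F"
  proof
    fix p assume "p \<in> S \<inter> integer_points \<times> \<int>"
    then obtain x t where p: "p = (x, t)" "(x, t) \<in> S" "x \<in> integer_points" "t \<in> \<int>" by auto
    have "norm x \<le> M" "norm t \<le> M" using M[OF p(2)] norm_fst_le[of x t] norm_snd_le[of t x] by auto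
    then have "\<forall>i. x $ i \<in> F" "t \<in> F" using p(3,4) component_le_norm_cart[of x]
      by (auto simp: F_def integer_points_def intro: order_trans)
    then have "vec_nth x \<in> UNIV \<rightarrow>\<^sub>E F" by auto
    then have "vec_lambda (vec_nth x) \<in> vec_lambda ` (UNIV \<rightarrow>\<^sub>E F)" by (rule imageI)
    then show "p \<in> (vec_lambda ` (UNIV \<rightarrow>\<^sub>E F)) \<times> F" using p(1) \<open>t \<in> F\<close> by simp
  qed
  then show ?thesis by (rule finite_subset) (intro finite_cartesian_product finite_imageI finite_PiE F; simp)
qed

interpretation int_lattice: graded_lattice "integer_points \<times> \<int> :: ((real ^ 'n) \<times> real) set" snd
proof (rule graded_lattice.intro)
  show "linear (snd :: (real ^ 'n) \<times> real \<Rightarrow> real)" by (rule linear_snd)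
qed (auto simp: integer_points_def finite_integer_points_bounded[unfolded integer_points_def] zero_prod_def)

definition homogenize :: "(real ^ 'n) set \<Rightarrow> ((real ^ 'n) \<times> real) set" where
  "homogenize V = (\<lambda>v. (v, 1)) ` V"

lemma mem_conic_hull_homogenize:
  fixes V :: "(real ^ 'n) set"
  assumes "finite V"
  shows "(x, t) \<in> conic_hull (homogenize V) \<longleftrightarrow>
    (\<exists>a. (\<forall>v\<in>V. 0 \<le> a v) \<and> x = (\<Sum>v\<in>V. a v *\<^sub>R v) \<and> t = (\<Sum>v\<in>V. a v))"
proof -
  have sum: "(\<Sum>p\<in>homogenize V. b p *\<^sub>R p) = (\<Sum>v\<in>V. b (v, 1) *\<^sub>R v, \<Sum>v\<in>V. b (v, 1))" for b :: "(real ^ 'n) \<times> real \<Rightarrow> real"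
  proof -
    have "(\<Sum>p\<in>homogenize V. b p *\<^sub>R p) = (\<Sum>v\<in>V. b (v, 1) *\<^sub>R (v, 1))"
      unfolding homogenize_def by (subst sum.reindex) (auto simp: inj_on_def)
    then show ?thesis by (simp add: prod_eq_iff fst_sum snd_sum)
  qed
  show ?thesis
  proof
    assume "(x, t) \<in> conic_hull (homogenize V)"
    then obtain b where "\<forall>p\<in>homogenize V. 0 \<le> b p" "(x, t) = (\<Sum>p\<in>homogenize V. b p *\<^sub>R p)"
      unfolding conic_hull_def by auto
    then show "\<exists>a. (\<forall>v\<in>V. 0 \<le> a v) \<and> x = (\<Sum>v\<in>V. a v *\<^sub>R v) \<and> t = (\<Sum>v\<in>V. a v)"
      unfolding sum by (intro exI[of _ "\<lambda>v. b (v, 1)"]) (auto simp: homogenize_def)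
  next
    assume "\<exists>a. (\<forall>v\<in>V. 0 \<le> a v) \<and> x = (\<Sum>v\<in>V. a v *\<^sub>R v) \<and> t = (\<Sum>v\<in>V. a v)"
    then obtain a where a: "\<forall>v\<in>V. 0 \<le> a v" "x = (\<Sum>v\<in>V. a v *\<^sub>R v)" "t = (\<Sum>v\<in>V. a v)" by auto
    have "(\<Sum>p\<in>homogenize V. a (fst p) *\<^sub>R p) \<in> conic_hull (homogenize V)"
      by (rule conic_hullI) (use a in \<open>auto simp: homogenize_def\<close>)
    then show "(x, t) \<in> conic_hull (homogenize V)" unfolding sum using a by simp
  qed
qed

lemma mem_dilated_hull:
  fixes V :: "(real ^ 'n) set"
  assumes V: "finite V" and t: "0 < t"
  shows "(x, t) \<in> conic_hull (homogenize V) \<longleftrightarrow> x \<in> (\<lambda>y. t *\<^sub>R y) ` (convex hull V)"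
proof
  assume "(x, t) \<in> conic_hull (homogenize V)"
  then obtain a where a: "\<forall>v\<in>V. 0 \<le> a v" "x = (\<Sum>v\<in>V. a v *\<^sub>R v)" "t = (\<Sum>v\<in>V. a v)"
    using mem_conic_hull_homogenize[OF V] by auto
  have "(\<Sum>v\<in>V. (a v / t) *\<^sub>R v) \<in> convex hull V"
    unfolding convex_hull_finite[OF V] mem_Collect_eq
    by (intro exI[of _ "\<lambda>v. a v / t"]) (use a t in \<open>auto simp: sum_divide_distrib[symmetric]\<close>)
  moreover have "x = t *\<^sub>R (\<Sum>v\<in>V. (a v / t) *\<^sub>R v)" using t by (simp add: a(2) scaleR_sum_right)
  ultimately show "x \<in> (\<lambda>y. t *\<^sub>R y) ` (convex hull V)" by blast
next
  assume "x \<in> (\<lambda>y. t *\<^sub>R y) ` (convex hull V)"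
  then obtain a where a: "\<forall>v\<in>V. 0 \<le> a v" "(\<Sum>v\<in>V. a v) = 1" "x = t *\<^sub>R (\<Sum>v\<in>V. a v *\<^sub>R v)"
    unfolding convex_hull_finite[OF V] by auto
  show "(x, t) \<in> conic_hull (homogenize V)" unfolding mem_conic_hull_homogenize[OF V]
    by (intro exI[of _ "\<lambda>v. t * a v"]) (use a t in \<open>auto simp: scaleR_sum_right sum_distrib_left[symmetric]\<close>)
qed

lemma span_homogenize:
  fixes V :: "(real ^ 'n) set"
  assumes V: "finite V" and full: "affine hull V = UNIV"
  shows "span (homogenize V) = UNIV"
proof -
  let ?S = "span (homogenize V)"
  have lev1: "(x, 1) \<in> ?S" for x
  proof -
    obtain u where u: "(\<Sum>v\<in>V. u v) = 1" "(\<Sum>v\<in>V. u v *\<^sub>R v) = x"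
    proof -
      have "x \<in> affine hull V" by (simp add: full)
      then show ?thesis using that unfolding affine_hull_finite[OF V] by auto
    qed
    have "(\<Sum>v\<in>V. u v *\<^sub>R (v, 1::real)) \<in> ?S"
      by (intro span_sum span_scale span_base) (auto simp: homogenize_def)
    also have "(\<Sum>v\<in>V. u v *\<^sub>R (v, 1::real)) = (x, 1)" using u by (simp add: prod_eq_iff fst_sum snd_sum)
    finally show ?thesis .
  qed
  have "(x, t) \<in> ?S" for x t
  proof -
    have "(x, t) = (x, 1) + (t - 1) *\<^sub>R (0, 1)" by simp
    then show ?thesis using lev1 by (metis span_add span_scale)
  qed
  then show ?thesis by auto
qed

lemma lattice_cone_homogenize:
  assumes "finite V" "V \<subseteq> integer_points" "affine hull V = (UNIV :: (real ^ 'n) set)"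
  shows "lattice_cone (integer_points \<times> \<int>) snd (homogenize V)"
  by unfold_locales (use assms span_homogenize in \<open>auto simp: homogenize_def\<close>)

lemma ehrhart_series_eq_hseries:
  fixes V :: "(real ^ 'n) set"
  assumes V: "finite V"
  shows "ehrhart_series (convex hull V) = int_lattice.hseries ((integer_points \<times> \<int>) \<inter> conic_hull (homogenize V))"
proof (rule fps_ext)
  fix n
  let ?C = "(integer_points \<times> \<int>) \<inter> conic_hull (homogenize V)"
  let ?l = "{p \<in> ?C. snd p = real n}"
  show "fps_nth (ehrhart_series (convex hull V)) n = fps_nth (int_lattice.hseries ?C) n"
  proof (cases "n = 0")
    case True
    have "?l = {0}"
    proof (intro equalityI subsetI)
      fix p assume "p \<in> ?l"
      then have "(fst p, 0) \<in> conic_hull (homogenize V)" "snd p = 0" using True by (auto simp: prod_eq_iff)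
      then obtain a where a: "\<forall>v\<in>V. 0 \<le> a v" "fst p = (\<Sum>v\<in>V. a v *\<^sub>R v)" "0 = (\<Sum>v\<in>V. a v)"
        using mem_conic_hull_homogenize[OF V] by auto
      then have "\<forall>v\<in>V. a v = 0" using sum_nonneg_eq_0_iff[OF V, of a] by auto
      then show "p \<in> {0}" using a(2) \<open>snd p = 0\<close> by (simp add: prod_eq_iff)
    next
      fix p :: "(real ^ 'n) \<times> real" assume "p \<in> {0}"
      moreover have "0 \<in> conic_hull (homogenize V)" using conic_hullI[of "homogenize V" "\<lambda>_. 0"] by simp
      ultimately show "p \<in> ?l" using True int_lattice.lattice_zero by auto
    qed
    then have "card ?l = 1" by simp
    then show ?thesis using True by (simp add: ehrhart_series_def int_lattice.hseries_def int_lattice.hcount_def)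
  next
    case False
    then have n: "0 < real n" by simp
    have "?l = (\<lambda>x. (x, real n)) ` (((\<lambda>x. real n *\<^sub>R x) ` (convex hull V)) \<inter> integer_points)"
      using mem_dilated_hull[OF V n] by (auto simp: image_iff)
    then have "card ?l = ehrhart_count (convex hull V) n"
      unfolding ehrhart_count_def by (simp add: card_image inj_on_def)
    then show ?thesis using False by (simp add: ehrhart_series_def int_lattice.hseries_def int_lattice.hcount_def)
  qed
qed

theorem delta_eq_box_count:
  fixes V :: "(real ^ 'n) set"
  assumes V: "finite V" "V \<subseteq> integer_points" and dim: "aff_dim V = CARD('n)"
    and c: "generic_cost (homogenize V) c" and w: "w \<in> conic_hull (homogenize V)" "generic (homogenize V) w"
  shows "delta (convex hull V) i = int (lattice_cone.box_count (integer_points \<times> \<int>) snd (homogenize V) c w i)"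
proof -
  have full: "affine hull V = UNIV" using dim aff_dim_eq_full[of V] by simp
  interpret lattice_cone "integer_points \<times> \<int>" snd "homogenize V"
    by (rule lattice_cone_homogenize[OF V full])
  have "nat (aff_dim (convex hull V)) + 1 = DIM((real ^ 'n) \<times> real)" using dim by (simp add: aff_dim_convex_hull)
  then show ?thesis unfolding delta_def ehrhart_series_eq_hseries[OF V(1)] using hseries_cone_box_count[OF c w] by simp
qed

text \<open>A vertex is not in the convex hull of the other vertices.\<close>

lemma extreme_point_not_in_conic_hull:
  assumes V: "finite V" and v: "v \<in> V" "v extreme_point_of (convex hull V)"
  shows "(v, 1) \<notin> conic_hull (homogenize V - {(v, 1)})"
proof
  assume "(v, 1) \<in> conic_hull (homogenize V - {(v, 1)})"
  moreover have "homogenize V - {(v, 1)} = homogenize (V - {v})" by (auto simp: homogenize_def)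
  ultimately have "v \<in> convex hull (V - {v})" using mem_dilated_hull[of "V - {v}" 1 v] V by simp
  then have "convex hull V = convex hull (V - {v})" using hull_redundant[of v convex "V - {v}"] v(1) by (simp add: insert_absorb)
  then show False using v(2) extreme_point_of_convex_hull[of v "V - {v}"] by simp
qed

section \<open>Simplices with a cyclic group of order four\<close>

lemma affine_independent_homogenize:
  fixes V :: "(real ^ 'n) set"
  assumes V: "finite V" and ind: "independent (homogenize V)"
  shows "\<not> affine_dependent V"
proof
  assume "affine_dependent V"
  then obtain U v where U: "sum U V = 0" "v \<in> V" "U v \<noteq> 0" "(\<Sum>v\<in>V. U v *\<^sub>R v) = 0"
    unfolding affine_dependent_explicit_finite[OF V] by auto
  have "(\<Sum>p\<in>homogenize V. U (fst p) *\<^sub>R p) = (\<Sum>v\<in>V. U v *\<^sub>R (v, 1))"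
    unfolding homogenize_def by (subst sum.reindex) (auto simp: inj_on_def)
  also have "\<dots> = 0" using U(1,4) by (simp add: prod_eq_iff fst_sum snd_sum)
  finally have "U (fst (v, 1::real)) = 0"
    using independentD[OF ind _ subset_refl, of "\<lambda>p. U (fst p)" "(v, 1)"] V U(2) by (auto simp: homogenize_def)
  then show False using U(3) by simp
qed

lemma sum_option: "(\<Sum>o'\<in>UNIV. F o') = F None + (\<Sum>i\<in>UNIV. F (Some i))" for F :: "'n::finite option \<Rightarrow> 'b::comm_monoid_add"
  unfolding UNIV_option_conv by (subst sum.insert) (auto simp: sum.reindex)

lemma frac_eqI: "x - y \<in> \<int> \<Longrightarrow> 0 \<le> x \<Longrightarrow> x < 1 \<Longrightarrow> x = frac (y::real)"
  by (metis frac_eq frac_eq_iff)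

text \<open>The vertices are \<open>0\<close>, the unit vectors \<open>e\<^sub>i\<close> for \<open>i \<noteq> s\<close>, and \<open>4 e\<^sub>s - \<Sum> f\<^sub>i e\<^sub>i\<close>, so \<open>e\<^sub>s\<close> generates the
  group of the simplex and its coordinates are congruent to \<open>f/4\<close>. The weight of the vertex \<open>0\<close> is
  determined modulo \<open>4\<close> by the others, because the height of a lattice point is an integer.\<close>

theorem cyclic_simplex_delta:
  fixes f :: "'n::finite option \<Rightarrow> nat" and s :: 'n
  assumes fs: "f (Some s) = 1" and div: "4 dvd (\<Sum>o'\<in>UNIV. f o')"
  defines "h \<equiv> \<lambda>m. \<Sum>o'\<in>UNIV. frac (real (f o') * real m / 4)"
  obtains V :: "(real ^ 'n) set" where "finite V" "V \<subseteq> integer_points" "\<not> affine_dependent V" "card V = CARD('n) + 1"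
    "\<And>n. delta (convex hull V) n = (\<Sum>m<4. of_bool (h m = real n))"
proof -
  \<comment> \<open>\<open>None\<close> indexes the vertex at the origin, \<open>Some s\<close> the exceptional vertex.\<close>
  define p :: "'n option \<Rightarrow> real ^ 'n" where
    "p o' = (case o' of None \<Rightarrow> 0 | Some i \<Rightarrow> if i = s then (\<chi> k. if k = s then 4 else - real (f (Some k))) else axis i 1)" for o'
  define q where "q o' = (p o', 1 :: real)" for o'
  \<comment> \<open>The coordinates with respect to the vertices at height one, solved for explicitly.\<close>
  define lam :: "(real ^ 'n) \<times> real \<Rightarrow> 'n option \<Rightarrow> real" where
    "lam z = (\<lambda>o'. let l = (\<lambda>i. if i = s then fst z $ s / 4 else fst z $ i + real (f (Some i)) * fst z $ s / 4)
       in case o' of Some i \<Rightarrow> l i | None \<Rightarrow> snd z - (\<Sum>i\<in>UNIV. l i))" for z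
  have lam_s: "lam z (Some s) = fst z $ s / 4"
    and lam_i: "i \<noteq> s \<Longrightarrow> lam z (Some i) = fst z $ i + real (f (Some i)) * fst z $ s / 4"
    and lam_None: "lam z None = snd z - (\<Sum>i\<in>UNIV. lam z (Some i))" for z i
    by (simp_all add: lam_def)
  have expand: "(\<Sum>o'\<in>UNIV. lam z o' *\<^sub>R q o') = z" for z
  proof -
    have "(\<Sum>i\<in>UNIV. lam z (Some i) * p (Some i) $ k) = fst z $ k" for k
    proof -
      have "(\<Sum>i\<in>UNIV. lam z (Some i) * p (Some i) $ k)
          = lam z (Some s) * p (Some s) $ k + (\<Sum>i\<in>UNIV - {s}. lam z (Some i) * p (Some i) $ k)"
        by (rule sum.remove) auto
      also have "(\<Sum>i\<in>UNIV - {s}. lam z (Some i) * p (Some i) $ k) = (\<Sum>i\<in>UNIV - {s}. if i = k then lam z (Some k) else 0)"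
        by (rule sum.cong) (auto simp: p_def axis_def)
      finally show ?thesis by (auto simp: p_def lam_s lam_i)
    qed
    then have "(\<Sum>i\<in>UNIV. lam z (Some i) *\<^sub>R p (Some i)) = fst z" by (simp add: vec_eq_iff)
    moreover have "p None = 0" by (simp add: p_def)
    ultimately have "fst (\<Sum>o'\<in>UNIV. lam z o' *\<^sub>R q o') = fst z" by (simp add: sum_option q_def fst_sum)
    moreover have "snd (\<Sum>o'\<in>UNIV. lam z o' *\<^sub>R q o') = snd z" by (simp add: sum_option q_def snd_sum lam_None)
    ultimately show ?thesis by (simp add: prod_eq_iff)
  qed
  define V where "V = range p"
  have V: "finite V" by (simp add: V_def)
  have Vint: "V \<subseteq> integer_points"
    by (auto simp: V_def p_def integer_points_def axis_def split: option.splits)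
  have hV: "homogenize V = range q" by (auto simp: homogenize_def V_def q_def)
  have sp: "span (range q) = UNIV"
  proof -
    have "z \<in> span (range q)" for z
      by (subst expand[symmetric]) (intro span_sum span_scale span_base; simp)
    then show ?thesis by auto
  qed
  have card_le: "card (range q) \<le> CARD('n) + 1" using card_image_le[of UNIV q] by simp
  then have ind: "independent (range q)"
    by (intro card_le_dim_spanning[of _ UNIV]) (auto simp: sp)
  have basis: "is_basis (range q)" using sp ind by (simp add: is_basis_def)
  have card_q: "card (range q) = CARD('n) + 1" using basis_card[OF basis] by simp
  then have "inj q" by (intro eq_card_imp_inj_on) auto
  have rep: "representation (range q) z (q o') = lam z o'" for z o'
  proof -
    have "(\<Sum>b\<in>range q. lam z (the_inv q b) *\<^sub>R b) = z"
      using expand[of z] by (simp add: sum.reindex[OF \<open>inj q\<close>] the_inv_f_f[OF \<open>inj q\<close>])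
    then show ?thesis using representation_unique[OF basis, of z "\<lambda>b. lam z (the_inv q b)" "q o'"] by (simp add: the_inv_f_f[OF \<open>inj q\<close>])
  qed
  have aind: "\<not> affine_dependent V" using affine_independent_homogenize[OF V] ind hV by simp
  have "inj_on (\<lambda>v. (v, 1 :: real)) V" by (auto simp: inj_on_def)
  then have cardV: "card V = CARD('n) + 1" using card_q unfolding hV[symmetric] homogenize_def by (simp add: card_image)
  have dimV: "aff_dim V = CARD('n)" using aind cardV by (simp add: affine_independent_iff_card)
  have full: "affine hull V = UNIV" using dimV aff_dim_eq_full[of V] by simp
  interpret lattice_cone "integer_points \<times> \<int>" snd "range q"
    using lattice_cone_homogenize[OF V Vint full] unfolding hV .
  let ?L = "integer_points \<times> \<int> :: ((real ^ 'n) \<times> real) set"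
  let ?S = "\<Sum>o'\<in>UNIV. f o'"
  have lam_cong: "lam z o' - real (f o') * fst z $ s / 4 \<in> \<int>" if z: "z \<in> ?L" for z o'
  proof -
    have zi: "fst z $ i \<in> \<int>" "snd z \<in> \<int>" for i using z by (auto simp: integer_points_def)
    have some: "lam z (Some i) - real (f (Some i)) * fst z $ s / 4 \<in> \<int>" for i
      using zi fs by (cases "i = s") (auto simp: lam_s lam_i)
    show ?thesis
    proof (cases o')
      case None
      obtain k where k: "?S = 4 * k" using div by (auto elim: dvdE)
      have "real (f None) + (\<Sum>i\<in>UNIV. real (f (Some i))) = 4 * real k"
        using arg_cong[OF k, of real] by (simp add: sum_option)
      then have fN: "real (f None) = 4 * real k - (\<Sum>i\<in>UNIV. real (f (Some i)))" by simp
      have "lam z None - real (f None) * fst z $ s / 4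
          = snd z - real k * fst z $ s - (\<Sum>i\<in>UNIV. lam z (Some i) - real (f (Some i)) * fst z $ s / 4)"
        unfolding lam_None fN sum_subtractf sum_distrib_right[symmetric] sum_divide_distrib[symmetric]
        by (simp add: field_simps)
      also have "\<dots> \<in> \<int>" by (intro Ints_diff Ints_sum Ints_mult some zi) auto
      finally show ?thesis using None by simp
    qed (use some in simp)
  qed
  have box: "z \<in> int_lattice.closed_box (range q) \<longleftrightarrow> z \<in> ?L \<and> (\<forall>o'. lam z o' = frac (real (f o') * fst z $ s / 4))" for z
  proof -
    have "z \<in> int_lattice.closed_box (range q) \<longleftrightarrow> z \<in> ?L \<and> (\<forall>o'. 0 \<le> lam z o' \<and> lam z o' < 1)"
      unfolding int_lattice.closed_box_def by (simp add: rep)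
    also have "\<dots> \<longleftrightarrow> z \<in> ?L \<and> (\<forall>o'. lam z o' = frac (real (f o') * fst z $ s / 4))"
      using frac_eqI[OF lam_cong] frac_ge_0 frac_lt_1 by metis
    finally show ?thesis .
  qed
  define g :: "nat \<Rightarrow> (real ^ 'n) \<times> real" where
    "g m = (\<Sum>o'\<in>UNIV. frac (real (f o') * real m / 4) *\<^sub>R q o')" for m
  have lam_g: "lam (g m) o' = frac (real (f o') * real m / 4)" for m o'
  proof -
    have "g m = (\<Sum>b\<in>range q. frac (real (f (the_inv q b)) * real m / 4) *\<^sub>R b)"
      by (simp add: g_def sum.reindex[OF \<open>inj q\<close>] the_inv_f_f[OF \<open>inj q\<close>])
    from representation_unique[OF basis this, of "q o'"] show ?thesis by (simp add: the_inv_f_f[OF \<open>inj q\<close>] rep)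
  qed
  have g_s: "fst (g m) $ s = real m" if "m < 4" for m
  proof -
    have "frac (real m / 4) = real m / 4" using that by (simp add: frac_eq)
    then show ?thesis using lam_g[of m "Some s"] by (simp add: lam_s fs)
  qed
  have snd_g: "snd (g m) = h m" for m by (simp add: g_def h_def snd_sum q_def)
  have g_L: "g m \<in> ?L" if m: "m < 4" for m
  proof -
    have "fst (g m) $ i \<in> \<int>" for i
    proof (cases "i = s")
      case False
      have "fst (g m) $ i = frac (real (f (Some i)) * real m / 4) - real (f (Some i)) * real m / 4"
        using lam_i[OF False, of "g m"] unfolding lam_g g_s[OF m] by simp
      then show ?thesis by (simp add: frac_def)
    qed (simp add: g_s[OF m])
    moreover have "h m \<in> \<int>"
    proof -
      obtain k where k: "?S = 4 * k" using div by (auto elim: dvdE)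
      have "(\<Sum>o'\<in>UNIV. real (f o') * real m / 4) = real ?S * real m / 4"
        by (simp add: sum_distrib_right sum_divide_distrib)
      also have "\<dots> = real (k * m)" unfolding k by simp
      finally have "h m = real (k * m) - (\<Sum>o'\<in>UNIV. of_int \<lfloor>real (f o') * real m / 4\<rfloor>)"
        by (simp add: h_def frac_def sum_subtractf)
      then show ?thesis by (simp add: Ints_diff Ints_sum)
    qed
    ultimately show ?thesis using snd_g[of m] by (simp add: mem_Times_iff integer_points_def)
  qed
  have box_eq: "int_lattice.closed_box (range q) = g ` {..<4}"
  proof (intro equalityI subsetI)
    fix z assume "z \<in> int_lattice.closed_box (range q)"
    then have z: "z \<in> ?L" "\<And>o'. lam z o' = frac (real (f o') * fst z $ s / 4)" using box by auto
    have "fst z $ s \<in> \<int>" using z(1) by (auto simp: integer_points_def)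
    moreover have "0 \<le> lam z (Some s)" "lam z (Some s) < 1" unfolding z(2) by (simp_all add: frac_lt_1)
    ultimately obtain k where k: "fst z $ s = of_int k" "0 \<le> k" "k < 4" unfolding lam_s by (auto elim!: Ints_cases)
    define m where "m = nat k"
    have m: "fst z $ s = real m" "m < 4" using k by (auto simp: m_def)
    have "lam z = lam (g m)" by (rule ext) (simp add: z(2) m lam_g)
    then have "z = g m" using expand by metis
    then show "z \<in> g ` {..<4}" using m by auto
  next
    fix z assume "z \<in> g ` {..<4}"
    then obtain m where m: "m < 4" "z = g m" by auto
    then show "z \<in> int_lattice.closed_box (range q)" unfolding box by (auto simp: g_L lam_g g_s)
  qed
  have inj_g: "inj_on g {..<4}" by (rule inj_onI) (metis g_s lessThan_iff of_nat_eq_iff)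
  obtain c w where cw: "generic_cost (range q) c" "w \<in> conic_hull (range q)" "generic (range q) w"
    and bc: "\<And>n. box_count c w n = (\<Sum>g\<in>int_lattice.closed_box (range q). of_bool (snd g = real n))"
    by (rule simplex_box_count[OF basis]) blast
  have "delta (convex hull V) n = int (box_count c w n)" for n
    using delta_eq_box_count[OF V Vint dimV, unfolded hV, OF cw] .
  then have "delta (convex hull V) n = (\<Sum>m<4. of_bool (h m = real n))" for n
    unfolding bc box_eq by (simp add: sum.reindex[OF inj_g] snd_g)
  then show ?thesis using that[OF V Vint aind cardV] by blast
qed

text \<open>The places are numbered from \<open>0\<close> to \<open>d\<close> such that \<open>None\<close>, which stands for the vertex at the origin,
  has number \<open>d\<close>; the weights are then assigned in blocks.\<close>

lemma weights_exist:
  assumes d: "CARD('n::finite) = d" and le: "A + B + C \<le> d + 1" "1 \<le> A" and d1: "1 \<le> d"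
  obtains f :: "'n::finite option \<Rightarrow> nat" and s where "f (Some s) = 1" "\<And>o'. f o' < 4"
    "card {o'. f o' = 1} = A" "card {o'. f o' = 2} = B" "card {o'. f o' = 3} = C"
proof -
  obtain e0 :: "'n \<Rightarrow> nat" where e0: "bij_betw e0 UNIV {0..<d}" using ex_bij_betw_finite_nat[of "UNIV :: 'n set"] d by auto
  define e where "e o' = (case o' of None \<Rightarrow> d | Some i \<Rightarrow> e0 i)" for o'
  have lt: "e0 i < d" for i using bij_betwE[OF e0] by auto
  have inj: "inj e"
  proof (rule injI)
    fix x y assume "e x = e y"
    then show "x = y" using lt bij_betw_imp_inj_on[OF e0] by (auto simp: e_def inj_on_def less_irrefl split: option.splits)
  qed
  have range: "range e = {..d}"
  proof (intro card_subset_eq)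
    show "range e \<subseteq> {..d}" using lt by (auto simp: e_def less_imp_le split: option.splits)
    show "card (range e) = card {..d}" using inj d by (simp add: card_image)
  qed simp
  have "0 \<in> {0..<d}" using d1 by simp
  then obtain s where s: "e0 s = 0" using e0 unfolding bij_betw_def by (metis imageE)
  define g where "g k = (if k < A then 1 else if k < A + B then 2 else if k < A + B + C then 3 else (0::nat))" for k :: nat
  have cnt: "card {o'. g (e o') = j} = card {k\<in>{..d}. g k = j}" for j
  proof -
    have "e ` {o'. g (e o') = j} = {k\<in>{..d}. g k = j}" using range by auto
    then show ?thesis using card_image[of e "{o'. g (e o') = j}"] inj by (metis inj_on_subset subset_UNIV)
  qed
  have sets: "{k\<in>{..d}. g k = 1} = {..<A}" "{k\<in>{..d}. g k = 2} = {A..<A+B}" "{k\<in>{..d}. g k = 3} = {A+B..<A+B+C}"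
    using le by (auto simp: g_def)
  show ?thesis
  proof (rule that[of "\<lambda>o'. g (e o')" s])
    show "g (e (Some s)) = 1" using s le by (simp add: e_def g_def)
    show "g (e o') < 4" for o' by (simp add: g_def)
  qed (simp_all only: cnt sets, simp_all)
qed

text \<open>The numbers \<open>A\<close>, \<open>B\<close>, \<open>C\<close> of weights \<open>1\<close>, \<open>2\<close>, \<open>3\<close> are the solution of
  \<open>A + 2 * B + 3 * C = 4 * x\<close>, \<open>A + C = 2 * y\<close> and \<open>3 * A + 2 * B + C = 4 * z\<close>. Their nonnegativity and the
  bound \<open>A + B + C \<le> d + 1\<close> are the last three inequalities among the hypotheses on the exponents, and
  \<open>A\<close> is positive, so that some weight is \<open>1\<close>.\<close>

theorem simplex_with_exponents:
  fixes x y z d :: nat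
  assumes d: "CARD('n::finite) = d" and le: "x \<le> z" "1 \<le> y" "z \<le> x + y" "2 * y \<le> x + z" "x + z \<le> d + 1"
  obtains V :: "(real ^ 'n) set" where "finite V" "V \<subseteq> integer_points" "\<not> affine_dependent V" "card V = d + 1"
    "\<And>n. delta (convex hull V) n = of_bool (n = 0) + of_bool (n = x) + of_bool (n = y) + of_bool (n = z)"
proof -
  define A B C where "A = y + z - x" "B = x + z - 2 * y" "C = x + y - z"
  note ABC = A_B_C_def
  have d1: "1 \<le> d" using zero_less_card_finite[where 'a = 'n] d by simp
  have abc: "A + B + C \<le> d + 1" "1 \<le> A" using le by (auto simp: ABC)
  obtain f :: "'n option \<Rightarrow> nat" and s where f: "f (Some s) = 1" "\<And>o'. f o' < 4"
    "card {o'. f o' = 1} = A" "card {o'. f o' = 2} = B" "card {o'. f o' = 3} = C"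
    using weights_exist[OF d abc d1] by blast
  have lt4: "{..<4::nat} = {0,1,2,3}" by auto
  have sums: "(\<Sum>o'\<in>UNIV. F (f o')) = real (card {o'. f o' = 0}) * F 0 + real A * F 1 + real B * F 2 + real C * F 3" for F :: "nat \<Rightarrow> real"
    using sum_by_values[of UNIV f 4 F] f unfolding lt4 by (simp add: add.assoc)
  have "real (\<Sum>o'\<in>UNIV. f o') = real (4 * x)" using sums[of real] le by (simp add: ABC of_nat_diff)
  then have "(\<Sum>o'\<in>UNIV. f o') = 4 * x" by (metis of_nat_eq_iff)
  then have div: "4 dvd (\<Sum>o'\<in>UNIV. f o')" by simp
  define h where "h m = (\<Sum>o'\<in>UNIV. frac (real (f o') * real m / 4))" for m
  have fr: "frac (1/4) = (1/4::real)" "frac (2/4) = (2/4::real)" "frac (3/4) = (3/4::real)"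
     "frac (6/4) = (2/4::real)" "frac (9/4) = (1/4::real)" "frac 1 = (0::real)" "frac (3/2) = (1/2::real)" "frac (1/2) = (1/2::real)"
    by (simp_all add: frac_def floor_eq_iff)
  have h: "h 0 = 0" "h 1 = x" "h 2 = y" "h 3 = z"
    unfolding h_def sums[of "\<lambda>j. frac (real j * real m / 4)" for m] using le by (simp_all add: fr ABC of_nat_diff field_simps)
  obtain V :: "(real ^ 'n) set" where V: "finite V" "V \<subseteq> integer_points" "\<not> affine_dependent V" "card V = CARD('n) + 1"
    "\<And>n. delta (convex hull V) n = (\<Sum>m<4. of_bool (h m = real n))"
    using cyclic_simplex_delta[OF f(1) div] unfolding h_def by blast
  have "delta (convex hull V) n = of_bool (n = 0) + of_bool (n = x) + of_bool (n = y) + of_bool (n = z)" for n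
    unfolding V(5) lt4 by (simp add: h eq_commute[of _ n] add.assoc del: One_nat_def)
  then show ?thesis using that V d by blast
qed

section \<open>Classification\<close>

lemma coeff_delta_poly:
  "coeff (delta_poly P) n = (if n \<le> nat (aff_dim P) then delta P n else 0)"
  unfolding delta_poly_def by (simp add: coeff_sum)

lemma coeff_four_monomials:
  "coeff (1 + monom 1 i1 + monom 1 i2 + monom 1 i3 :: int poly) n
    = of_bool (n = 0) + of_bool (n = i1) + of_bool (n = i2) + of_bool (n = i3)"
  by (auto simp: coeff_1)

theorem polytope_exponents_necessary:
  fixes P :: "(real ^ 'n) set"
  assumes d: "CARD('n) = d" and i: "1 \<le> i1" "i1 \<le> i2" "i2 \<le> i3" "i3 \<le> d"
    and P: "integral_polytope P" "aff_dim P = int d" "delta_poly P = 1 + monom 1 i1 + monom 1 i2 + monom 1 i3"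
  shows "i3 \<le> i1 + i2 \<and> i1 + i3 \<le> d + 1 \<and> 2 * i2 \<le> d + 1 \<and> (2 * i2 \<le> i1 + i3 \<or> i2 + i3 \<le> d + 1)"
proof -
  have poly: "polytope P" using P(1) by (simp add: integral_polytope_def)
  define V where "V = {v. v extreme_point_of P}"
  obtain S where S: "finite S" "P = convex hull S" using poly by (auto simp: polytope_def)
  then have V: "finite V" unfolding V_def using extreme_points_of_convex_hull finite_subset by metis
  have Vint: "V \<subseteq> integer_points" using P(1) by (auto simp: V_def integral_polytope_def)
  have PV: "P = convex hull V" unfolding V_def
    by (rule Krein_Milman_Minkowski) (use poly polytope_imp_compact polytope_imp_convex in auto)
  have dimV: "aff_dim V = CARD('n)" using P(2) d unfolding PV by (simp add: aff_dim_convex_hull)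
  have full: "affine hull V = UNIV" using dimV aff_dim_eq_full[of V] by simp
  interpret lattice_cone "integer_points \<times> \<int>" snd "homogenize V"
    by (rule lattice_cone_homogenize[OF V Vint full])
  have D: "DIM((real ^ 'n) \<times> real) = d + 1" using d by simp
  have extreme: "u extreme_point_of convex hull V" if "u \<in> V" for u
    using that unfolding PV[symmetric] by (simp add: V_def)
  have vertex: "v \<notin> conic_hull (homogenize V - {v})" if v: "v \<in> homogenize V" for v
  proof -
    obtain u where "u \<in> V" "v = (u, 1)" using v by (auto simp: homogenize_def)
    then show ?thesis using extreme_point_not_in_conic_hull[OF V] extreme by simp
  qed
  have bc: "box_count c w n = of_bool (n = 0) + of_bool (n = i1) + of_bool (n = i2) + of_bool (n = i3)"
    if cw: "generic_cost (homogenize V) c" "w \<in> conic_hull (homogenize V)" "generic (homogenize V) w" for c w n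
  proof (cases "n \<le> d")
    case True
    have "int (box_count c w n) = delta P n" using delta_eq_box_count[OF V Vint dimV cw] PV by simp
    also have "\<dots> = coeff (delta_poly P) n" using True P(2) by (simp add: coeff_delta_poly)
    also have "\<dots> = of_bool (n = 0) + of_bool (n = i1) + of_bool (n = i2) + of_bool (n = i3)"
      unfolding P(3) coeff_four_monomials ..
    finally have "int (box_count c w n) = int (of_bool (n = 0) + of_bool (n = i1) + of_bool (n = i2) + of_bool (n = i3))"
      by (simp only: of_nat_add of_nat_of_bool)
    then show ?thesis by (simp only: of_nat_eq_iff)
  next
    case False
    then show ?thesis using box_count_beyond[OF cw(2,3), of n c] i D by simp
  qed
  show ?thesis using exponents_necessary[OF vertex i(1-3) _ bc] i(4) unfolding D by simp
qed

theorem theorem5p1: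
  fixes d i1 i2 i3 :: nat
  assumes "CARD('n::finite) = d" and "d \<ge> 1"
    and "1 \<le> i1" and "i1 \<le> i2" and "i2 \<le> i3" and "i3 \<le> d"
  shows "((\<exists>P :: (real ^ 'n) set. integral_polytope P \<and> aff_dim P = int d \<and>
             delta_poly P = 1 + monom 1 i1 + monom 1 i2 + monom 1 i3)
           \<longleftrightarrow>
           i3 \<le> i1 + i2 \<and> i1 + i3 \<le> d + 1 \<and> i2 \<le> (d + 1) div 2 \<and>
           (2 * i2 \<le> i1 + i3 \<or> i2 + i3 \<le> d + 1))
       \<and>
         (i3 \<le> i1 + i2 \<and> i1 + i3 \<le> d + 1 \<and> i2 \<le> (d + 1) div 2 \<and>
           (2 * i2 \<le> i1 + i3 \<or> i2 + i3 \<le> d + 1)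
           \<longrightarrow>
           (\<exists>P :: (real ^ 'n) set. integral_polytope P \<and> int d simplex P \<and> aff_dim P = int d \<and>
             delta_poly P = 1 + monom 1 i1 + monom 1 i2 + monom 1 i3))"
    (is "((\<exists>P. ?poly P) \<longleftrightarrow> ?cond) \<and> (_ \<longrightarrow> (\<exists>P. ?simp P))")
proof -
  have nec: ?cond if "?poly P" for P
    using polytope_exponents_necessary[OF assms(1,3-6), of P] that by auto
  have suf: "\<exists>P. ?simp P" if c: ?cond
  proof -
    obtain x y z where xyz: "x \<le> z" "1 \<le> y" "z \<le> x + y" "2 * y \<le> x + z" "x + z \<le> d + 1"
      and perm: "(x, y, z) = (i1, i2, i3) \<or> (x, y, z) = (i2, i1, i3)"
    proof (cases "2 * i2 \<le> i1 + i3")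
      case True
      then show ?thesis using that[of i1 i3 i2] c assms by auto
    next
      case False
      then show ?thesis using that[of i2 i3 i1] c assms by auto
    qed
    obtain V :: "(real ^ 'n) set" where V: "finite V" "V \<subseteq> integer_points" "\<not> affine_dependent V" "card V = d + 1"
      and delta: "\<And>n. delta (convex hull V) n = of_bool (n = 0) + of_bool (n = x) + of_bool (n = y) + of_bool (n = z)"
      using simplex_with_exponents[OF assms(1) xyz] by blast
    let ?P = "convex hull V"
    have simp: "int d simplex ?P" by (rule simplex_convex_hull) (use V in auto)
    have dim: "aff_dim ?P = int d" by (rule aff_dim_simplex[OF simp])
    have "integral_polytope ?P" unfolding integral_polytope_def
      using simplex_imp_polytope[OF simp] extreme_point_of_convex_hull[of _ V] V(2) by auto
    moreover have "delta_poly ?P = 1 + monom 1 i1 + monom 1 i2 + monom 1 i3"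
    proof (rule poly_eqI)
      fix n
      show "coeff (delta_poly ?P) n = coeff (1 + monom 1 i1 + monom 1 i2 + monom 1 i3) n"
      proof (cases "n \<le> d")
        case True
        have "delta ?P n = of_bool (n = 0) + of_bool (n = i1) + of_bool (n = i2) + of_bool (n = i3)"
          unfolding delta using perm by (elim disjE) simp_all
        then show ?thesis using True unfolding coeff_delta_poly coeff_four_monomials dim by simp
      next
        case False
        then show ?thesis using assms unfolding coeff_delta_poly coeff_four_monomials dim by simp
      qed
    qed
    ultimately show ?thesis using simp dim by blast
  qed
  show ?thesis using nec suf by blast
qed

end
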